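(* Assume that $X$ is ergodic and that the noise densities $g_i$, $i=1,\dots,d$, satisfy: (1) every $g_i$ is bounded; (2) all $g_i$ have the same support (i.e. the sets $\{g_i>0\}$ coincide up to $\varphi$-null sets); (3) $\int_{\mathbb{R}} g_i(u)\log g_j(u)\,\varphi(du)>-\infty$ for all $i,j$. Then for any pair $(\nu,\bar\nu)$ of probability distributions on $\mathbb{S}$, $$\gamma(\varepsilon)\le -\sum_{i=1}^d \mu_i\min_{j\ne i}\mathscr{D}(g_i\parallel g_j)+o(1),\qquad \varepsilon\to 0,$$ where $\mathscr{D}(g_i\parallel g_j)=\int_{\mathbb{R}} g_i(u)\log\frac{g_i(u)}{g_j(u)}\,\varphi(du)$ are the Kullback–Leibler relative entropies. For $d=2$ (and $\nu\neq\bar\nu$) this asymptotic is precise, i.e. $$\gamma(\varepsilon)=-\mu_1\mathscr{D}(g_1\parallel g_2)-\mu_2\mathscr{D}(g_2\parallel g_1)+o(1),\qquad \varepsilon\to 0.$$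
   Context: Let $\mathbb{S}=\{a_1,\dots,a_d\}\subset\mathbb{R}$ be a finite alphabet with $d\ge 2$ elements and let $X=(X_n)_{n\ge 0}$ be a Markov chain on $\mathbb{S}$ with transition matrix $\Lambda=(\lambda_{ij})$, $\lambda_{ij}=\mathsf{P}(X_n=a_j\mid X_{n-1}=a_i)$. $X$ is ergodic if the limits $\mu_i=\lim_{n\to\infty}\mathsf{P}(X_n=a_i)$ exist, are unique (do not depend on the initial law) and positive; equivalently, $\Lambda^q$ has all entries positive for some integer $q\ge1$. Then $\mu$ is the stationary distribution of $X$. For $\varepsilon\in(0,1)$ let $X^\varepsilon$ be the (slow) Markov chain on $\mathbb{S}$ with initial distribution $\nu$ ($\nu_i=\mathsf{P}(X^\varepsilon_0=a_i)$) and transition matrix $\Lambda^\varepsilon=(\lambda^\varepsilon_{ij})$, $\lambda^\varepsilon_{ij}=\varepsilon\lambda_{ij}$ for $i\ne j$ and $\lambda^\varepsilon_{ii}=1-\varepsilon\sum_{\ell\ne i}\lambda_{i\ell}$; it has the same invariant distribution $\mu$. Observations: $Y^\varepsilon_n=\sum_{i=1}^d \mathbf{1}_{\{X^\varepsilon_n=a_i\}}\xi_n(i)$, $n\ge1$, where $\xi=(\xi_n)_{n\ge1}$ is an i.i.d. sequence of random vectors, independent of the chain, with independent entries $\xi_n(i)$, $i=1,\dots,d$, such that $\mathsf{P}(\xi_1(i)\in B)=\int_B g_i(u)\,\varphi(du)$ for Borel $B\subseteq\mathbb{R}$, where $\varphi$ is a $\sigma$-finite reference measure on $\mathbb{R}$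 and $g_i$ are densities. Filter: let $G(y)$ be the diagonal matrix with entries $g_1(y),\dots,g_d(y)$, let $\Lambda^{\varepsilon *}$ be the transpose of $\Lambda^\varepsilon$, and $|x|=\sum_{i=1}^d|x_i|$ for $x\in\mathbb{R}^d$. Probability distributions on $\mathbb{S}$ are identified with column vectors in $\mathcal{S}^{d-1}=\{x\in\mathbb{R}^d:x_i\ge0,\ \sum_i x_i=1\}$. Let $\pi^\varepsilon$ and $\bar\pi^\varepsilon$ be the solutions of the recursion $$\pi_n=\frac{G(Y^\varepsilon_n)\Lambda^{\varepsilon *}\pi_{n-1}}{|G(Y^\varepsilon_n)\Lambda^{\varepsilon *}\pi_{n-1}|},\quad n\ge1,$$ started from $\pi^\varepsilon_0=\nu$ and $\bar\pi^\varepsilon_0=\bar\nu$ respectively (both driven by the same observations $Y^\varepsilon$, with $X^\varepsilon_0\sim\nu$). The stability index is $$\gamma(\varepsilon)=\lim_{n\to\infty}\frac1n\log|\pi^\varepsilon_n-\bar\pi^\varepsilon_n|\quad \mathsf{P}\text{-a.s.},$$ which exists under the stated assumptions; $\log 0=-\infty$. *)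

theory Defs
  imports "HOL-Probability.Probability" "HOL-Library.Landau_Symbols"
begin

text \<open>The states are indexed by a finite type \<open>'d\<close> with \<open>d = CARD('d)\<close>; the alphabet is the
  range of an injection \<open>a :: 'd \<Rightarrow> real\<close>.  A transition matrix has rows indexed by the current
  state, so \<open>L $ i $ j\<close> is the probability of a jump from \<open>a i\<close> to \<open>a j\<close>.\<close>

definition prob_vec :: "real ^ 'd::finite \<Rightarrow> bool" where
  "prob_vec p \<longleftrightarrow> (\<forall>i. 0 \<le> p $ i) \<and> (\<Sum>i\<in>UNIV. p $ i) = 1"

definition stochastic :: "real ^ 'd ^ 'd::finite \<Rightarrow> bool" where
  "stochastic L \<longleftrightarrow> (\<forall>i. prob_vec (L $ i))"

definition law_at :: "real ^ 'd ^ 'd::finite \<Rightarrow> real ^ 'd \<Rightarrow> nat \<Rightarrow> real ^ 'd" where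
  "law_at L p n = ((\<lambda>v. transpose L *v v) ^^ n) p"

text \<open>\<open>law_at L p n $ i\<close> is the probability that a chain with initial law \<open>p\<close> is in state \<open>a i\<close>
  at time \<open>n\<close>.  The limits must not depend on \<open>p\<close>.\<close>

definition ergodic_with_limits :: "real ^ 'd ^ 'd::finite \<Rightarrow> real ^ 'd \<Rightarrow> bool" where
  "ergodic_with_limits L \<mu> \<longleftrightarrow>
     (\<forall>i. \<mu> $ i > 0) \<and>
     (\<forall>p. prob_vec p \<longrightarrow> (\<forall>i. (\<lambda>n. law_at L p n $ i) \<longlonglongrightarrow> \<mu> $ i))"

definition slow :: "real ^ 'd ^ 'd::finite \<Rightarrow> real \<Rightarrow> real ^ 'd ^ 'd" where
  "slow L \<epsilon> =
     (\<chi> i j. if i = j then 1 - \<epsilon> * (\<Sum>l\<in>UNIV - {i}. L $ i $ l) else \<epsilon> * L $ i $ j)"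

definition markov_chain ::
  "'w measure \<Rightarrow> ('d::finite \<Rightarrow> real) \<Rightarrow> real ^ 'd \<Rightarrow> real ^ 'd ^ 'd \<Rightarrow> (nat \<Rightarrow> 'w \<Rightarrow> real) \<Rightarrow> bool" where
  "markov_chain M a \<nu> L X \<longleftrightarrow>
     (\<forall>n. X n \<in> borel_measurable M) \<and>
     (\<forall>n. \<forall>\<omega>\<in>space M. X n \<omega> \<in> range a) \<and>
     (\<forall>i. \<P>(\<omega> in M. X 0 \<omega> = a i) = \<nu> $ i) \<and>
     (\<forall>n (s :: nat \<Rightarrow> 'd). \<P>(\<omega> in M. \<forall>k\<le>n. X k \<omega> = a (s k)) > 0 \<longrightarrow>
        \<P>(\<omega> in M. X (Suc n) \<omega> = a (s (Suc n)) \<bar> \<forall>k\<le>n. X k \<omega> = a (s k))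
          = L $ s n $ s (Suc n))"

text \<open>Independence of all the scalar variables \<open>\<xi> n i\<close>, with a law depending on \<open>i\<close> only, is
  the same as: the vectors \<open>\<xi> n\<close> are i.i.d. and have independent entries.
  Only the times \<open>n \<ge> 1\<close> matter.\<close>

definition noise ::
  "'w measure \<Rightarrow> real measure \<Rightarrow> ('d::finite \<Rightarrow> real \<Rightarrow> real) \<Rightarrow> (nat \<Rightarrow> 'd \<Rightarrow> 'w \<Rightarrow> real) \<Rightarrow> bool" where
  "noise M \<phi> g \<xi> \<longleftrightarrow>
     prob_space.indep_vars M (\<lambda>_. borel) (\<lambda>(n, i). \<xi> n i) ({1..} \<times> UNIV) \<and>
     (\<forall>n\<ge>1. \<forall>i. distributed M \<phi> (\<xi> n i) (\<lambda>u. ennreal (g i u)))"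

definition indep_chain_noise ::
  "'w measure \<Rightarrow> (nat \<Rightarrow> 'w \<Rightarrow> real) \<Rightarrow> (nat \<Rightarrow> 'd::finite \<Rightarrow> 'w \<Rightarrow> real) \<Rightarrow> bool" where
  "indep_chain_noise M X \<xi> \<longleftrightarrow>
     prob_space.indep_set M
       (sets (vimage_algebra (space M) (\<lambda>\<omega> n. X n \<omega>) (PiM UNIV (\<lambda>_::nat. borel))))
       (sets (vimage_algebra (space M) (\<lambda>\<omega>. \<lambda>(n, i)\<in>{1..} \<times> UNIV. \<xi> n i \<omega>)
          (PiM ({1..} \<times> UNIV) (\<lambda>_::nat \<times> 'd. borel))))"

definition observation ::
  "('d::finite \<Rightarrow> real) \<Rightarrow> (nat \<Rightarrow> 'w \<Rightarrow> real) \<Rightarrow> (nat \<Rightarrow> 'd \<Rightarrow> 'w \<Rightarrow> real) \<Rightarrow> nat \<Rightarrow> 'w \<Rightarrow> real" where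
  "observation a X \<xi> n \<omega> = (\<Sum>i\<in>UNIV. of_bool (X n \<omega> = a i) * \<xi> n i \<omega>)"

text \<open>The library norm on \<open>real ^ 'd\<close> is Euclidean, hence a separate \<open>l\<^sup>1\<close> norm.\<close>

definition l1_norm :: "real ^ 'd::finite \<Rightarrow> real" where
  "l1_norm x = (\<Sum>i\<in>UNIV. \<bar>x $ i\<bar>)"

definition density_matrix :: "('d::finite \<Rightarrow> real \<Rightarrow> real) \<Rightarrow> real \<Rightarrow> real ^ 'd ^ 'd" where
  "density_matrix g y = (\<chi> i j. if i = j then g i y else 0)"

primrec nl_filter ::
  "('d::finite \<Rightarrow> real \<Rightarrow> real) \<Rightarrow> real ^ 'd ^ 'd \<Rightarrow> (nat \<Rightarrow> real) \<Rightarrow> real ^ 'd \<Rightarrow> nat \<Rightarrow> real ^ 'd" where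
  "nl_filter g L y p 0 = p"
| "nl_filter g L y p (Suc n) =
     (let v = density_matrix g (y (Suc n)) *v (transpose L *v nl_filter g L y p n)
      in v /\<^sub>R l1_norm v)"

text \<open>Logarithm on \<open>[0, \<infinity>)\<close> with \<open>log 0 = -\<infinity>\<close> (the library has \<open>ln 0 = 0\<close>).\<close>

definition ext_log :: "real \<Rightarrow> ereal" where
  "ext_log x = (if x = 0 then -\<infinity> else ereal (ln x))"

definition has_stability_index ::
  "(nat \<Rightarrow> real ^ 'd::finite) \<Rightarrow> (nat \<Rightarrow> real ^ 'd) \<Rightarrow> ereal \<Rightarrow> bool" where
  "has_stability_index p q \<gamma> \<longleftrightarrow>
     (\<lambda>n. ereal (1 / real n) * ext_log (l1_norm (p n - q n))) \<longlonglongrightarrow> \<gamma>"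

definition kl_div :: "real measure \<Rightarrow> (real \<Rightarrow> real) \<Rightarrow> (real \<Rightarrow> real) \<Rightarrow> real" where
  "kl_div \<phi> p q = (LINT u|\<phi>. p u * ln (p u / q u))"

lemma kl_div_eq_KL_divergence:
  assumes "sigma_finite_measure \<phi>"
    and "p \<in> borel_measurable \<phi>" "q \<in> borel_measurable \<phi>"
    and "\<And>u. 0 \<le> p u" "\<And>u. 0 \<le> q u"
    and "AE u in \<phi>. q u = 0 \<longrightarrow> p u = 0"
  shows "kl_div \<phi> p q = KL_divergence (exp 1) (density \<phi> q) (density \<phi> p)"
  using sigma_finite_measure.KL_density_density[of \<phi> "exp 1" q p] assms
  by (simp add: kl_div_def log_def)

text \<open>For a bounded probability density \<open>p\<close> and a bounded \<open>q\<close> the positive part of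
  \<open>p * ln q\<close> is integrable, so the extended integral of \<open>p * ln q\<close> is \<open>> -\<infinity>\<close> iff the negative
  part has finite integral; \<open>ennreal\<close> truncates negative reals to \<open>0\<close>.  With the library
  convention \<open>ln 0 = 0\<close>, points where \<open>p > 0 = q\<close> contribute nothing; this is harmless since
  they form a null set when \<open>p\<close> and \<open>q\<close> have the same support.\<close>

definition log_integral_finite :: "real measure \<Rightarrow> (real \<Rightarrow> real) \<Rightarrow> (real \<Rightarrow> real) \<Rightarrow> bool" where
  "log_integral_finite \<phi> p q \<longleftrightarrow> (\<integral>\<^sup>+ u. ennreal (- (p u * ln (q u))) \<partial>\<phi>) < \<infinity>"

end

theory Submission
  imports Defs "HOL-Real_Asymp.Real_Asymp"
begin

text \<open>Rescale the unnormalized filter at each step by the density of the true state, so that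
  only the ratios \<open>g\<^sub>k/g\<^sub>i\<close> enter. The \<open>l\<^sup>1\<close> distance of two filters is a sum of two-by-two minors
  of the rescaled filters divided by the product of their masses.

  Upper bound. Given the path of the chain, the expectation of the \<open>\<theta>\<close>-th power of a minor,
  \<open>\<theta> \<le> 1/2\<close>, grows at each step in state \<open>i\<close> by at most the largest over \<open>k \<noteq> l\<close> of
  \<open>\<integral> g\<^sub>i (g\<^sub>k g\<^sub>l/g\<^sub>i\<^sup>2)\<^sup>\<theta> d\<phi>\<close>, plus \<open>O(\<epsilon>\<^sup>\<theta>)\<close> for the jumps. Markov's inequality and the ergodic
  theorem turn this into an almost sure growth rate, and as \<open>\<theta> \<rightarrow> 0\<close> the moment is
  \<open>1 - \<theta> (D(g\<^sub>i \<parallel> g\<^sub>k) + D(g\<^sub>i \<parallel> g\<^sub>l)) + o(\<theta>)\<close>, where one of \<open>k, l\<close> differs from \<open>i\<close>. The mass is at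
  least a constant times the probability of the path, hence subexponential up to a factor that
  vanishes with \<open>\<epsilon>\<close>.

  For two states the minor is an explicit product, the mass has expectation \<open>1\<close> given the path, and
  the law of large numbers gives the matching lower bound.\<close>

section \<open>Deterministic preliminaries and the filter recursion\<close>

text \<open>Raising the minors to a small power does two things. Subadditivity of
  \<open>x powr \<theta>\<close> turns their signed recursion into a positive linear one that can be
  integrated, and the moments become finite, since exponents up to 1/2 are controlled by the means
  of the likelihood ratios. The entropies appear only as slopes at exponent 0. The price is that a
  jump costs \<epsilon>^\<theta>, so the order of choices is forced: the tolerance fixes \<theta>,
  and only then does \<epsilon> tend to 0. The almost sure growth bounds rest on one mechanism in
  place of martingale convergence: nonnegative variables with bounded expectations are eventually
  below exp(\<delta> n) for every \<delta> > 0. Applied to products of factors 1 + t D with centred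
  bounded D, it also yields laws of large numbers. The lower bound for two states averages
  log-ratios that are merely integrable; there an estimate along a subsequence of times is enough,
  because the stability index is given as a limit.\<close>

lemma (in prob_space) AE_eventually_le_exp:
  fixes Z :: "nat \<Rightarrow> 'a \<Rightarrow> real"
  assumes meas[measurable]: "\<And>n. Z n \<in> borel_measurable M"
    and "0 \<le> C" and bound: "\<And>n. (\<integral>\<^sup>+\<omega>. ennreal (Z n \<omega>) \<partial>M) \<le> ennreal C"
  shows "AE \<omega> in M. \<forall>\<delta>>0. \<forall>\<^sub>F n in sequentially. Z n \<omega> \<le> exp (\<delta> * real n)"
proof -
  \<comment> \<open>With summable weights of polynomial decay the weighted sum of the
    \<open>Z n\<close> has finite expectation. It is then almost surely finite, so
    \<open>Z n\<close> grows at most quadratically; this exceptional set does not depend on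
    \<delta>.\<close>
  define w where "w n = 1 / (real n + 1)\<^sup>2" for n
  have w: "w n > 0" for n by (simp add: w_def)
  have sw: "summable w"
    using inverse_squares_sums unfolding w_def by (auto simp: sums_iff add.commute)
  define W where "W \<omega> = (\<Sum>n. ennreal (Z n \<omega>) * ennreal (w n))" for \<omega>
  have [measurable]: "W \<in> borel_measurable M" unfolding W_def by measurable
  have "(\<integral>\<^sup>+\<omega>. W \<omega> \<partial>M) = (\<Sum>n. \<integral>\<^sup>+\<omega>. ennreal (Z n \<omega>) * ennreal (w n) \<partial>M)"
    unfolding W_def by (rule nn_integral_suminf) measurable
  also have "\<dots> = (\<Sum>n. (\<integral>\<^sup>+\<omega>. ennreal (Z n \<omega>) \<partial>M) * ennreal (w n))"
    by (simp add: nn_integral_multc)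
  also have "\<dots> \<le> (\<Sum>n. ennreal C * ennreal (w n))"
    by (intro suminf_le mult_right_mono bound) auto
  also have "\<dots> = (\<Sum>n. ennreal (C * w n))"
    using \<open>0 \<le> C\<close> w by (intro suminf_cong) (simp add: ennreal_mult less_imp_le)
  also have "\<dots> = ennreal (\<Sum>n. C * w n)"
    using \<open>0 \<le> C\<close> w sw by (intro suminf_ennreal2) (auto simp: less_imp_le intro: summable_mult)
  also have "\<dots> < \<infinity>" by simp
  finally have "(\<integral>\<^sup>+\<omega>. W \<omega> \<partial>M) \<noteq> \<infinity>" by simp
  then have "AE \<omega> in M. W \<omega> \<noteq> \<infinity>"
    by (intro nn_integral_PInf_AE) auto
  then show ?thesis
  proof eventually_elim
    case (elim \<omega>)
    then obtain K where K: "0 \<le> K" "W \<omega> = ennreal K" by (cases "W \<omega>") auto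
    have le: "Z n \<omega> \<le> K * (real n + 1)\<^sup>2" for n
    proof -
      have "(\<Sum>m\<in>{n}. ennreal (Z m \<omega>) * ennreal (w m)) \<le> W \<omega>"
        unfolding W_def by (rule sum_le_suminf) auto
      then have "ennreal (Z n \<omega> * w n) \<le> ennreal K"
        using K w[of n] by (simp add: ennreal_mult'')
      then have "Z n \<omega> * w n \<le> K" using K by simp
      then show ?thesis by (simp add: w_def field_simps)
    qed
    show ?case
    proof (intro allI impI)
      fix \<delta> :: real assume "\<delta> > 0"
      then have "((\<lambda>n. K * ((real n + 1)\<^sup>2 / exp (\<delta> * real n))) \<longlongrightarrow> K * 0) sequentially"
        by (intro tendsto_mult tendsto_const) real_asymp
      then have "\<forall>\<^sub>F n in sequentially. K * ((real n + 1)\<^sup>2 / exp (\<delta> * real n)) < 1"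
        by (intro order_tendstoD) auto
      then show "\<forall>\<^sub>F n in sequentially. Z n \<omega> \<le> exp (\<delta> * real n)"
      proof eventually_elim
        case (elim n)
        then have "K * (real n + 1)\<^sup>2 < exp (\<delta> * real n)"
          by (simp add: field_simps)
        with le[of n] show ?case by linarith
      qed
    qed
  qed
qed

lemma eventually_sum_le_of_prod_le_exp:
  fixes D :: "nat \<Rightarrow> real"
  assumes D: "\<And>k. \<bar>D k\<bar> \<le> K" and t: "\<bar>t\<bar> * K \<le> 1 / 2"
    and prod: "\<forall>\<delta>>0. \<forall>\<^sub>F n in sequentially. (\<Prod>k<n. 1 + t * D k) \<le> exp (\<delta> * real n)"
    and "\<delta> > 0"
  shows "\<forall>\<^sub>F n in sequentially. t * (\<Sum>k<n. D k) \<le> (\<delta> + 2 * t\<^sup>2 * K\<^sup>2) * real n"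
proof -
  have tD: "\<bar>t * D k\<bar> \<le> 1 / 2" for k
    using mult_left_mono[OF D[of k], of "\<bar>t\<bar>"] t by (simp add: abs_mult)
  \<comment> \<open>The quadratic error of the logarithm near 1, valid for arguments up to 1/2; it
    is beaten later by taking t small.\<close>
  have ln: "ln (1 + t * D k) \<ge> t * D k - 2 * t\<^sup>2 * K\<^sup>2" for k
  proof -
    have "\<bar>ln (1 + t * D k) - t * D k\<bar> \<le> 2 * (t * D k)\<^sup>2"
      using tD by (rule abs_ln_one_plus_x_minus_x_bound)
    moreover have "(D k)\<^sup>2 \<le> K\<^sup>2"
      using D[of k] by (metis abs_ge_zero power2_abs power_mono)
    then have "2 * (t * D k)\<^sup>2 \<le> 2 * t\<^sup>2 * K\<^sup>2"
      by (simp add: power_mult_distrib mult_left_mono)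
    ultimately show ?thesis by linarith
  qed
  have pos: "1 + t * D k > 0" for k using tD[of k] by linarith
  from prod \<open>\<delta> > 0\<close> have "\<forall>\<^sub>F n in sequentially. (\<Prod>k<n. 1 + t * D k) \<le> exp (\<delta> * real n)"
    by blast
  then show ?thesis
  proof eventually_elim
    case (elim n)
    have "(\<Sum>k<n. t * D k - 2 * t\<^sup>2 * K\<^sup>2) \<le> (\<Sum>k<n. ln (1 + t * D k))"
      by (intro sum_mono ln)
    also have "\<dots> = ln (\<Prod>k<n. 1 + t * D k)"
      by (intro ln_prod[symmetric]) (simp_all, use pos in \<open>metis less_irrefl\<close>)
    also have "\<dots> \<le> ln (exp (\<delta> * real n))"
      using elim pos by (subst ln_le_cancel_iff) (auto intro!: prod_pos)
    finally show ?case
      by (simp add: sum_subtractf sum_distrib_left[symmetric] algebra_simps)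
  qed
qed

text \<open>A law of large numbers by exponential moments. Dividing the previous bound by |t| leaves
  an error \<delta>/|t| + 2 |t| K^2, so t is made small first and \<delta> afterwards. Only the
  values 1/N and -1/N of t occur, so that a countable union of null sets suffices in the
  applications.\<close>

lemma mean_tendsto_0_of_prod_le_exp:
  fixes D :: "nat \<Rightarrow> real"
  assumes D: "\<And>k. \<bar>D k\<bar> \<le> K"
    and prod: "\<And>N t. real N \<ge> 2 * K \<Longrightarrow> N > 0 \<Longrightarrow> \<bar>t\<bar> = 1 / real N \<Longrightarrow>
      \<forall>\<delta>>0. \<forall>\<^sub>F n in sequentially. (\<Prod>k<n. 1 + t * D k) \<le> exp (\<delta> * real n)"
  shows "(\<lambda>n. (\<Sum>k<n. D k) / real n) \<longlonglongrightarrow> 0"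
proof (rule tendstoI)
  fix e :: real assume e: "e > 0"
  have K: "K \<ge> 0" using D[of 0] by linarith
  \<comment> \<open>N makes the quadratic error at most e/2. The choice \<delta> = e/(4N) leaves e/4
    after multiplication by N, in total 3e/4.\<close>
  obtain N :: nat where N: "real N > 2 * K + 1 + 4 * K\<^sup>2 / e"
    using reals_Archimedean2 by blast
  have ge: "2 * K \<ge> 0" "4 * K\<^sup>2 / e \<ge> 0" using K e by auto
  have N2: "real N \<ge> 2 * K" "N > 0"
    using N ge by (linarith, cases "N = 0", auto)
  have NK: "2 * (1 / real N) * K\<^sup>2 \<le> e / 2"
  proof -
    have "real N \<ge> 4 * K\<^sup>2 / e" using N ge by linarith
    then show ?thesis using e N2 by (simp add: field_simps)
  qed
  define \<delta> where "\<delta> = e / (4 * real N)"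
  have \<delta>: "\<delta> > 0" using e N2 by (simp add: \<delta>_def)
  have key: "\<forall>\<^sub>F n in sequentially. \<sigma> * (\<Sum>k<n. D k) \<le> (3 * e / 4) * real n" if "\<bar>\<sigma>\<bar> = 1" for \<sigma> :: real
  proof -
    let ?t = "\<sigma> / real N"
    have t: "\<bar>?t\<bar> = 1 / real N" using that N2 by simp
    have tK: "\<bar>?t\<bar> * K \<le> 1 / 2" unfolding t using N2 by (simp add: field_simps)
    have "?t\<^sup>2 = (1 / real N)\<^sup>2" using t by (metis power2_abs)
    then have "\<forall>\<^sub>F n in sequentially. ?t * (\<Sum>k<n. D k) \<le> (\<delta> + 2 * (1 / real N)\<^sup>2 * K\<^sup>2) * real n"
      using eventually_sum_le_of_prod_le_exp[OF D tK prod[OF N2 t] \<delta>] by simp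
    then show ?thesis
    proof eventually_elim
      case (elim n)
      have "\<sigma> * (\<Sum>k<n. D k) = real N * (?t * (\<Sum>k<n. D k))" using N2 by simp
      also have "\<dots> \<le> real N * ((\<delta> + 2 * (1 / real N)\<^sup>2 * K\<^sup>2) * real n)"
        using elim by (rule mult_left_mono) simp
      also have "\<dots> = (e / 4 + 2 * (1 / real N) * K\<^sup>2) * real n"
        using N2 by (simp add: \<delta>_def field_simps power2_eq_square)
      also have "\<dots> \<le> (e / 4 + e / 2) * real n"
        using NK by (intro mult_right_mono add_left_mono) auto
      finally show ?case by simp
    qed
  qed
  have "\<forall>\<^sub>F n in sequentially. 1 * (\<Sum>k<n. D k) \<le> (3 * e / 4) * real n"
    "\<forall>\<^sub>F n in sequentially. -1 * (\<Sum>k<n. D k) \<le> (3 * e / 4) * real n"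
    by (rule key, simp)+
  from this eventually_gt_at_top[of 0]
  show "\<forall>\<^sub>F n in sequentially. dist ((\<Sum>k<n. D k) / real n) 0 < e"
  proof eventually_elim
    case (elim n)
    then have "\<bar>\<Sum>k<n. D k\<bar> \<le> (3 * e / 4) * real n" by auto
    also have "\<dots> < e * real n" using e elim by simp
    finally show ?case using elim by (simp add: field_simps)
  qed
qed

text \<open>After division by the sum each term lies in [0,1], where a power \<theta> <= 1 can only
  enlarge it.\<close>

lemma sum_powr_le:
  fixes x :: "'i \<Rightarrow> real"
  assumes "finite I" "\<And>i. i \<in> I \<Longrightarrow> 0 \<le> x i" "0 < \<theta>" "\<theta> \<le> 1"
  shows "(\<Sum>i\<in>I. x i) powr \<theta> \<le> (\<Sum>i\<in>I. x i powr \<theta>)"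
proof (cases "(\<Sum>i\<in>I. x i) = 0")
  case True
  then show ?thesis by (simp add: sum_nonneg)
next
  case False
  define S where "S = (\<Sum>i\<in>I. x i)"
  have S: "S > 0" using False assms by (simp add: S_def sum_nonneg less_le)
  have "x i / S \<le> x i powr \<theta> / S powr \<theta>" if "i \<in> I" for i
  proof -
    have "x i \<le> S" unfolding S_def using assms that by (intro member_le_sum) auto
    then have "x i / S \<le> 1" "0 \<le> x i / S" using S assms that by auto
    then have "(x i / S) powr 1 \<le> (x i / S) powr \<theta>"
      using \<open>\<theta> \<le> 1\<close> by (intro powr_mono') auto
    then show ?thesis using \<open>0 \<le> x i / S\<close> S assms that by (simp add: powr_divide)
  qed
  then have "(\<Sum>i\<in>I. x i / S) \<le> (\<Sum>i\<in>I. x i powr \<theta> / S powr \<theta>)" by (rule sum_mono)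
  moreover have "(\<Sum>i\<in>I. x i / S) = 1"
    using S by (simp add: sum_divide_distrib[symmetric] flip: S_def)
  ultimately have "1 \<le> (\<Sum>i\<in>I. x i powr \<theta>) / S powr \<theta>" by (simp add: sum_divide_distrib)
  then show ?thesis using S by (simp add: S_def[symmetric] field_simps)
qed

text \<open>A positive linear recursion whose weights depend on the true state and the observation.
  It is used over three index types: states (the rescaled filter), pairs of states (powers of
  minors) and \<open>unit\<close> (plain products along the path), so that one moment bound serves
  all three.\<close>

primrec lin_rec ::
  "('d \<Rightarrow> 'x::finite \<Rightarrow> real \<Rightarrow> real) \<Rightarrow> ('x \<Rightarrow> 'x \<Rightarrow> real) \<Rightarrow> (nat \<Rightarrow> 'd) \<Rightarrow> (nat \<Rightarrow> real) \<Rightarrow>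
    ('x \<Rightarrow> real) \<Rightarrow> nat \<Rightarrow> 'x \<Rightarrow> real" where
  "lin_rec r A s y T 0 = T"
| "lin_rec r A s y T (Suc n) =
     (\<lambda>x. r (s (Suc n)) x (y (Suc n)) * (\<Sum>z\<in>UNIV. A z x * lin_rec r A s y T n z))"

lemma lin_rec_nonneg:
  assumes "\<And>i x u. 0 \<le> r i x u" "\<And>z x. 0 \<le> A z x" "\<And>x. 0 \<le> T x"
  shows "0 \<le> lin_rec r A s y T n x"
  by (induction n arbitrary: x) (auto intro!: mult_nonneg_nonneg sum_nonneg assms)

lemma lin_rec_cong:
  assumes "\<And>k. 1 \<le> k \<Longrightarrow> k \<le> n \<Longrightarrow> s k = s' k" "\<And>k. 1 \<le> k \<Longrightarrow> k \<le> n \<Longrightarrow> y k = y' k"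
  shows "lin_rec r A s y T n = lin_rec r A s' y' T n"
  using assms by (induction n) auto

abbreviation ratio :: "('d \<Rightarrow> real \<Rightarrow> real) \<Rightarrow> 'd \<Rightarrow> 'd \<Rightarrow> real \<Rightarrow> real" where
  "ratio g i k u \<equiv> g k u / g i u"

text \<open>Dividing the unnormalized filter at each step by the density of the true state does not
  change the normalized filter, and makes the moments below finite.\<close>

definition ratio_filter ::
  "('d::finite \<Rightarrow> real \<Rightarrow> real) \<Rightarrow> real ^ 'd ^ 'd \<Rightarrow> (nat \<Rightarrow> 'd) \<Rightarrow> (nat \<Rightarrow> real) \<Rightarrow> real ^ 'd \<Rightarrow>
    nat \<Rightarrow> 'd \<Rightarrow> real" where
  "ratio_filter g L s y p = lin_rec (ratio g) (\<lambda>i j. L $ i $ j) s y (\<lambda>i. p $ i)"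

lemma ratio_filter_0 [simp]: "ratio_filter g L s y p 0 k = p $ k"
  by (simp add: ratio_filter_def)

lemma ratio_filter_Suc:
  "ratio_filter g L s y p (Suc n) k = g k (y (Suc n)) / g (s (Suc n)) (y (Suc n)) *
     (\<Sum>j\<in>UNIV. L $ j $ k * ratio_filter g L s y p n j)"
  by (simp add: ratio_filter_def)

text \<open>The two-by-two minors of a pair of filters follow the second exterior power of the filter
  equation.\<close>

definition minor ::
  "('d::finite \<Rightarrow> real \<Rightarrow> real) \<Rightarrow> real ^ 'd ^ 'd \<Rightarrow> (nat \<Rightarrow> 'd) \<Rightarrow> (nat \<Rightarrow> real) \<Rightarrow> real ^ 'd \<Rightarrow>
    real ^ 'd \<Rightarrow> nat \<Rightarrow> 'd \<Rightarrow> 'd \<Rightarrow> real" where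
  "minor g L s y p q n k l = ratio_filter g L s y p n k * ratio_filter g L s y q n l
     - ratio_filter g L s y p n l * ratio_filter g L s y q n k"

section \<open>Positivity, normalization and minors of filters along one observation
  sequence\<close>

context
  fixes g :: "'d::finite \<Rightarrow> real \<Rightarrow> real" and L :: "real ^ 'd ^ 'd" and s :: "nat \<Rightarrow> 'd"
    and y :: "nat \<Rightarrow> real"
  assumes gpos: "\<And>n k. g k (y (Suc n)) > 0" and Lnn: "\<And>i j. 0 \<le> L $ i $ j"
begin

lemma ratio_filter_nonneg:
  assumes "prob_vec p"
  shows "0 \<le> ratio_filter g L s y p n k"
proof (induction n arbitrary: k)
  case 0
  then show ?case using assms by (simp add: prob_vec_def)
next
  case (Suc n)
  then show ?case unfolding ratio_filter_Suc
    using gpos Lnn by (intro mult_nonneg_nonneg divide_nonneg_pos sum_nonneg) (auto simp: less_imp_le)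
qed

lemma ratio_filter_step_ge:
  assumes "prob_vec p"
  shows "g k (y (Suc n)) / g (s (Suc n)) (y (Suc n)) * (L $ j $ k * ratio_filter g L s y p n j)
    \<le> ratio_filter g L s y p (Suc n) k"
  unfolding ratio_filter_Suc
proof (rule mult_left_mono)
  show "L $ j $ k * ratio_filter g L s y p n j \<le> (\<Sum>j\<in>UNIV. L $ j $ k * ratio_filter g L s y p n j)"
    by (rule member_le_sum[where f="\<lambda>j. L $ j $ k * ratio_filter g L s y p n j"])
      (simp_all add: Lnn ratio_filter_nonneg[OF assms])
qed (use gpos in \<open>simp add: less_imp_le\<close>)

lemma ratio_filter_pos_step:
  assumes "prob_vec p" "L $ j $ k > 0" "ratio_filter g L s y p n j > 0"
  shows "ratio_filter g L s y p (Suc n) k > 0"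
proof -
  have "0 < g k (y (Suc n)) / g (s (Suc n)) (y (Suc n)) * (L $ j $ k * ratio_filter g L s y p n j)"
    using assms(2,3) gpos by (intro mult_pos_pos divide_pos_pos)
  then show ?thesis using ratio_filter_step_ge[OF assms(1)] by (rule less_le_trans)
qed

text \<open>The filter charges every state that the chain with matrix \<open>\<Lambda>\<close> can
  reach from \<open>p\<close> in the same time. This transfers positivity from the ergodic fast
  chain.\<close>

lemma ratio_filter_pos:
  assumes p: "prob_vec p" and Lp: "\<And>i j. \<Lambda> $ i $ j > 0 \<Longrightarrow> L $ i $ j > 0"
    and \<Lambda>: "\<And>i j. 0 \<le> \<Lambda> $ i $ j" and "law_at \<Lambda> p n $ k > 0"
  shows "ratio_filter g L s y p n k > 0"
  using assms(4)
proof (induction n arbitrary: k)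
  case 0
  then show ?case by (simp add: law_at_def)
next
  case (Suc n)
  have "(\<Sum>j\<in>UNIV. \<Lambda> $ j $ k * law_at \<Lambda> p n $ j) > 0"
    using Suc.prems by (simp add: law_at_def matrix_vector_mult_def transpose_def)
  then obtain j where j: "\<Lambda> $ j $ k * law_at \<Lambda> p n $ j > 0"
    using sum_nonpos[of UNIV "\<lambda>j. \<Lambda> $ j $ k * law_at \<Lambda> p n $ j"] by (force simp: not_less)
  then have "\<Lambda> $ j $ k > 0" "law_at \<Lambda> p n $ j > 0"
    using \<Lambda>[of j k] by (auto simp: zero_less_mult_iff)
  then show ?case using Suc.IH ratio_filter_pos_step p Lp by blast
qed

text \<open>Positive holding probabilities keep a state charged by \<open>p\<close> charged forever,
  so normalization never divides by zero.\<close>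

lemma ratio_filter_sum_pos:
  assumes p: "prob_vec p" and diag: "\<And>i. L $ i $ i > 0"
  shows "(\<Sum>k\<in>UNIV. ratio_filter g L s y p n k) > 0"
proof -
  have "\<exists>k. p $ k > 0"
    using p sum_nonpos[of UNIV "\<lambda>k. p $ k"] unfolding prob_vec_def by (force simp: not_less)
  then obtain k where k: "p $ k > 0" ..
  have "ratio_filter g L s y p n k > 0"
  proof (induction n)
    case (Suc n)
    then show ?case by (rule ratio_filter_pos_step[OF p diag])
  qed (simp add: k)
  also have "ratio_filter g L s y p n k \<le> (\<Sum>k\<in>UNIV. ratio_filter g L s y p n k)"
    by (rule member_le_sum) (simp_all add: ratio_filter_nonneg[OF p])
  finally show ?thesis .
qed

lemma nl_filter_eq_ratio_filter:
  assumes p: "prob_vec p" and diag: "\<And>i. L $ i $ i > 0"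
  shows "nl_filter g L y p n $ k =
    ratio_filter g L s y p n k / (\<Sum>l\<in>UNIV. ratio_filter g L s y p n l)"
proof (induction n arbitrary: k)
  case 0
  then show ?case using p by (simp add: prob_vec_def)
next
  case (Suc n)
  define R where "R = ratio_filter g L s y p"
  define S where "S n = (\<Sum>l\<in>UNIV. R n l)" for n
  have S: "S n > 0" for n using ratio_filter_sum_pos[OF assms] by (simp add: S_def R_def)
  \<comment> \<open>The density of the true state put back, over the old mass: the factor is common
    to all coordinates and cancels in the normalization.\<close>
  define c where "c = g (s (Suc n)) (y (Suc n)) / S n"
  have c: "c > 0" using S gpos by (simp add: c_def)
  define v where "v = density_matrix g (y (Suc n)) *v (transpose L *v nl_filter g L y p n)"
  have IH: "nl_filter g L y p n $ k = R n k / S n" for k using Suc by (simp add: R_def S_def)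
  have v: "v $ k = c * R (Suc n) k" for k
  proof -
    have "v $ k = g k (y (Suc n)) * (transpose L *v nl_filter g L y p n) $ k"
      unfolding v_def density_matrix_def matrix_vector_mult_def[of "\<chi> i j. _ i j"]
      by (simp add: if_distrib[where f="\<lambda>x. x * _"] cong: if_cong)
    also have "\<dots> = g k (y (Suc n)) * ((\<Sum>i\<in>UNIV. L $ i $ k * R n i) / S n)"
      by (simp add: matrix_vector_mult_def transpose_def IH sum_divide_distrib)
    also have "\<dots> = c * R (Suc n) k"
      using gpos[of "s (Suc n)" n] by (simp add: c_def R_def ratio_filter_Suc)
    finally show ?thesis .
  qed
  have "l1_norm v = c * S (Suc n)"
    using c ratio_filter_nonneg[OF p, of "Suc n"]
    by (simp add: l1_norm_def v abs_mult S_def sum_distrib_left R_def del: nl_filter.simps)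
  moreover have "nl_filter g L y p (Suc n) = v /\<^sub>R l1_norm v"
    unfolding v_def by (simp only: nl_filter.simps Let_def)
  ultimately show ?case
    using c by (simp add: v field_simps flip: S_def R_def del: nl_filter.simps)
qed

text \<open>The ratio of the true state to itself is 1, so following the true path costs only its
  transition probabilities; all other contributions are nonnegative. The bound is free of the
  observations.\<close>

lemma ratio_filter_path_ge:
  assumes p: "prob_vec p"
  shows "ratio_filter g L s y p m (s m) * (\<Prod>k=m..<m+n. L $ s k $ s (Suc k))
    \<le> ratio_filter g L s y p (m + n) (s (m + n))"
proof (induction n)
  case (Suc n)
  have "ratio_filter g L s y p m (s m) * (\<Prod>k=m..<m+Suc n. L $ s k $ s (Suc k)) =
    L $ s (m + n) $ s (Suc (m + n)) * (ratio_filter g L s y p m (s m) * (\<Prod>k=m..<m+n. L $ s k $ s (Suc k)))"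
    by simp
  also have "\<dots> \<le> L $ s (m + n) $ s (Suc (m + n)) * ratio_filter g L s y p (m + n) (s (m + n))"
    using Suc Lnn by (rule mult_left_mono)
  also have "\<dots> \<le> ratio_filter g L s y p (Suc (m + n)) (s (Suc (m + n)))"
    using ratio_filter_step_ge[OF p, of "s (Suc (m + n))" "m + n" "s (m + n)"] gpos[of "s (Suc (m+n))" "m+n"]
    by simp
  finally show ?case by simp
qed simp

text \<open>Cauchy-Binet for two-by-two minors, summed over ordered pairs of old states so that the
  coefficients are products of entries and hence nonnegative.\<close>

lemma minor_Suc:
  "minor g L s y p q (Suc n) k l = ratio g (s (Suc n)) k (y (Suc n)) * ratio g (s (Suc n)) l (y (Suc n)) *
     (\<Sum>z\<in>UNIV. L $ fst z $ k * L $ snd z $ l * minor g L s y p q n (fst z) (snd z))"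
proof -
  let ?P = "ratio_filter g L s y p n" and ?Q = "ratio_filter g L s y q n"
  have 1: "(\<Sum>i\<in>UNIV. L $ i $ k * P i) * (\<Sum>j\<in>UNIV. L $ j $ l * Q j) =
     (\<Sum>z\<in>UNIV. L $ fst z $ k * L $ snd z $ l * (P (fst z) * Q (snd z)))" for P Q :: "'d \<Rightarrow> real"
    by (simp add: sum_product sum.cartesian_product UNIV_Times_UNIV[symmetric] split_beta mult_ac
        del: UNIV_Times_UNIV)
  have 2: "(\<Sum>i\<in>UNIV. L $ i $ l * ?P i) * (\<Sum>j\<in>UNIV. L $ j $ k * ?Q j) =
     (\<Sum>z\<in>UNIV. L $ fst z $ k * L $ snd z $ l * (?P (snd z) * ?Q (fst z)))"
    using 1[of ?Q ?P] by (simp add: mult.commute)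
  have 3: "(a * A) * (b * B) - (b * C) * (a * D) = a * b * (A * B - C * D)" for a b A B C D :: real
    by (simp add: algebra_simps)
  show ?thesis
    unfolding minor_def ratio_filter_Suc 3 1 2 sum_subtractf[symmetric]
    by (simp add: right_diff_distrib)
qed

text \<open>Absolute values give up the cancellation between (k, l) and (l, k), which costs little
  at small \<epsilon>, as a move to a different pair contains a jump. Weight 0 on k = l, where
  minors vanish, removes in particular the pair (i, i) of the true state, whose moment would not
  decay.\<close>

lemma minor_powr_le:
  assumes \<theta>: "0 < \<theta>" "\<theta> \<le> 1"
  shows "\<bar>minor g L s y p q n k l\<bar> powr \<theta> \<le>
    lin_rec (\<lambda>i x u. if fst x = snd x then 0 else (ratio g i (fst x) u * ratio g i (snd x) u) powr \<theta>)
      (\<lambda>z x. (L $ fst z $ fst x * L $ snd z $ snd x) powr \<theta>) s y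
      (\<lambda>x. \<bar>minor g L s y p q 0 (fst x) (snd x)\<bar> powr \<theta>) n (k, l)"
proof (induction n arbitrary: k l)
  case (Suc n)
  define c where "c = ratio g (s (Suc n)) k (y (Suc n)) * ratio g (s (Suc n)) l (y (Suc n))"
  have c: "c > 0" using gpos by (simp add: c_def)
  show ?case
  proof (cases "k = l")
    case True
    then show ?thesis by (simp add: minor_def)
  next
    case False
    have "\<bar>minor g L s y p q (Suc n) k l\<bar> \<le> c * (\<Sum>z\<in>UNIV. L $ fst z $ k * L $ snd z $ l * \<bar>minor g L s y p q n (fst z) (snd z)\<bar>)"
      unfolding minor_Suc c_def[symmetric] using c Lnn
      by (auto simp: abs_mult intro!: mult_left_mono order_trans[OF sum_abs] sum_mono)
    then have "\<bar>minor g L s y p q (Suc n) k l\<bar> powr \<theta> \<le>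
        (c * (\<Sum>z\<in>UNIV. L $ fst z $ k * L $ snd z $ l * \<bar>minor g L s y p q n (fst z) (snd z)\<bar>)) powr \<theta>"
      using \<theta> by (intro powr_mono2) auto
    also have "\<dots> = c powr \<theta> * (\<Sum>z\<in>UNIV. L $ fst z $ k * L $ snd z $ l * \<bar>minor g L s y p q n (fst z) (snd z)\<bar>) powr \<theta>"
      by (rule powr_mult)
    also have "\<dots> \<le> c powr \<theta> * (\<Sum>z\<in>UNIV. (L $ fst z $ k * L $ snd z $ l * \<bar>minor g L s y p q n (fst z) (snd z)\<bar>) powr \<theta>)"
      using \<theta> Lnn by (intro mult_left_mono sum_powr_le) auto
    also have "\<dots> = c powr \<theta> * (\<Sum>z\<in>UNIV. (L $ fst z $ k * L $ snd z $ l) powr \<theta> * \<bar>minor g L s y p q n (fst z) (snd z)\<bar> powr \<theta>)"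
      using Lnn by (simp add: powr_mult)
    also have "\<dots> \<le> c powr \<theta> * (\<Sum>z\<in>UNIV. (L $ fst z $ k * L $ snd z $ l) powr \<theta> *
       lin_rec (\<lambda>i x u. if fst x = snd x then 0 else (ratio g i (fst x) u * ratio g i (snd x) u) powr \<theta>)
      (\<lambda>z x. (L $ fst z $ fst x * L $ snd z $ snd x) powr \<theta>) s y
      (\<lambda>x. \<bar>minor g L s y p q 0 (fst x) (snd x)\<bar> powr \<theta>) n z)"
    proof (intro mult_left_mono sum_mono)
      fix z :: "'d \<times> 'd"
      show "\<bar>minor g L s y p q n (fst z) (snd z)\<bar> powr \<theta> \<le>
       lin_rec (\<lambda>i x u. if fst x = snd x then 0 else (ratio g i (fst x) u * ratio g i (snd x) u) powr \<theta>)
      (\<lambda>z x. (L $ fst z $ fst x * L $ snd z $ snd x) powr \<theta>) s y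
      (\<lambda>x. \<bar>minor g L s y p q 0 (fst x) (snd x)\<bar> powr \<theta>) n z"
        using Suc[of "fst z" "snd z"] by simp
    qed auto
    finally show ?thesis using False by (simp add: c_def)
  qed
qed simp

text \<open>The second exterior power of a two-dimensional space is one-dimensional, so the
  recursion is scalar and contributes the determinant of \<open>L\<close> at each step.\<close>

lemma minor_two_states:
  assumes U: "UNIV = {i, j}" "i \<noteq> j"
  shows "minor g L s y p q n i j = (\<Prod>k=1..n. ratio g (s k) i (y k) * ratio g (s k) j (y k)) *
    (L $ i $ i * L $ j $ j - L $ i $ j * L $ j $ i) ^ n * minor g L s y p q 0 i j"
proof (induction n)
  case (Suc n)
  have "minor g L s y p q (Suc n) i j = ratio g (s (Suc n)) i (y (Suc n)) * ratio g (s (Suc n)) j (y (Suc n)) *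
    ((L $ i $ i * L $ j $ j - L $ i $ j * L $ j $ i) * minor g L s y p q n i j)"
  proof -
    have *: "(\<Sum>l\<in>UNIV. f l) = f i + f j" for f :: "'d \<Rightarrow> real" unfolding U(1) using U(2) by simp
    show ?thesis
      unfolding minor_def ratio_filter_Suc * by algebra
  qed
  then show ?case using Suc by (simp add: mult_ac)
qed simp

context
  fixes p q :: "real ^ 'd" assumes p: "prob_vec p" and q: "prob_vec q" and diag: "\<And>i. L $ i $ i > 0"
begin

text \<open>Over the common denominator the numerator is one coordinate of each filter times the
  mass of the other, that is, the sum of a row of minors.\<close>

lemma nl_filter_diff:
  "nl_filter g L y p n $ k - nl_filter g L y q n $ k = (\<Sum>l\<in>UNIV. minor g L s y p q n k l) /
    ((\<Sum>l\<in>UNIV. ratio_filter g L s y p n l) * (\<Sum>l\<in>UNIV. ratio_filter g L s y q n l))"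
  using ratio_filter_sum_pos[OF p diag, of n] ratio_filter_sum_pos[OF q diag, of n]
  unfolding nl_filter_eq_ratio_filter[OF p diag] nl_filter_eq_ratio_filter[OF q diag] minor_def
    sum_subtractf sum_distrib_left[symmetric] sum_distrib_right[symmetric]
  by (simp add: divide_simps)

lemma l1_norm_nl_filter_diff_le:
  "l1_norm (nl_filter g L y p n - nl_filter g L y q n) \<le> (\<Sum>x\<in>UNIV. \<bar>minor g L s y p q n (fst x) (snd x)\<bar>) /
    ((\<Sum>l\<in>UNIV. ratio_filter g L s y p n l) * (\<Sum>l\<in>UNIV. ratio_filter g L s y q n l))"
proof -
  let ?c = "(\<Sum>l\<in>UNIV. ratio_filter g L s y p n l) * (\<Sum>l\<in>UNIV. ratio_filter g L s y q n l)"
  have c: "?c > 0" using ratio_filter_sum_pos[OF p diag, of n] ratio_filter_sum_pos[OF q diag, of n] by simp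
  have "l1_norm (nl_filter g L y p n - nl_filter g L y q n) = (\<Sum>k\<in>UNIV. \<bar>\<Sum>l\<in>UNIV. minor g L s y p q n k l\<bar> / ?c)"
    using c by (simp add: l1_norm_def nl_filter_diff)
  also have "\<dots> \<le> (\<Sum>k\<in>UNIV. (\<Sum>l\<in>UNIV. \<bar>minor g L s y p q n k l\<bar>) / ?c)"
    using c by (intro sum_mono divide_right_mono) auto
  also have "\<dots> = (\<Sum>x\<in>UNIV. \<bar>minor g L s y p q n (fst x) (snd x)\<bar>) / ?c"
    by (simp add: sum_divide_distrib[symmetric] sum.cartesian_product UNIV_Times_UNIV[symmetric] split_beta
        del: UNIV_Times_UNIV)
  finally show ?thesis .
qed

text \<open>The diagonal minor vanishes, so row i has a single entry and nothing can cancel.\<close>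

lemma l1_norm_nl_filter_diff_ge:
  assumes U: "UNIV = {i, j}" "i \<noteq> j"
  shows "\<bar>minor g L s y p q n i j\<bar> / ((\<Sum>l\<in>UNIV. ratio_filter g L s y p n l) * (\<Sum>l\<in>UNIV. ratio_filter g L s y q n l))
    \<le> l1_norm (nl_filter g L y p n - nl_filter g L y q n)"
proof -
  let ?c = "(\<Sum>l\<in>UNIV. ratio_filter g L s y p n l) * (\<Sum>l\<in>UNIV. ratio_filter g L s y q n l)"
  have c: "?c > 0" using ratio_filter_sum_pos[OF p diag, of n] ratio_filter_sum_pos[OF q diag, of n] by simp
  have *: "(\<Sum>l\<in>UNIV. f l) = f i + f j" for f :: "'d \<Rightarrow> real" unfolding U(1) using U(2) by simp
  have "(\<Sum>l\<in>UNIV. minor g L s y p q n i l) = minor g L s y p q n i j" unfolding * by (simp add: minor_def)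
  then have "\<bar>minor g L s y p q n i j\<bar> / ?c = \<bar>nl_filter g L y p n $ i - nl_filter g L y q n $ i\<bar>"
    using c by (simp add: nl_filter_diff)
  also have "\<dots> \<le> l1_norm (nl_filter g L y p n - nl_filter g L y q n)"
    unfolding l1_norm_def * by simp
  finally show ?thesis .
qed

end

end


section \<open>Expectations along the hidden chain\<close>

text \<open>By independence, restricting the measure to \<open>A\<close> merely rescales the law of
  \<open>T\<close>; the formula integrates \<open>F\<close> against these two equal
  measures.\<close>

lemma (in prob_space) nn_integral_indep_set:
  assumes indep: "indep_set \<A> \<B>" and A: "A \<in> \<A>" and T: "T \<in> measurable M N"
    and TB: "\<And>B. B \<in> sets N \<Longrightarrow> T -` B \<inter> space M \<in> \<B>" and F: "F \<in> borel_measurable N"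
  shows "(\<integral>\<^sup>+\<omega>. indicator A \<omega> * F (T \<omega>) \<partial>M) = emeasure M A * (\<integral>\<^sup>+y. F y \<partial>distr M N T)"
proof -
  have AM[measurable]: "A \<in> sets M" using indep_setD_ev1[OF indep] A by auto
  note T[measurable] F[measurable]
  have "distr (density M (indicator A)) N T = scale_measure (emeasure M A) (distr M N T)"
  proof (rule measure_eqI)
    fix B assume "B \<in> sets (distr (density M (indicator A)) N T)"
    then have B[measurable]: "B \<in> sets N" by simp
    have "emeasure (distr (density M (indicator A)) N T) B = emeasure M (A \<inter> (T -` B \<inter> space M))"
      by (simp add: emeasure_distr emeasure_density nn_integral_indicator
          indicator_inter_arith[symmetric] Int_assoc cong: nn_integral_cong)
    also have "\<dots> = emeasure M A * emeasure M (T -` B \<inter> space M)"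
      using indep_setD[OF indep A TB[OF B]]
      by (simp add: emeasure_eq_measure ennreal_mult)
    finally show "emeasure (distr (density M (indicator A)) N T) B =
        emeasure (scale_measure (emeasure M A) (distr M N T)) B"
      by (simp add: emeasure_distr)
  qed simp
  then have "(\<integral>\<^sup>+y. F y \<partial>distr (density M (indicator A)) N T) =
      (\<integral>\<^sup>+y. F y \<partial>scale_measure (emeasure M A) (distr M N T))" by simp
  then show ?thesis
    by (simp add: nn_integral_distr nn_integral_density nn_integral_scale_measure)
qed

locale hidden_chain = prob_space M for M :: "'w measure" +
  fixes a :: "'d::finite \<Rightarrow> real" and \<nu> :: "real ^ 'd" and L :: "real ^ 'd ^ 'd"
    and X :: "nat \<Rightarrow> 'w \<Rightarrow> real" and \<phi> :: "real measure" and g :: "'d \<Rightarrow> real \<Rightarrow> real"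
    and \<xi> :: "nat \<Rightarrow> 'd \<Rightarrow> 'w \<Rightarrow> real"
  assumes inj: "inj a" and L: "stochastic L" and chain: "markov_chain M a \<nu> L X"
    and sets_\<phi>[measurable_cong, simp]: "sets \<phi> = sets borel"
    and g_nonneg: "\<And>i u. 0 \<le> g i u" and noise: "noise M \<phi> g \<xi>"
    and indep: "indep_chain_noise M X \<xi>"
begin

definition st :: "nat \<Rightarrow> 'w \<Rightarrow> 'd" where
  "st n \<omega> = inv a (X n \<omega>)"

definition obs :: "nat \<Rightarrow> 'w \<Rightarrow> real" where
  "obs n \<omega> = \<xi> n (st n \<omega>) \<omega>"

abbreviation P :: "'d \<Rightarrow> real measure" where
  "P i \<equiv> density \<phi> (\<lambda>u. ennreal (g i u))"

lemma L_nonneg: "0 \<le> L $ i $ j" and L_sum: "(\<Sum>j\<in>UNIV. L $ i $ j) = 1"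
  using L by (auto simp: stochastic_def prob_vec_def)

lemma X_measurable[measurable]: "X n \<in> borel_measurable M"
  using chain by (simp add: markov_chain_def)

lemma X_eq: "\<omega> \<in> space M \<Longrightarrow> X n \<omega> = a (st n \<omega>)"
  using chain unfolding markov_chain_def st_def by (metis f_inv_into_f)

lemma X_eq_iff: "\<omega> \<in> space M \<Longrightarrow> X n \<omega> = a i \<longleftrightarrow> st n \<omega> = i"
  using X_eq inj by (metis injD)

lemma observation_eq: "\<omega> \<in> space M \<Longrightarrow> observation a X \<xi> n \<omega> = obs n \<omega>"
  by (simp add: observation_def X_eq_iff obs_def of_bool_def if_distrib[where f="\<lambda>x. x * _"] cong: if_cong)

lemma st_measurable[measurable]: "st n \<in> measurable M (count_space UNIV)"
proof (subst measurable_count_space_eq2)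
  have "st n -` {i} \<inter> space M = X n -` {a i} \<inter> space M" for i
    using X_eq_iff by auto
  then show "st n \<in> space M \<rightarrow> UNIV \<and> (\<forall>i\<in>UNIV. st n -` {i} \<inter> space M \<in> sets M)"
    by simp
qed simp

lemma \<xi>_measurable: "1 \<le> n \<Longrightarrow> \<xi> n i \<in> borel_measurable M"
proof -
  assume "1 \<le> n"
  then have "\<xi> n i \<in> measurable M \<phi>" using noise by (auto simp: noise_def distributed_def)
  then show ?thesis using measurable_cong_sets[OF refl sets_\<phi>] by blast
qed

lemma g_measurable[measurable]: "g i \<in> borel_measurable borel"
proof -
  have "(\<lambda>u. ennreal (g i u)) \<in> borel_measurable \<phi>"
    using noise by (auto simp: noise_def distributed_def)
  then have "(\<lambda>u. enn2real (ennreal (g i u))) \<in> borel_measurable \<phi>" by measurable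
  then have "g i \<in> borel_measurable \<phi>" using g_nonneg by simp
  then show ?thesis using measurable_cong_sets[OF sets_\<phi> refl] by blast
qed

lemma distr_\<xi>: "1 \<le> n \<Longrightarrow> distr M borel (\<xi> n i) = P i"
proof -
  assume "1 \<le> n"
  then have "distr M \<phi> (\<xi> n i) = P i" using noise by (auto simp: noise_def distributed_def)
  moreover have "distr M \<phi> (\<xi> n i) = distr M borel (\<xi> n i)" by (rule distr_cong) simp_all
  ultimately show ?thesis by simp
qed

lemma prob_space_P: "prob_space (P i)"
  using distr_\<xi>[of 1 i] prob_space_distr[OF \<xi>_measurable[of 1 i]] by simp

definition path_event :: "nat \<Rightarrow> (nat \<Rightarrow> 'd) \<Rightarrow> 'w set" where
  "path_event n s = {\<omega> \<in> space M. \<forall>k\<le>n. st k \<omega> = s k}"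

lemma path_event_sets[measurable]: "path_event n s \<in> sets M"
  unfolding path_event_def by measurable

lemma path_event_X: "path_event n s = {\<omega> \<in> space M. \<forall>k\<le>n. X k \<omega> = a (s k)}"
  unfolding path_event_def using X_eq_iff by auto

lemma path_event_Suc:
  "path_event (Suc n) s = {\<omega> \<in> path_event n s. st (Suc n) \<omega> = s (Suc n)}"
  unfolding path_event_def by (auto simp: le_Suc_eq)

lemma prob_path_event_Suc:
  "prob (path_event (Suc n) s) = prob (path_event n s) * L $ s n $ s (Suc n)"
proof (cases "prob (path_event n s) = 0")
  case True
  have "prob (path_event (Suc n) s) \<le> prob (path_event n s)"
    by (intro finite_measure_mono) (auto simp: path_event_Suc)
  with True show ?thesis by (simp add: measure_le_0_iff)
next
  case False
  then have "prob (path_event n s) > 0" by (simp add: less_le)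
  then have "cond_prob M (\<lambda>\<omega>. X (Suc n) \<omega> = a (s (Suc n))) (\<lambda>\<omega>. \<forall>k\<le>n. X k \<omega> = a (s k)) = L $ s n $ s (Suc n)"
    using chain by (simp add: markov_chain_def path_event_X)
  moreover have "{\<omega> \<in> space M. X (Suc n) \<omega> = a (s (Suc n)) \<and> (\<forall>k\<le>n. X k \<omega> = a (s k))} = path_event (Suc n) s"
    unfolding path_event_X by (auto simp: le_Suc_eq)
  ultimately show ?thesis
    using False by (simp add: cond_prob_def path_event_X[symmetric] field_simps)
qed

section \<open>Splitting over the finitely many paths up to a time\<close>

definition paths :: "nat \<Rightarrow> (nat \<Rightarrow> 'd) set" where
  "paths n = PiE {..n} (\<lambda>_. UNIV)"

text \<open>Extensional outside \<open>{..n}\<close>, so that it takes values in the finite set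
  \<open>paths n\<close>.\<close>

definition path :: "nat \<Rightarrow> 'w \<Rightarrow> nat \<Rightarrow> 'd" where
  "path n \<omega> = (\<lambda>k\<in>{..n}. st k \<omega>)"

lemma finite_paths: "finite (paths n)"
  unfolding paths_def by (intro finite_PiE) auto

lemma path_in_paths: "path n \<omega> \<in> paths n"
  by (auto simp: paths_def path_def)

lemma path_event_iff: "s \<in> paths n \<Longrightarrow> \<omega> \<in> path_event n s \<longleftrightarrow> \<omega> \<in> space M \<and> path n \<omega> = s"
  by (auto simp: paths_def path_def path_event_def PiE_def extensional_def fun_eq_iff)

lemma path_measurable: "path n \<in> measurable M (count_space (paths n))"
proof (subst measurable_count_space_eq2[OF finite_paths])
  have "path n -` {s} \<inter> space M = path_event n s" if "s \<in> paths n" for s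
    using path_event_iff[OF that] by auto
  then show "path n \<in> space M \<rightarrow> paths n \<and> (\<forall>s\<in>paths n. path n -` {s} \<inter> space M \<in> sets M)"
    using path_in_paths by auto
qed

lemma nn_integral_path:
  fixes F :: "(nat \<Rightarrow> 'd) \<Rightarrow> 'w \<Rightarrow> ennreal"
  assumes [measurable]: "\<And>s. F s \<in> borel_measurable M"
  shows "(\<integral>\<^sup>+\<omega>. F (path n \<omega>) \<omega> \<partial>M) = (\<Sum>s\<in>paths n. \<integral>\<^sup>+\<omega>. indicator (path_event n s) \<omega> * F s \<omega> \<partial>M)"
proof -
  have "(\<integral>\<^sup>+\<omega>. F (path n \<omega>) \<omega> \<partial>M) = (\<integral>\<^sup>+\<omega>. (\<Sum>s\<in>paths n. indicator (path_event n s) \<omega> * F s \<omega>) \<partial>M)"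
  proof (rule nn_integral_cong)
    fix \<omega> assume \<omega>: "\<omega> \<in> space M"
    have "(\<Sum>s\<in>paths n. indicator (path_event n s) \<omega> * F s \<omega>) =
       (\<Sum>s\<in>paths n. if path n \<omega> = s then F s \<omega> else 0)"
      using \<omega> by (intro sum.cong) (auto simp: path_event_iff indicator_def)
    also have "\<dots> = F (path n \<omega>) \<omega>" using finite_paths path_in_paths by simp
    finally show "F (path n \<omega>) \<omega> = (\<Sum>s\<in>paths n. indicator (path_event n s) \<omega> * F s \<omega>)" ..
  qed
  also have "\<dots> = (\<Sum>s\<in>paths n. \<integral>\<^sup>+\<omega>. indicator (path_event n s) \<omega> * F s \<omega> \<partial>M)"
    by (rule nn_integral_sum) measurable
  finally show ?thesis .
qed

lemma sum_prob_paths: "(\<Sum>s\<in>paths n. emeasure M (path_event n s)) = 1"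
  using nn_integral_path[of "\<lambda>_ _. 1" n] by (simp add: emeasure_space_1)

text \<open>Given the path up to n, the last factor has mean at most \<open>c\<close>; the Markov
  property enters through \<open>prob_path_event_Suc\<close>.\<close>

lemma nn_integral_chain_prod_le:
  assumes q: "\<And>i j. 0 \<le> q i j" and c: "\<And>i. (\<Sum>j\<in>UNIV. L $ i $ j * q i j) \<le> c"
  shows "(\<integral>\<^sup>+\<omega>. ennreal (\<Prod>k<n. q (st k \<omega>) (st (Suc k) \<omega>)) \<partial>M) \<le> ennreal (c ^ n)"
proof (induction n)
  case 0
  then show ?case by (simp add: emeasure_space_1)
next
  case (Suc n)
  define \<Psi> where "\<Psi> s = (\<Prod>k<n. q (s k) (s (Suc k)))" for s :: "nat \<Rightarrow> 'd"
  have \<Psi>: "\<Psi> s \<ge> 0" for s unfolding \<Psi>_def by (intro prod_nonneg) (simp add: q)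
  have \<Psi>_path: "\<Psi> (path n \<omega>) = (\<Prod>k<n. q (st k \<omega>) (st (Suc k) \<omega>))" for \<omega>
    unfolding \<Psi>_def path_def by (intro prod.cong) auto
  have c0: "0 \<le> c" using c[of undefined] order_trans[OF sum_nonneg] q L_nonneg
    by (metis (no_types, lifting) mult_nonneg_nonneg)
  have "(\<integral>\<^sup>+\<omega>. ennreal (\<Prod>k<Suc n. q (st k \<omega>) (st (Suc k) \<omega>)) \<partial>M) =
     (\<integral>\<^sup>+\<omega>. ennreal (\<Psi> (path n \<omega>) * q (path n \<omega> n) (st (Suc n) \<omega>)) \<partial>M)"
    unfolding \<Psi>_path by (simp add: path_def)
  also have "\<dots> = (\<Sum>s\<in>paths n. \<integral>\<^sup>+\<omega>. indicator (path_event n s) \<omega> * ennreal (\<Psi> s * q (s n) (st (Suc n) \<omega>)) \<partial>M)"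
    by (rule nn_integral_path) measurable
  also have "\<dots> = (\<Sum>s\<in>paths n. \<Sum>j\<in>UNIV. ennreal (\<Psi> s * q (s n) j) * ennreal (prob (path_event n s) * L $ s n $ j))"
  proof (rule sum.cong[OF refl])
    fix s assume "s \<in> paths n"
    define E where "E j = path_event (Suc n) (s(Suc n := j))" for j
    have E: "E j = {\<omega> \<in> path_event n s. st (Suc n) \<omega> = j}" for j
      unfolding E_def path_event_Suc by (auto simp: path_event_def)
    have [measurable]: "E j \<in> sets M" for j unfolding E_def by measurable
    have probE: "prob (E j) = prob (path_event n s) * L $ s n $ j" for j
    proof -
      have "path_event n (s(Suc n := j)) = path_event n s" by (auto simp: path_event_def)
      then show ?thesis unfolding E_def prob_path_event_Suc by simp
    qed
    have "(\<integral>\<^sup>+\<omega>. indicator (path_event n s) \<omega> * ennreal (\<Psi> s * q (s n) (st (Suc n) \<omega>)) \<partial>M) =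
      (\<integral>\<^sup>+\<omega>. (\<Sum>j\<in>UNIV. ennreal (\<Psi> s * q (s n) j) * indicator (E j) \<omega>) \<partial>M)"
    proof (rule nn_integral_cong)
      fix \<omega> assume "\<omega> \<in> space M"
      have "(\<Sum>j\<in>UNIV. ennreal (\<Psi> s * q (s n) j) * indicator (E j) \<omega>) =
        (\<Sum>j\<in>UNIV. if st (Suc n) \<omega> = j then ennreal (\<Psi> s * q (s n) j) * indicator (path_event n s) \<omega> else 0)"
        by (intro sum.cong) (auto simp: E indicator_def)
      then show "indicator (path_event n s) \<omega> * ennreal (\<Psi> s * q (s n) (st (Suc n) \<omega>)) =
         (\<Sum>j\<in>UNIV. ennreal (\<Psi> s * q (s n) j) * indicator (E j) \<omega>)" by (simp add: mult.commute)
    qed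
    also have "\<dots> = (\<Sum>j\<in>UNIV. \<integral>\<^sup>+\<omega>. ennreal (\<Psi> s * q (s n) j) * indicator (E j) \<omega> \<partial>M)"
      by (rule nn_integral_sum) measurable
    also have "\<dots> = (\<Sum>j\<in>UNIV. ennreal (\<Psi> s * q (s n) j) * emeasure M (E j))"
      by (intro sum.cong refl nn_integral_cmult_indicator) measurable
    finally show "(\<integral>\<^sup>+\<omega>. indicator (path_event n s) \<omega> * ennreal (\<Psi> s * q (s n) (st (Suc n) \<omega>)) \<partial>M) =
       (\<Sum>j\<in>UNIV. ennreal (\<Psi> s * q (s n) j) * ennreal (prob (path_event n s) * L $ s n $ j))"
      by (simp add: emeasure_eq_measure probE)
  qed
  also have "\<dots> = ennreal (\<Sum>s\<in>paths n. (prob (path_event n s) * \<Psi> s) * (\<Sum>j\<in>UNIV. L $ s n $ j * q (s n) j))"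
    using \<Psi> q L_nonneg
    by (simp add: ennreal_mult[symmetric] sum_ennreal sum_nonneg sum_distrib_left mult_ac)
  also have "\<dots> \<le> ennreal (\<Sum>s\<in>paths n. (prob (path_event n s) * \<Psi> s) * c)"
    using \<Psi> c by (intro ennreal_leI sum_mono mult_left_mono) auto
  also have "\<dots> = ennreal c * (\<Sum>s\<in>paths n. ennreal (\<Psi> s) * emeasure M (path_event n s))"
    using \<Psi> c0 by (simp add: emeasure_eq_measure ennreal_mult[symmetric] sum_ennreal sum_nonneg
        sum_distrib_left mult_ac)
  also have "(\<Sum>s\<in>paths n. ennreal (\<Psi> s) * emeasure M (path_event n s)) =
      (\<integral>\<^sup>+\<omega>. ennreal (\<Psi> (path n \<omega>)) \<partial>M)"
    using nn_integral_path[of "\<lambda>s _. ennreal (\<Psi> s)" n]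
    by (simp add: mult.commute[of "indicator _ _"] nn_integral_cmult_indicator)
  also have "ennreal c * \<dots> \<le> ennreal c * ennreal (c ^ n)"
    unfolding \<Psi>_path by (intro mult_left_mono Suc) auto
  also have "\<dots> = ennreal (c ^ Suc n)" using c0 by (simp add: ennreal_mult)
  finally show ?case .
qed

text \<open>At each time there are finitely many paths, so those of probability zero form a null
  set, and a vanishing transition probability would put the path among them.\<close>

lemma AE_transitions_pos: "AE \<omega> in M. \<nu> $ st 0 \<omega> > 0 \<and> (\<forall>n. L $ st n \<omega> $ st (Suc n) \<omega> > 0)"
proof -
  have "AE \<omega> in M. prob (path_event n (path n \<omega>)) > 0" for n
  proof -
    have "(\<Union>s\<in>{s \<in> paths n. prob (path_event n s) = 0}. path_event n s) \<in> null_sets M"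
      using finite_paths by (intro null_sets_UN') (auto simp: null_sets_def emeasure_eq_measure intro: countable_finite)
    then show ?thesis
    proof (rule AE_I', safe)
      fix \<omega> assume "\<omega> \<in> space M" "\<not> prob (path_event n (path n \<omega>)) > 0"
      then show "\<omega> \<in> (\<Union>s\<in>{s \<in> paths n. prob (path_event n s) = 0}. path_event n s)"
        using path_in_paths[of n \<omega>] path_event_iff[OF path_in_paths, of \<omega> n \<omega>]
        by (auto simp: measure_le_0_iff not_less intro!: bexI[of _ "path n \<omega>"])
    qed
  qed
  then have "AE \<omega> in M. \<forall>n. prob (path_event n (path n \<omega>)) > 0" by (simp add: AE_all_countable)
  then show ?thesis
    using AE_space
  proof eventually_elim
    case (elim \<omega>)
    have eq: "path_event m (path n \<omega>) = path_event m (path m \<omega>)" if "m \<le> n" for m n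
      using that by (auto simp: path_event_def path_def)
    have "prob (path_event 0 (path 0 \<omega>)) = \<nu> $ st 0 \<omega>"
      using chain by (simp add: markov_chain_def path_event_X path_def)
    then have "\<nu> $ st 0 \<omega> > 0" using elim(1)[rule_format, of 0] by simp
    moreover have "L $ st n \<omega> $ st (Suc n) \<omega> > 0" for n
    proof -
      have "prob (path_event (Suc n) (path (Suc n) \<omega>)) > 0" using elim by blast
      then have "L $ path (Suc n) \<omega> n $ path (Suc n) \<omega> (Suc n) > 0"
        unfolding prob_path_event_Suc by (auto simp: zero_less_mult_iff not_less measure_le_0_iff)
      then show ?thesis by (simp add: path_def)
    qed
    ultimately show ?case by blast
  qed
qed

section \<open>The noise along a prescribed path\<close>

definition noise_path :: "nat \<Rightarrow> (nat \<Rightarrow> 'd) \<Rightarrow> 'w \<Rightarrow> nat \<Rightarrow> real" where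
  "noise_path n s \<omega> = (\<lambda>k\<in>{1..n}. \<xi> k (s k) \<omega>)"

lemma noise_path_measurable[measurable]: "noise_path n s \<in> measurable M (PiM {1..n} (\<lambda>_. borel))"
  unfolding noise_path_def by (intro measurable_restrict \<xi>_measurable) auto

lemma distr_noise_path:
  "distr M (PiM {1..n} (\<lambda>_. borel)) (noise_path n s) = PiM {1..n} (\<lambda>k. P (s k))"
proof (cases "n = 0")
  case True
  show ?thesis
    unfolding True
  proof (rule measure_eqI)
    show "sets (distr M (PiM {1..0} (\<lambda>_. borel)) (noise_path 0 s)) = sets (PiM {1..0} (\<lambda>k. P (s k)))"
      by (simp add: PiM_empty)
    fix A assume "A \<in> sets (distr M (PiM {1..0} (\<lambda>_. borel)) (noise_path 0 s))"
    then have "A \<subseteq> {\<lambda>_. undefined}" by (simp add: PiM_empty)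
    then consider "A = {}" | "A = {\<lambda>_. undefined}" by blast
    then show "emeasure (distr M (PiM {1..0} (\<lambda>_. borel)) (noise_path 0 s)) A = emeasure (PiM {1..0} (\<lambda>k. P (s k))) A"
    proof cases
      case 2
      have "noise_path 0 s -` A \<inter> space M = space M"
        using 2 by (auto simp: noise_path_def)
      then show ?thesis
        using 2 noise_path_measurable[of 0 s]
        by (subst emeasure_distr) (auto simp: PiM_empty emeasure_space_1)
    qed simp
  qed
next
  case False
  \<comment> \<open>Time j uses the single index (j, s j). Grouping the doubly indexed family into
    these disjoint singletons makes the selected entries independent over time.\<close>
  have "indep_vars (\<lambda>j. PiM {(j, s j)} (\<lambda>_. borel))
      (\<lambda>j \<omega>. restrict (\<lambda>k. (case k of (n, i) \<Rightarrow> \<xi> n i) \<omega>) {(j, s j)}) {1..n}"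
  proof (rule indep_vars_restrict)
    show "indep_vars (\<lambda>_. borel) (\<lambda>(n, i). \<xi> n i) ({1..} \<times> UNIV)"
      using noise by (simp add: noise_def)
  qed (auto simp: disjoint_family_on_def)
  then have "indep_vars (\<lambda>_. borel)
      (\<lambda>j \<omega>. restrict (\<lambda>k. (case k of (n, i) \<Rightarrow> \<xi> n i) \<omega>) {(j, s j)} (j, s j)) {1..n}"
    by (rule indep_vars_compose2) (rule measurable_component_singleton, simp)
  then have "indep_vars (\<lambda>_. borel) (\<lambda>k. \<xi> k (s k)) {1..n}" by simp
  then have "distr M (PiM {1..n} (\<lambda>_. borel)) (noise_path n s) = PiM {1..n} (\<lambda>k. distr M borel (\<xi> k (s k)))"
    using False \<xi>_measurable unfolding noise_path_def
    by (subst (asm) indep_vars_iff_distr_eq_PiM') auto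
  also have "\<dots> = PiM {1..n} (\<lambda>k. P (s k))"
    by (intro PiM_cong) (auto simp: distr_\<xi>)
  finally show ?thesis .
qed

text \<open>The observation selects its noise entry by the random state. For a fixed path
  \<open>s\<close> the selection is deterministic; the event then depends on the chain and
  \<open>noise_path n s\<close> on the noise, and these are independent.\<close>

lemma nn_integral_path_event_noise:
  assumes F: "F \<in> borel_measurable (PiM {1..n} (\<lambda>_. borel))"
  shows "(\<integral>\<^sup>+\<omega>. indicator (path_event n s) \<omega> * F (noise_path n s \<omega>) \<partial>M) =
    emeasure M (path_event n s) * (\<integral>\<^sup>+y. F y \<partial>PiM {1..n} (\<lambda>k. P (s k)))"
  unfolding distr_noise_path[symmetric]
proof (rule nn_integral_indep_set[OF _ _ noise_path_measurable _ F])
  let ?N = "PiM ({1..} \<times> UNIV) (\<lambda>_::nat \<times> 'd. borel :: real measure)"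
  let ?\<Xi> = "\<lambda>\<omega>. \<lambda>(n, i)\<in>{1..} \<times> UNIV. \<xi> n i \<omega>"
  show "indep_set (sets (vimage_algebra (space M) (\<lambda>\<omega> n. X n \<omega>) (PiM UNIV (\<lambda>_::nat. borel))))
       (sets (vimage_algebra (space M) ?\<Xi> ?N))"
    using indep by (simp add: indep_chain_noise_def)
  have "path_event n s = (\<lambda>\<omega> n. X n \<omega>) -` {x \<in> space (PiM UNIV (\<lambda>_. borel)). \<forall>k\<le>n. x k = a (s k)} \<inter> space M"
    unfolding path_event_X by (auto simp: space_PiM)
  also have "\<dots> \<in> sets (vimage_algebra (space M) (\<lambda>\<omega> n. X n \<omega>) (PiM UNIV (\<lambda>_::nat. borel)))"
    by (intro in_vimage_algebra) measurable
  finally show "path_event n s \<in> \<dots>" .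
  fix B assume B: "B \<in> sets (PiM {1..n} (\<lambda>_. borel :: real measure))"
  define T where "T z = (\<lambda>k\<in>{1..n}. z (k, s k))" for z :: "nat \<times> 'd \<Rightarrow> real"
  have T: "T \<in> measurable ?N (PiM {1..n} (\<lambda>_. borel))"
    unfolding T_def by (intro measurable_restrict measurable_component_singleton) auto
  have "T (?\<Xi> \<omega>) = noise_path n s \<omega>" for \<omega>
    by (auto simp: T_def noise_path_def fun_eq_iff)
  moreover have "?\<Xi> \<omega> \<in> space ?N" for \<omega> by (auto simp: space_PiM)
  ultimately have "noise_path n s -` B \<inter> space M = ?\<Xi> -` (T -` B \<inter> space ?N) \<inter> space M"
    by auto
  also have "\<dots> \<in> sets (vimage_algebra (space M) ?\<Xi> ?N)"
    by (intro in_vimage_algebra measurable_sets[OF T B])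
  finally show "noise_path n s -` B \<inter> space M \<in> \<dots>" .
qed

text \<open>The passage from fixed paths to the random one: where the path is \<open>s\<close>, the
  observations are \<open>noise_path n s\<close>, whose law is a product. A bound uniform in
  \<open>s\<close> survives averaging over \<open>s\<close>. The assumption \<open>cong\<close> says
  that \<open>f\<close> looks at no time after n.\<close>

lemma
  fixes f :: "(nat \<Rightarrow> 'd) \<Rightarrow> (nat \<Rightarrow> real) \<Rightarrow> real"
  assumes f: "\<And>s. f s \<in> borel_measurable (PiM {1..n} (\<lambda>_. borel))"
    and cong: "\<And>s s' y y'. \<forall>k\<le>n. s k = s' k \<Longrightarrow> \<forall>k\<in>{1..n}. y k = y' k \<Longrightarrow> f s y = f s' y'"
  shows path_obs_measurable: "(\<lambda>\<omega>. f (\<lambda>k. st k \<omega>) (\<lambda>k. obs k \<omega>)) \<in> borel_measurable M"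
    and nn_integral_path_obs_le:
      "(\<And>s. (\<integral>\<^sup>+y. ennreal (f s y) \<partial>PiM {1..n} (\<lambda>k. P (s k))) \<le> C) \<Longrightarrow>
       (\<integral>\<^sup>+\<omega>. ennreal (f (\<lambda>k. st k \<omega>) (\<lambda>k. obs k \<omega>)) \<partial>M) \<le> C"
proof -
  have eq: "f (\<lambda>k. st k \<omega>) (\<lambda>k. obs k \<omega>) = f (path n \<omega>) (noise_path n (path n \<omega>) \<omega>)" for \<omega>
    by (rule cong) (auto simp: path_def noise_path_def obs_def)
  have m[measurable]: "(\<lambda>\<omega>. f s (noise_path n s \<omega>)) \<in> borel_measurable M" for s
    using f by measurable
  show "(\<lambda>\<omega>. f (\<lambda>k. st k \<omega>) (\<lambda>k. obs k \<omega>)) \<in> borel_measurable M"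
    unfolding eq
    by (rule measurable_compose_countable'[OF m path_measurable countable_finite[OF finite_paths]])
  assume C: "\<And>s. (\<integral>\<^sup>+y. ennreal (f s y) \<partial>PiM {1..n} (\<lambda>k. P (s k))) \<le> C"
  have "(\<integral>\<^sup>+\<omega>. ennreal (f (\<lambda>k. st k \<omega>) (\<lambda>k. obs k \<omega>)) \<partial>M) =
     (\<Sum>s\<in>paths n. \<integral>\<^sup>+\<omega>. indicator (path_event n s) \<omega> * ennreal (f s (noise_path n s \<omega>)) \<partial>M)"
    unfolding eq by (rule nn_integral_path) measurable
  also have "\<dots> = (\<Sum>s\<in>paths n. emeasure M (path_event n s) * (\<integral>\<^sup>+y. ennreal (f s y) \<partial>PiM {1..n} (\<lambda>k. P (s k))))"
    using f by (intro sum.cong nn_integral_path_event_noise[where F="\<lambda>y. ennreal (f _ y)"]) measurable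
  also have "\<dots> \<le> (\<Sum>s\<in>paths n. emeasure M (path_event n s) * C)"
    by (intro sum_mono mult_left_mono C) auto
  also have "\<dots> = C" by (simp add: sum_distrib_right[symmetric] sum_prob_paths)
  finally show "(\<integral>\<^sup>+\<omega>. ennreal (f (\<lambda>k. st k \<omega>) (\<lambda>k. obs k \<omega>)) \<partial>M) \<le> C" .
qed

lemma lin_rec_measurable:
  assumes r: "\<And>i x. r i x \<in> borel_measurable borel" and "{1..n} \<subseteq> I"
  shows "(\<lambda>y. lin_rec r A s y T n x) \<in> borel_measurable (PiM I (\<lambda>_. borel))"
  using assms(2)
proof (induction n arbitrary: x)
  case (Suc n)
  have [measurable]: "(\<lambda>y. lin_rec r A s y T n z) \<in> borel_measurable (PiM I (\<lambda>_. borel))" for z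
 by (rule Suc.IH) (use Suc.prems in auto)
  have "Suc n \<in> I" using Suc.prems by auto
  then have [measurable]: "(\<lambda>y. r (s (Suc n)) x (y (Suc n))) \<in> borel_measurable (PiM I (\<lambda>_. borel))"
    by (intro measurable_compose[OF _ r] measurable_component_singleton)
  show ?case by simp
qed simp

text \<open>When the true state is i, \<open>\<rho> i\<close> bounds the operator norm on
  \<open>l1\<close> of the averaged step. The newest observation is independent of the earlier ones
  and is integrated first, so the bounds multiply.\<close>

lemma nn_integral_lin_rec_le:
  fixes r :: "'d \<Rightarrow> 'x::finite \<Rightarrow> real \<Rightarrow> real"
  assumes r: "\<And>i x. r i x \<in> borel_measurable borel" and r0: "\<And>i x u. 0 \<le> r i x u"
    and A0: "\<And>z x. 0 \<le> A z x" and T0: "\<And>x. 0 \<le> T x" and \<rho>0: "\<And>i. 0 \<le> \<rho> i"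
    and \<rho>: "\<And>i z. (\<Sum>x\<in>UNIV. ennreal (A z x) * (\<integral>\<^sup>+u. ennreal (r i x u) \<partial>P i)) \<le> ennreal (\<rho> i)"
  shows "(\<integral>\<^sup>+y. ennreal (\<Sum>x\<in>UNIV. lin_rec r A s y T n x) \<partial>PiM {1..n} (\<lambda>k. P (s k))) \<le>
    ennreal ((\<Sum>x\<in>UNIV. T x) * (\<Prod>k=1..n. \<rho> (s k)))"
proof -
  interpret product_sigma_finite "\<lambda>k. P (s k)"
    by (intro product_sigma_finite.intro prob_space_imp_sigma_finite prob_space_P)
  have sets_PiM[measurable_cong]: "sets (PiM I (\<lambda>k. P (s k))) = sets (PiM I (\<lambda>_. borel))" for I
    by (intro sets_PiM_cong) auto
  note lin0 = lin_rec_nonneg[of r A T, OF r0 A0 T0]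
  show ?thesis
  proof (induction n)
    case 0
    show ?case by (simp add: PiM_empty nn_integral_count_space_finite)
  next
    case (Suc n)
    have ins: "{1..Suc n} = insert (Suc n) {1..n}" by auto
    note [measurable] = r
    have [measurable]: "(\<lambda>y. lin_rec r A s y T (Suc n) x) \<in> borel_measurable (PiM {1..Suc n} (\<lambda>_. borel))" for x
      by (rule lin_rec_measurable[OF r]) simp
    have [measurable]: "(\<lambda>y. lin_rec r A s y T n x) \<in> borel_measurable (PiM {1..n} (\<lambda>_. borel))" for x
      by (rule lin_rec_measurable[OF r]) simp
    have mm: "(\<lambda>y. ennreal (\<Sum>x\<in>UNIV. lin_rec r A s y T (Suc n) x)) \<in>
        borel_measurable (PiM {1..Suc n} (\<lambda>k. P (s k)))"
      by measurable
    have "(\<integral>\<^sup>+y. ennreal (\<Sum>x\<in>UNIV. lin_rec r A s y T (Suc n) x) \<partial>PiM {1..Suc n} (\<lambda>k. P (s k))) =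
      (\<integral>\<^sup>+y. \<integral>\<^sup>+v. ennreal (\<Sum>x\<in>UNIV. lin_rec r A s (y(Suc n := v)) T (Suc n) x) \<partial>P (s (Suc n)) \<partial>PiM {1..n} (\<lambda>k. P (s k)))"
      unfolding ins by (rule product_nn_integral_insert[OF _ _ mm[unfolded ins]]) auto
    also have "\<dots> \<le> (\<integral>\<^sup>+y. ennreal (\<rho> (s (Suc n))) * ennreal (\<Sum>x\<in>UNIV. lin_rec r A s y T n x) \<partial>PiM {1..n} (\<lambda>k. P (s k)))"
    proof (rule nn_integral_mono)
      fix y
      have c: "lin_rec r A s (y(Suc n := v)) T n = lin_rec r A s y T n" for v
        by (rule lin_rec_cong) auto
      let ?i = "s (Suc n)"
      let ?l = "lin_rec r A s y T n"
      have "(\<integral>\<^sup>+v. ennreal (\<Sum>x\<in>UNIV. lin_rec r A s (y(Suc n := v)) T (Suc n) x) \<partial>P ?i) =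
        (\<integral>\<^sup>+v. (\<Sum>x\<in>UNIV. ennreal (r ?i x v) * (\<Sum>z\<in>UNIV. ennreal (A z x) * ennreal (?l z))) \<partial>P ?i)"
        using r0 A0 lin0
        by (intro nn_integral_cong)
          (simp add: c ennreal_mult[symmetric] sum_ennreal sum_nonneg mult_nonneg_nonneg)
      also have "\<dots> = (\<Sum>x\<in>UNIV. (\<integral>\<^sup>+v. ennreal (r ?i x v) \<partial>P ?i) * (\<Sum>z\<in>UNIV. ennreal (A z x) * ennreal (?l z)))"
        by (simp add: nn_integral_sum nn_integral_multc)
      also have "\<dots> = (\<Sum>x\<in>UNIV. \<Sum>z\<in>UNIV. (ennreal (A z x) * (\<integral>\<^sup>+v. ennreal (r ?i x v) \<partial>P ?i)) * ennreal (?l z))"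
        by (simp add: sum_distrib_left sum_distrib_right mult_ac)
      also have "\<dots> = (\<Sum>z\<in>UNIV. (\<Sum>x\<in>UNIV. ennreal (A z x) * (\<integral>\<^sup>+v. ennreal (r ?i x v) \<partial>P ?i)) * ennreal (?l z))"
        by (subst sum.swap) (simp add: sum_distrib_right)
      also have "\<dots> \<le> (\<Sum>z\<in>UNIV. ennreal (\<rho> ?i) * ennreal (?l z))"
        by (intro sum_mono mult_right_mono \<rho>) auto
      also have "\<dots> = ennreal (\<rho> ?i) * ennreal (\<Sum>x\<in>UNIV. ?l x)"
        using lin0 by (simp add: sum_distrib_left[symmetric] sum_ennreal)
      finally show "(\<integral>\<^sup>+v. ennreal (\<Sum>x\<in>UNIV. lin_rec r A s (y(Suc n := v)) T (Suc n) x) \<partial>P ?i) \<le>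
          ennreal (\<rho> ?i) * ennreal (\<Sum>x\<in>UNIV. ?l x)" .
    qed
    also have "\<dots> = ennreal (\<rho> (s (Suc n))) * (\<integral>\<^sup>+y. ennreal (\<Sum>x\<in>UNIV. lin_rec r A s y T n x) \<partial>PiM {1..n} (\<lambda>k. P (s k)))"
      by (rule nn_integral_cmult) measurable
    also have "\<dots> \<le> ennreal (\<rho> (s (Suc n))) * ennreal ((\<Sum>x\<in>UNIV. T x) * (\<Prod>k=1..n. \<rho> (s k)))"
      by (intro mult_left_mono Suc) auto
    also have "\<dots> = ennreal ((\<Sum>x\<in>UNIV. T x) * (\<Prod>k=1..Suc n. \<rho> (s k)))"
      using \<rho>0 T0 by (simp add: ennreal_mult[symmetric] sum_nonneg prod_nonneg mult_ac)
    finally show ?case .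
  qed
qed

end


section \<open>Almost sure growth rates and means\<close>

lemma slow_eq:
  assumes "stochastic \<Lambda>"
  shows "slow \<Lambda> \<epsilon> $ i $ j = (if i = j then 1 - \<epsilon> else 0) + \<epsilon> * \<Lambda> $ i $ j"
proof -
  have "(\<Sum>l\<in>UNIV. \<Lambda> $ i $ l) = 1" using assms by (simp add: stochastic_def prob_vec_def)
  then have "(\<Sum>l\<in>UNIV - {i}. \<Lambda> $ i $ l) = 1 - \<Lambda> $ i $ i" by (simp add: sum_diff1)
  then show ?thesis by (cases "i = j") (simp_all add: slow_def right_diff_distrib)
qed

lemma stochastic_slow:
  assumes "stochastic \<Lambda>" "\<epsilon> \<in> {0<..<1}"
  shows "stochastic (slow \<Lambda> \<epsilon>)"
  using assms unfolding stochastic_def prob_vec_def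
  by (auto simp: slow_eq[OF assms(1)] sum.distrib sum_distrib_left[symmetric])

definition expect_next :: "real ^ 'd ^ 'd \<Rightarrow> ('d::finite \<Rightarrow> real) \<Rightarrow> 'd \<Rightarrow> real" where
  "expect_next \<Lambda> f i = (\<Sum>j\<in>UNIV. \<Lambda> $ i $ j * f j)"

text \<open>Duality between moving the law forward and averaging the function backward.\<close>

lemma sum_law_at:
  "(\<Sum>j\<in>UNIV. law_at \<Lambda> p m $ j * f j) = (\<Sum>i\<in>UNIV. p $ i * (expect_next \<Lambda> ^^ m) f i)"
proof (induction m arbitrary: f)
  case 0
  then show ?case by (simp add: law_at_def)
next
  case (Suc m)
  have "(\<Sum>j\<in>UNIV. law_at \<Lambda> p (Suc m) $ j * f j) =
      (\<Sum>j\<in>UNIV. \<Sum>i\<in>UNIV. \<Lambda> $ i $ j * law_at \<Lambda> p m $ i * f j)"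
    by (simp add: law_at_def matrix_vector_mult_def transpose_def sum_distrib_right
        flip: transpose_matrix_vector)
  also have "\<dots> = (\<Sum>i\<in>UNIV. law_at \<Lambda> p m $ i * expect_next \<Lambda> f i)"
    by (subst sum.swap) (simp add: expect_next_def sum_distrib_left mult_ac)
  also have "\<dots> = (\<Sum>i\<in>UNIV. p $ i * (expect_next \<Lambda> ^^ Suc m) f i)"
    by (simp only: Suc funpow_Suc_right comp_def)
  finally show ?case .
qed

lemma expect_next_funpow_tendsto:
  fixes \<mu> :: "real ^ 'd::finite"
  assumes "ergodic_with_limits \<Lambda> \<mu>"
  shows "(\<lambda>m. (expect_next \<Lambda> ^^ m) f i) \<longlonglongrightarrow> (\<Sum>j\<in>UNIV. \<mu> $ j * f j)"
proof -
  have "prob_vec (axis i 1 :: real ^ 'd)"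
    by (auto simp: prob_vec_def axis_def)
  then have "(\<lambda>m. \<Sum>j\<in>UNIV. law_at \<Lambda> (axis i 1) m $ j * f j) \<longlonglongrightarrow> (\<Sum>j\<in>UNIV. \<mu> $ j * f j)"
    using assms by (intro tendsto_sum tendsto_mult tendsto_const) (auto simp: ergodic_with_limits_def)
  moreover have "(\<Sum>j\<in>UNIV. law_at \<Lambda> (axis i 1) m $ j * f j) = (expect_next \<Lambda> ^^ m) f i" for m
    unfolding sum_law_at by (simp add: axis_def if_distrib[where f="\<lambda>x. x * _"] cong: if_cong)
  ultimately show ?thesis by simp
qed

lemma abs_le_sum_abs:
  fixes h :: "'i::finite \<Rightarrow> real"
  shows "\<bar>h i\<bar> \<le> (\<Sum>i\<in>UNIV. \<bar>h i\<bar>)"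
  by (rule member_le_sum) auto

section \<open>Almost sure consequences of the moment bounds\<close>

context hidden_chain
begin

text \<open>Dividing by the product of the \<open>\<rho>\<close> along the path leaves expectations
  bounded in n. The random product stays outside, to be evaluated by the ergodic theorem.\<close>

lemma AE_sum_lin_rec_le:
  fixes r :: "'d \<Rightarrow> 'x::finite \<Rightarrow> real \<Rightarrow> real"
  assumes r: "\<And>i x. r i x \<in> borel_measurable borel" and r0: "\<And>i x u. 0 \<le> r i x u"
    and A0: "\<And>z x. 0 \<le> A z x" and T0: "\<And>x. 0 \<le> T x" and \<rho>0: "\<And>i. 0 < \<rho> i"
    and \<rho>: "\<And>i z. (\<Sum>x\<in>UNIV. ennreal (A z x) * (\<integral>\<^sup>+u. ennreal (r i x u) \<partial>P i)) \<le> ennreal (\<rho> i)"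
  shows "AE \<omega> in M. \<forall>\<delta>>0. \<forall>\<^sub>F n in sequentially.
    (\<Sum>x\<in>UNIV. lin_rec r A (\<lambda>k. st k \<omega>) (\<lambda>k. obs k \<omega>) T n x) \<le>
      exp (\<delta> * real n) * (\<Prod>k<n. \<rho> (st (Suc k) \<omega>))"
proof -
  define f where "f n s y = (\<Sum>x\<in>UNIV. lin_rec r A s y T n x) / (\<Prod>k=1..n. \<rho> (s k))" for n s y
  have f_meas: "f n s \<in> borel_measurable (PiM {1..n} (\<lambda>_. borel))" for n s
  proof -
    have [measurable]: "(\<lambda>y. lin_rec r A s y T n x) \<in> borel_measurable (PiM {1..n} (\<lambda>_. borel))" for x
      by (rule lin_rec_measurable[OF r]) simp
    show ?thesis unfolding f_def by measurable
  qed
  have f_cong: "f n s y = f n s' y'" if "\<forall>k\<le>n. s k = s' k" "\<forall>k\<in>{1..n}. y k = y' k" for n s s' y y'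
  proof -
    have "lin_rec r A s y T n = lin_rec r A s' y' T n"
      using that by (intro lin_rec_cong) auto
    moreover have "(\<Prod>k=1..n. \<rho> (s k)) = (\<Prod>k=1..n. \<rho> (s' k))"
      using that by (intro prod.cong) auto
    ultimately show ?thesis by (simp add: f_def)
  qed
  have bound: "(\<integral>\<^sup>+y. ennreal (f n s y) \<partial>PiM {1..n} (\<lambda>k. P (s k))) \<le> ennreal (\<Sum>x\<in>UNIV. T x)" for n s
  proof -
    have [measurable]: "(\<lambda>y. lin_rec r A s y T n x) \<in> borel_measurable (PiM {1..n} (\<lambda>k. P (s k)))" for x
    proof -
      have "sets (PiM {1..n} (\<lambda>k. P (s k))) = sets (PiM {1..n} (\<lambda>_. borel))"
        by (intro sets_PiM_cong) auto
      moreover have "(\<lambda>y. lin_rec r A s y T n x) \<in> borel_measurable (PiM {1..n} (\<lambda>_. borel))"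
        by (rule lin_rec_measurable[OF r order_refl])
      ultimately show ?thesis by (simp cong: measurable_cong_sets)
    qed
    have pos: "(\<Prod>k=1..n. \<rho> (s k)) > 0" by (intro prod_pos) (simp add: \<rho>0)
    have "(\<integral>\<^sup>+y. ennreal (f n s y) \<partial>PiM {1..n} (\<lambda>k. P (s k))) =
      (\<integral>\<^sup>+y. ennreal (1 / (\<Prod>k=1..n. \<rho> (s k))) * ennreal (\<Sum>x\<in>UNIV. lin_rec r A s y T n x) \<partial>PiM {1..n} (\<lambda>k. P (s k)))"
      using pos lin_rec_nonneg[of r A T, OF r0 A0 T0] unfolding f_def
      by (intro nn_integral_cong) (simp add: ennreal_mult[symmetric] sum_nonneg)
    also have "\<dots> = ennreal (1 / (\<Prod>k=1..n. \<rho> (s k))) * (\<integral>\<^sup>+y. ennreal (\<Sum>x\<in>UNIV. lin_rec r A s y T n x) \<partial>PiM {1..n} (\<lambda>k. P (s k)))"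
      by (rule nn_integral_cmult) measurable
    also have "\<dots> \<le> ennreal (1 / (\<Prod>k=1..n. \<rho> (s k))) * ennreal ((\<Sum>x\<in>UNIV. T x) * (\<Prod>k=1..n. \<rho> (s k)))"
      using \<rho>0 by (intro mult_left_mono nn_integral_lin_rec_le[OF r r0 A0 T0 _ \<rho>]) (auto simp: less_imp_le)
    also have "\<dots> = ennreal (\<Sum>x\<in>UNIV. T x)"
      using pos T0 by (simp add: ennreal_mult[symmetric] sum_nonneg less_imp_neq[OF pos, symmetric] del: prod_zero_iff)
    finally show ?thesis .
  qed
  have "AE \<omega> in M. \<forall>\<delta>>0. \<forall>\<^sub>F n in sequentially. f n (\<lambda>k. st k \<omega>) (\<lambda>k. obs k \<omega>) \<le> exp (\<delta> * real n)"
    using T0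
    by (intro AE_eventually_le_exp[where C="\<Sum>x\<in>UNIV. T x"] path_obs_measurable[OF f_meas f_cong]
        nn_integral_path_obs_le[OF f_meas f_cong bound]) (auto simp: sum_nonneg)
  then show ?thesis
  proof eventually_elim
    case (elim \<omega>)
    have pos: "(\<Prod>k<n. \<rho> (st (Suc k) \<omega>)) > 0" for n by (intro prod_pos) (simp add: \<rho>0)
    show ?case
    proof (intro allI impI)
      fix \<delta> :: real assume "\<delta> > 0"
      with elim have "\<forall>\<^sub>F n in sequentially. f n (\<lambda>k. st k \<omega>) (\<lambda>k. obs k \<omega>) \<le> exp (\<delta> * real n)" by blast
      then show "\<forall>\<^sub>F n in sequentially. (\<Sum>x\<in>UNIV. lin_rec r A (\<lambda>k. st k \<omega>) (\<lambda>k. obs k \<omega>) T n x) \<le>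
          exp (\<delta> * real n) * (\<Prod>k<n. \<rho> (st (Suc k) \<omega>))"
      proof eventually_elim
        case (elim n)
        then show ?case
          using pos[of n] by (simp add: f_def prod.atLeast1_atMost_eq divide_le_eq)
      qed
    qed
  qed
qed

lemma AE_chain_prod_le:
  assumes q: "\<And>i j. 0 \<le> q i j" and c: "\<And>i. (\<Sum>j\<in>UNIV. L $ i $ j * q i j) \<le> c" "0 < c"
  shows "AE \<omega> in M. \<forall>\<delta>>0. \<forall>\<^sub>F n in sequentially.
    (\<Prod>k<n. q (st k \<omega>) (st (Suc k) \<omega>)) \<le> exp (\<delta> * real n) * c ^ n"
proof -
  have "AE \<omega> in M. \<forall>\<delta>>0. \<forall>\<^sub>F n in sequentially.
    (\<Prod>k<n. q (st k \<omega>) (st (Suc k) \<omega>)) / c ^ n \<le> exp (\<delta> * real n)"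
  proof (rule AE_eventually_le_exp[where C=1])
    have [measurable]: "(\<lambda>\<omega>. q (st k \<omega>) (st (Suc k) \<omega>)) \<in> borel_measurable M" for k
      by measurable
    show "(\<lambda>\<omega>. (\<Prod>k<n. q (st k \<omega>) (st (Suc k) \<omega>)) / c ^ n) \<in> borel_measurable M" for n
      by measurable
    fix n
    have "(\<integral>\<^sup>+\<omega>. ennreal ((\<Prod>k<n. q (st k \<omega>) (st (Suc k) \<omega>)) / c ^ n) \<partial>M) =
      (\<integral>\<^sup>+\<omega>. ennreal (1 / c ^ n) * ennreal (\<Prod>k<n. q (st k \<omega>) (st (Suc k) \<omega>)) \<partial>M)"
      using q \<open>0 < c\<close> by (intro nn_integral_cong) (simp add: ennreal_mult[symmetric] prod_nonneg)
    also have "\<dots> = ennreal (1 / c ^ n) * (\<integral>\<^sup>+\<omega>. ennreal (\<Prod>k<n. q (st k \<omega>) (st (Suc k) \<omega>)) \<partial>M)"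
      by (rule nn_integral_cmult) measurable
    also have "\<dots> \<le> ennreal (1 / c ^ n) * ennreal (c ^ n)"
      using q c by (intro mult_left_mono nn_integral_chain_prod_le) auto
    also have "\<dots> = ennreal 1" using c by (simp add: ennreal_mult[symmetric])
    finally show "(\<integral>\<^sup>+\<omega>. ennreal ((\<Prod>k<n. q (st k \<omega>) (st (Suc k) \<omega>)) / c ^ n) \<partial>M) \<le> ennreal 1" .
  qed simp
  then show ?thesis
    using \<open>0 < c\<close> by (simp add: divide_le_eq)
qed

text \<open>The terms are martingale differences, so factors 1 + t h have conditional mean 1 and,
  for small t of either sign, are nonnegative. Their products therefore satisfy the
  exponential-moment criterion.\<close>

lemma AE_mean_chain_tendsto_0:
  assumes h: "\<And>i. (\<Sum>j\<in>UNIV. L $ i $ j * h i j) = 0"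
  shows "AE \<omega> in M. (\<lambda>n. (\<Sum>k<n. h (st k \<omega>) (st (Suc k) \<omega>)) / real n) \<longlonglongrightarrow> 0"
proof -
  define K where "K = (\<Sum>x\<in>UNIV. \<bar>h (fst x) (snd x)\<bar>)"
  have K: "\<bar>h i j\<bar> \<le> K" for i j
    using abs_le_sum_abs[of "\<lambda>x. h (fst x) (snd x)" "(i, j)"] by (simp add: K_def)
  have "AE \<omega> in M. \<forall>\<sigma>\<in>{1, -1}. real N \<ge> 2 * K \<longrightarrow> N > 0 \<longrightarrow> (\<forall>\<delta>>0. \<forall>\<^sub>F n in sequentially.
    (\<Prod>k<n. 1 + \<sigma> / real N * h (st k \<omega>) (st (Suc k) \<omega>)) \<le> exp (\<delta> * real n))" for N
  proof (cases "real N \<ge> 2 * K \<and> N > 0")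
    case True
    have "AE \<omega> in M. \<forall>\<delta>>0. \<forall>\<^sub>F n in sequentially.
      (\<Prod>k<n. 1 + \<sigma> / real N * h (st k \<omega>) (st (Suc k) \<omega>)) \<le> exp (\<delta> * real n) * 1 ^ n"
      if "\<bar>\<sigma>\<bar> = 1" for \<sigma> :: real
    proof (rule AE_chain_prod_le)
      fix i j
      have "\<bar>\<sigma> / real N * h i j\<bar> \<le> 1"
        using K[of i j] True that by (simp add: abs_mult divide_le_eq)
      then show "0 \<le> 1 + \<sigma> / real N * h i j" by linarith
      have "(\<Sum>j\<in>UNIV. L $ i $ j * (1 + \<sigma> / real N * h i j)) =
        (\<Sum>j\<in>UNIV. L $ i $ j) + \<sigma> / real N * (\<Sum>j\<in>UNIV. L $ i $ j * h i j)"
        by (simp add: algebra_simps sum.distrib sum_distrib_left)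
      then show "(\<Sum>j\<in>UNIV. L $ i $ j * (1 + \<sigma> / real N * h i j)) \<le> 1"
        by (simp add: h L_sum)
    qed simp
    note this[of 1, OF abs_one] this[of "-1", OF trans[OF abs_minus abs_one]]
    then show ?thesis by eventually_elim
      (intro ballI impI; elim insertE emptyE; hypsubst; simp only: power_one mult_1_right)
  qed auto
  then have "AE \<omega> in M. \<forall>N. \<forall>\<sigma>\<in>{1, -1}. real N \<ge> 2 * K \<longrightarrow> N > 0 \<longrightarrow> (\<forall>\<delta>>0. \<forall>\<^sub>F n in sequentially.
    (\<Prod>k<n. 1 + \<sigma> / real N * h (st k \<omega>) (st (Suc k) \<omega>)) \<le> exp (\<delta> * real n))"
    by (subst AE_all_countable) blast
  then show ?thesis
  proof eventually_elim
    case (elim \<omega>)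
    show ?case
    proof (rule mean_tendsto_0_of_prod_le_exp[where K=K])
      fix N :: nat and t :: real assume N: "real N \<ge> 2 * K" "N > 0" "\<bar>t\<bar> = 1 / real N"
      then have "t = 1 / real N \<or> t = -1 / real N" by linarith
      then obtain \<sigma> where "\<sigma> \<in> {1, -1}" "t = \<sigma> / real N" by blast
      with elim N show "\<forall>\<delta>>0. \<forall>\<^sub>F n in sequentially.
          (\<Prod>k<n. 1 + t * h (st k \<omega>) (st (Suc k) \<omega>)) \<le> exp (\<delta> * real n)" by blast
    qed (rule K)
  qed
qed

lemma lin_rec_unit:
  fixes r :: "'d \<Rightarrow> unit \<Rightarrow> real \<Rightarrow> real"
  shows "lin_rec r (\<lambda>_ _. 1) s y (\<lambda>_. 1) n x = (\<Prod>k<n. r (s (Suc k)) () (y (Suc k)))"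
  by (induction n arbitrary: x) (auto simp: UNIV_unit)

text \<open>Given the path, the centred terms are independent with mean zero, so the same
  exponential-moment argument applies; the products are the instance of \<open>lin_rec\<close> over
  a one-point index.\<close>

lemma AE_mean_noise_tendsto_0:
  assumes \<psi>[measurable]: "\<And>i. \<psi> i \<in> borel_measurable borel" and K0: "\<And>i u. \<bar>\<psi> i u\<bar> \<le> K"
  shows "AE \<omega> in M. (\<lambda>n. (\<Sum>k<n. \<psi> (st (Suc k) \<omega>) (obs (Suc k) \<omega>) - (LINT u|P (st (Suc k) \<omega>). \<psi> (st (Suc k) \<omega>) u)) / real n)
    \<longlonglongrightarrow> 0"
proof -
  define m where "m i = (LINT u|P i. \<psi> i u)" for i
  have int: "integrable (P i) (\<psi> i)" for i
  proof -
    interpret P: prob_space "P i" by (rule prob_space_P)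
    show ?thesis by (rule P.integrable_const_bound[where B=K]) (simp_all add: K0)
  qed
  have mK: "\<bar>m i\<bar> \<le> K" for i
  proof -
    interpret P: prob_space "P i" by (rule prob_space_P)
    have "\<bar>m i\<bar> \<le> (LINT u|P i. \<bar>\<psi> i u\<bar>)" unfolding m_def by (rule integral_abs_bound)
    also have "\<dots> \<le> (LINT u|P i. K)" using int K0 by (intro integral_mono) auto
    finally show ?thesis using P.prob_space by simp
  qed
  have K: "\<bar>\<psi> i u - m i\<bar> \<le> 2 * K" for i u using K0[of i u] mK[of i] by linarith
  have "AE \<omega> in M. \<forall>\<sigma>\<in>{1, -1}. real N \<ge> 2 * (2 * K) \<longrightarrow> N > 0 \<longrightarrow> (\<forall>\<delta>>0. \<forall>\<^sub>F n in sequentially.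
    (\<Prod>k<n. 1 + \<sigma> / real N * (\<psi> (st (Suc k) \<omega>) (obs (Suc k) \<omega>) - m (st (Suc k) \<omega>))) \<le> exp (\<delta> * real n))" for N
  proof (cases "real N \<ge> 2 * (2 * K) \<and> N > 0")
    case True
    have nn: "0 \<le> 1 + \<sigma> / real N * (\<psi> i u - m i)" if "\<bar>\<sigma>\<bar> = 1" for \<sigma> :: real and i u
    proof -
      have "\<bar>\<sigma> / real N * (\<psi> i u - m i)\<bar> \<le> 1"
        using K[of i u] True that by (simp add: abs_mult divide_le_eq)
      then show ?thesis by linarith
    qed
    have "AE \<omega> in M. \<forall>\<delta>>0. \<forall>\<^sub>F n in sequentially.
      (\<Sum>x\<in>(UNIV::unit set). lin_rec (\<lambda>i _ u. 1 + \<sigma> / real N * (\<psi> i u - m i)) (\<lambda>_ _. 1) (\<lambda>k. st k \<omega>) (\<lambda>k. obs k \<omega>) (\<lambda>_. 1) n x) \<le>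
         exp (\<delta> * real n) * (\<Prod>k<n. (\<lambda>_. 1) (st (Suc k) \<omega>))"
      if "\<bar>\<sigma>\<bar> = 1" for \<sigma> :: real
    proof (rule AE_sum_lin_rec_le)
      fix i u
      show "0 \<le> 1 + \<sigma> / real N * (\<psi> i u - m i)" using that by (rule nn)
    next
      fix i
      interpret P: prob_space "P i" by (rule prob_space_P)
      have "(\<integral>\<^sup>+u. ennreal (1 + \<sigma> / real N * (\<psi> i u - m i)) \<partial>P i) =
        ennreal (LINT u|P i. 1 + \<sigma> / real N * (\<psi> i u - m i))"
        using int nn[OF that] by (intro nn_integral_eq_integral) auto
      also have "(LINT u|P i. 1 + \<sigma> / real N * (\<psi> i u - m i)) = 1"
        using int P.prob_space by (simp add: m_def[symmetric])
      finally show "(\<Sum>x\<in>(UNIV::unit set). ennreal 1 * (\<integral>\<^sup>+u. ennreal (1 + \<sigma> / real N * (\<psi> i u - m i)) \<partial>P i)) \<le> ennreal 1"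
        by (simp add: UNIV_unit)
    qed simp_all
    then have "AE \<omega> in M. \<forall>\<delta>>0. \<forall>\<^sub>F n in sequentially.
      (\<Prod>k<n. 1 + \<sigma> / real N * (\<psi> (st (Suc k) \<omega>) (obs (Suc k) \<omega>) - m (st (Suc k) \<omega>))) \<le> exp (\<delta> * real n)"
      if "\<bar>\<sigma>\<bar> = 1" for \<sigma> :: real
      using that by (simp add: lin_rec_unit UNIV_unit)
    note this[of 1, OF abs_one] this[of "-1", OF trans[OF abs_minus abs_one]]
    then show ?thesis by eventually_elim
      (intro ballI impI; elim insertE emptyE; hypsubst; simp only: power_one mult_1_right)
  qed auto
  then have "AE \<omega> in M. \<forall>N. \<forall>\<sigma>\<in>{1, -1}. real N \<ge> 2 * (2 * K) \<longrightarrow> N > 0 \<longrightarrow> (\<forall>\<delta>>0. \<forall>\<^sub>F n in sequentially.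
    (\<Prod>k<n. 1 + \<sigma> / real N * (\<psi> (st (Suc k) \<omega>) (obs (Suc k) \<omega>) - m (st (Suc k) \<omega>))) \<le> exp (\<delta> * real n))"
    by (subst AE_all_countable) blast
  then show ?thesis
    unfolding m_def[symmetric]
  proof eventually_elim
    case (elim \<omega>)
    show ?case
    proof (rule mean_tendsto_0_of_prod_le_exp[where K="2 * K"])
      fix N :: nat and t :: real assume N: "real N \<ge> 2 * (2 * K)" "N > 0" "\<bar>t\<bar> = 1 / real N"
      then have "t = 1 / real N \<or> t = -1 / real N" by linarith
      then obtain \<sigma> where "\<sigma> \<in> {1, -1}" "t = \<sigma> / real N" by blast
      with elim N show "\<forall>\<delta>>0. \<forall>\<^sub>F n in sequentially.
          (\<Prod>k<n. 1 + t * (\<psi> (st (Suc k) \<omega>) (obs (Suc k) \<omega>) - m (st (Suc k) \<omega>))) \<le> exp (\<delta> * real n)" by blast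
    qed (rule K)
  qed
qed

text \<open>The Poisson equation of the fast chain: for \<open>H = f + \<Lambda>f + \<dots> + \<Lambda>\<^bsup>m-1\<^esup>f\<close> one has
  \<open>H - \<Lambda>H = f - \<Lambda>\<^bsup>m\<^esup>f\<close>, and the slow chain multiplies the left side by \<open>\<epsilon>\<close>.\<close>

lemma AE_mean_chain_tendsto:
  assumes slow: "L = slow \<Lambda> \<epsilon>" "\<epsilon> > 0" "stochastic \<Lambda>" and erg: "ergodic_with_limits \<Lambda> \<mu>"
  shows "AE \<omega> in M. (\<lambda>n. (\<Sum>k<n. f (st (Suc k) \<omega>)) / real n) \<longlonglongrightarrow> (\<Sum>i\<in>UNIV. \<mu> $ i * f i)"
proof -
  define F where "F m = (expect_next \<Lambda> ^^ m) f" for m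
  define H where "H m i = (\<Sum>r<m. F r i)" for m i
  define h where "h m i j = H m j - (H m i - \<epsilon> * (f i - F m i))" for m i j
  have next_H: "expect_next \<Lambda> (H m) i = H m i - (f i - F m i)" for m i
  proof -
    have "expect_next \<Lambda> (H m) i = (\<Sum>r<m. F (Suc r) i)"
      unfolding H_def expect_next_def sum_distrib_left by (subst sum.swap) (simp add: F_def expect_next_def)
    also have "\<dots> = H m i + (\<Sum>r<m. F (Suc r) i - F r i)" by (simp add: H_def sum_subtractf)
    also have "\<dots> = H m i + (F m i - F 0 i)" by (subst sum_lessThan_telescope) simp
    finally show ?thesis by (simp add: F_def)
  qed
  have h0: "(\<Sum>j\<in>UNIV. L $ i $ j * h m i j) = 0" for m i
  proof -
    have "(\<Sum>j\<in>UNIV. L $ i $ j * H m j) =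
        (\<Sum>j\<in>UNIV. (if i = j then (1 - \<epsilon>) * H m j else 0) + \<epsilon> * (\<Lambda> $ i $ j * H m j))"
      unfolding slow(1) slow_eq[OF slow(3)] by (intro sum.cong) (auto simp: algebra_simps)
    also have "\<dots> = (1 - \<epsilon>) * H m i + \<epsilon> * expect_next \<Lambda> (H m) i"
      by (simp add: sum.distrib expect_next_def sum_distrib_left[symmetric])
    also have "\<dots> = H m i - \<epsilon> * (f i - F m i)" by (simp add: next_H algebra_simps)
    moreover have "(\<Sum>j\<in>UNIV. L $ i $ j * h m i j) =
        (\<Sum>j\<in>UNIV. L $ i $ j * H m j) - (\<Sum>j\<in>UNIV. L $ i $ j) * (H m i - \<epsilon> * (f i - F m i))"
      by (simp add: h_def right_diff_distrib sum_subtractf sum_distrib_right)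
    ultimately show ?thesis by (simp add: L_sum)
  qed
  have "AE \<omega> in M. \<forall>m. (\<lambda>n. (\<Sum>k<n. h m (st k \<omega>) (st (Suc k) \<omega>)) / real n) \<longlonglongrightarrow> 0"
    unfolding AE_all_countable by (intro allI AE_mean_chain_tendsto_0 h0)
  then show ?thesis
  proof eventually_elim
    case (elim \<omega>)
    let ?s = "\<lambda>k. st k \<omega>"
    \<comment> \<open>There are finitely many states, so the boundary terms of telescoping sums are
      bounded and vanish after division by n.\<close>
    have bdd: "(\<lambda>n. (u (?s n) - u (?s 0)) / real n) \<longlonglongrightarrow> 0" for u :: "'d \<Rightarrow> real"
    proof (rule tendsto_0_le[where K=1])
      show "(\<lambda>n. 2 * (\<Sum>i\<in>UNIV. \<bar>u i\<bar>) / real n) \<longlonglongrightarrow> 0"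
        by (rule lim_const_over_n)
      show "\<forall>\<^sub>F n in sequentially. norm ((u (?s n) - u (?s 0)) / real n) \<le>
          norm (2 * (\<Sum>i\<in>UNIV. \<bar>u i\<bar>) / real n) * 1"
      proof (rule always_eventually, rule allI)
        fix n
        have "\<bar>u (?s n) - u (?s 0)\<bar> \<le> 2 * (\<Sum>i\<in>UNIV. \<bar>u i\<bar>)"
          using abs_le_sum_abs[of u "?s n"] abs_le_sum_abs[of u "?s 0"] by linarith
        then show "norm ((u (?s n) - u (?s 0)) / real n) \<le> norm (2 * (\<Sum>i\<in>UNIV. \<bar>u i\<bar>) / real n) * 1"
          by (simp add: divide_right_mono)
      qed
    qed
    have mean_F: "(\<lambda>n. (\<Sum>k<n. f (?s k) - F m (?s k)) / real n) \<longlonglongrightarrow> 0" for m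
    proof -
      have "(\<lambda>n. 1 / \<epsilon> * ((\<Sum>k<n. h m (?s k) (?s (Suc k))) / real n - (H m (?s n) - H m (?s 0)) / real n)) \<longlonglongrightarrow> 1 / \<epsilon> * (0 - 0)"
        using elim by (intro tendsto_mult tendsto_diff tendsto_const bdd) auto
      moreover have "(\<Sum>k<n. h m (?s k) (?s (Suc k))) = H m (?s n) - H m (?s 0) + \<epsilon> * (\<Sum>k<n. f (?s k) - F m (?s k))" for n
      proof -
        have "(\<Sum>k<n. h m (?s k) (?s (Suc k))) = (\<Sum>k<n. H m (?s (Suc k)) - H m (?s k)) + (\<Sum>k<n. \<epsilon> * (f (?s k) - F m (?s k)))"
          by (simp add: h_def sum.distrib[symmetric] algebra_simps)
        then show ?thesis by (subst (asm) sum_lessThan_telescope) (simp add: sum_distrib_left)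
      qed
      ultimately show ?thesis using \<open>\<epsilon> > 0\<close> by (simp add: add_divide_distrib)
    qed
    \<comment> \<open>First m is fixed so that \<open>F m\<close> is within e/2 of the stationary
      mean in every state; then n grows.\<close>
    have mean_f: "(\<lambda>n. (\<Sum>k<n. f (?s k)) / real n) \<longlonglongrightarrow> (\<Sum>i\<in>UNIV. \<mu> $ i * f i)"
    proof (rule tendstoI)
      fix e :: real assume e: "e > 0"
      let ?\<mu>f = "\<Sum>i\<in>UNIV. \<mu> $ i * f i"
      have "\<forall>\<^sub>F m in sequentially. \<forall>i. dist (F m i) ?\<mu>f < e / 2"
        using e unfolding F_def by (intro eventually_all_finite tendstoD[OF expect_next_funpow_tendsto[OF erg]]) simp
      then obtain m where m: "\<And>i. \<bar>F m i - ?\<mu>f\<bar> < e / 2"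
        by (auto simp: eventually_sequentially dist_real_def)
      have "\<forall>\<^sub>F n in sequentially. dist ((\<Sum>k<n. f (?s k) - F m (?s k)) / real n) 0 < e / 2"
        using e by (intro tendstoD[OF mean_F]) simp
      then show "\<forall>\<^sub>F n in sequentially. dist ((\<Sum>k<n. f (?s k)) / real n) ?\<mu>f < e"
        using eventually_gt_at_top[of 0]
      proof eventually_elim
        case (elim n)
        have "(\<Sum>k<n. f (?s k)) - real n * ?\<mu>f = (\<Sum>k<n. f (?s k) - F m (?s k)) + (\<Sum>k<n. F m (?s k) - ?\<mu>f)"
          by (simp add: sum_subtractf)
        moreover have "\<bar>\<Sum>k<n. F m (?s k) - ?\<mu>f\<bar> \<le> (\<Sum>k<n. e / 2)"
          using m by (intro order_trans[OF sum_abs] sum_mono) (simp add: less_imp_le)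
        moreover have "(\<Sum>k<n. e / 2) = e / 2 * real n" "e / 2 * real n + e / 2 * real n = e * real n"
          by simp_all
        moreover have "\<bar>\<Sum>k<n. f (?s k) - F m (?s k)\<bar> < e / 2 * real n"
          using elim by (simp add: field_simps)
        ultimately have "\<bar>(\<Sum>k<n. f (?s k)) - real n * ?\<mu>f\<bar> < e * real n" by linarith
        moreover have "(\<Sum>k<n. f (?s k)) / real n - ?\<mu>f = ((\<Sum>k<n. f (?s k)) - real n * ?\<mu>f) / real n"
          using elim by (simp add: field_simps)
        ultimately show ?case using elim by (simp add: dist_real_def divide_less_eq)
      qed
    qed
    have "(\<lambda>n. (\<Sum>k<n. f (?s k)) / real n + (f (?s n) - f (?s 0)) / real n) \<longlonglongrightarrow> (\<Sum>i\<in>UNIV. \<mu> $ i * f i) + 0"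
      by (intro tendsto_add mean_f bdd)
    moreover have "(\<Sum>k<n. f (?s k)) + (f (?s n) - f (?s 0)) = (\<Sum>k<n. f (?s (Suc k)))" for n
      using sum_lessThan_telescope[of "\<lambda>k. f (?s k)" n] by (simp add: sum_subtractf)
    ultimately show ?case by (simp add: add_divide_distrib[symmetric])
  qed
qed

end


section \<open>Time averages of integrable functions of state and observation\<close>

context hidden_chain
begin

lemma
  fixes f :: "'d \<Rightarrow> real \<Rightarrow> real"
  assumes f[measurable]: "\<And>i. f i \<in> borel_measurable borel" and n: "1 \<le> n"
  shows obs_measurable: "(\<lambda>\<omega>. f (st n \<omega>) (obs n \<omega>)) \<in> borel_measurable M"
    and nn_integral_obs_le: "(\<And>i. (\<integral>\<^sup>+u. ennreal (f i u) \<partial>P i) \<le> C) \<Longrightarrow>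
      (\<integral>\<^sup>+\<omega>. ennreal (f (st n \<omega>) (obs n \<omega>)) \<partial>M) \<le> C"
proof -
  have n': "n \<in> {1..n}" using n by simp
  have m[measurable]: "(\<lambda>y. f (s n) (y n)) \<in> borel_measurable (PiM {1..n} (\<lambda>_. borel))" for s
    by (rule measurable_compose[OF measurable_component_singleton[OF n'] f])
  have c: "f (s n) (y n) = f (s' n) (y' n)" if "\<forall>k\<le>n. s k = s' k" "\<forall>k\<in>{1..n}. y k = y' k" for s s' y y'
    using that n' by auto
  show "(\<lambda>\<omega>. f (st n \<omega>) (obs n \<omega>)) \<in> borel_measurable M"
    by (rule path_obs_measurable[where f="\<lambda>s y. f (s n) (y n)" and n=n]) (rule m, rule c)
  assume C: "\<And>i. (\<integral>\<^sup>+u. ennreal (f i u) \<partial>P i) \<le> C"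
  have "(\<integral>\<^sup>+y. ennreal (f (s n) (y n)) \<partial>PiM {1..n} (\<lambda>k. P (s k))) \<le> C" for s
  proof -
    note [measurable] = \<xi>_measurable[OF n]
    have "(\<integral>\<^sup>+y. ennreal (f (s n) (y n)) \<partial>PiM {1..n} (\<lambda>k. P (s k))) =
        (\<integral>\<^sup>+\<omega>. ennreal (f (s n) (noise_path n s \<omega> n)) \<partial>M)"
      unfolding distr_noise_path[symmetric] by (rule nn_integral_distr) measurable
    also have "\<dots> = (\<integral>\<^sup>+\<omega>. ennreal (f (s n) (\<xi> n (s n) \<omega>)) \<partial>M)"
      using n by (simp add: noise_path_def)
    also have "\<dots> = (\<integral>\<^sup>+u. ennreal (f (s n) u) \<partial>distr M borel (\<xi> n (s n)))"
      by (rule nn_integral_distr[symmetric]) measurable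
    also have "\<dots> \<le> C" unfolding distr_\<xi>[OF n] by (rule C)
    finally show ?thesis .
  qed
  then show "(\<integral>\<^sup>+\<omega>. ennreal (f (st n \<omega>) (obs n \<omega>)) \<partial>M) \<le> C"
    by (intro nn_integral_path_obs_le[where f="\<lambda>s y. f (s n) (y n)" and n=n]) (rule m, rule c)
qed

text \<open>Only a finite mean is available for the terms, hence no bound on all large \<open>n\<close>: the
  truncated parts obey a law of large numbers, and Fatou's lemma makes the
  tails small along a subsequence.\<close>

lemma AE_frequently_sum_le:
  fixes \<zeta> :: "'d \<Rightarrow> real \<Rightarrow> real"
  assumes slow: "L = slow \<Lambda> \<epsilon>" "\<epsilon> > 0" "stochastic \<Lambda>" and erg: "ergodic_with_limits \<Lambda> \<mu>"
    and [measurable]: "\<And>i. \<zeta> i \<in> borel_measurable borel" and int: "\<And>i. integrable (P i) (\<zeta> i)"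
  shows "AE \<omega> in M. \<forall>\<delta>>0. \<exists>\<^sub>F n in sequentially.
    (\<Sum>k<n. \<zeta> (st (Suc k) \<omega>) (obs (Suc k) \<omega>)) \<le> ((\<Sum>i\<in>UNIV. \<mu> $ i * (LINT u|P i. \<zeta> i u)) + \<delta>) * real n"
proof -
  \<comment> \<open>Cut at level T: \<open>c\<close> is bounded and \<open>\<psi>\<close> is the
    excess above T. Values below -T are raised to -T, which is allowed because only an upper bound
    on the sums is wanted.\<close>
  define \<psi> where "\<psi> T i u = max 0 (\<zeta> i u - real T)" for T :: nat and i u
  define c where "c T i u = max (- real T) (min (\<zeta> i u) (real T))" for T :: nat and i u
  define m where "m T i = (LINT u|P i. c T i u)" for T i
  define \<tau> where "\<tau> T = (\<Sum>i\<in>UNIV. LINT u|P i. \<psi> T i u)" for T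
  have [measurable]: "\<psi> T i \<in> borel_measurable borel" "c T i \<in> borel_measurable borel" for T i
    unfolding \<psi>_def[abs_def] c_def[abs_def] by measurable
  have \<psi>0: "0 \<le> \<psi> T i u" for T i u by (simp add: \<psi>_def)
  have int_\<psi>: "integrable (P i) (\<psi> T i)" for T i
    by (rule Bochner_Integration.integrable_bound[OF int[of i]]) (auto simp: \<psi>_def)
  have cK: "\<bar>c T i u\<bar> \<le> real T" for T i u by (auto simp: c_def)
  have \<zeta>_le: "\<zeta> i u \<le> c T i u + \<psi> T i u" for T i u by (auto simp: \<psi>_def c_def)
  have ev: "\<forall>\<^sub>F T in sequentially. \<bar>\<zeta> i u\<bar> \<le> real T" for i u
    using filterlim_real_sequentially by (simp add: filterlim_at_top)
  have "\<tau> \<longlonglongrightarrow> (\<Sum>i\<in>UNIV. LINT u|P i. 0)"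
    unfolding \<tau>_def
  proof (intro tendsto_sum integral_dominated_convergence[where w="\<lambda>u. \<bar>\<zeta> i u\<bar>" for i] AE_I2)
    fix i u
    have "\<forall>\<^sub>F T in sequentially. \<psi> T i u = 0"
      using ev[of i u] by eventually_elim (auto simp: \<psi>_def)
    then show "(\<lambda>T. \<psi> T i u) \<longlonglongrightarrow> 0" by (rule tendsto_eventually)
  qed (use int in \<open>auto simp: \<psi>_def\<close>)
  then have \<tau>_lim: "\<tau> \<longlonglongrightarrow> 0" by simp
  have m_lim: "(\<lambda>T. m T i) \<longlonglongrightarrow> (LINT u|P i. \<zeta> i u)" for i
    unfolding m_def
  proof (intro integral_dominated_convergence[where w="\<lambda>u. \<bar>\<zeta> i u\<bar>"] AE_I2)
    fix u
    have "\<forall>\<^sub>F T in sequentially. c T i u = \<zeta> i u"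
      using ev[of i u] by eventually_elim (auto simp: c_def)
    then show "(\<lambda>T. c T i u) \<longlonglongrightarrow> \<zeta> i u" by (rule tendsto_eventually)
  qed (use int in \<open>auto simp: c_def\<close>)
  have sum_lim: "(\<lambda>T. \<Sum>i\<in>UNIV. \<mu> $ i * m T i) \<longlonglongrightarrow> (\<Sum>i\<in>UNIV. \<mu> $ i * (LINT u|P i. \<zeta> i u))"
    by (intro tendsto_sum tendsto_mult tendsto_const m_lim)

  define Z where "Z T n \<omega> = (\<Sum>k<n. \<psi> T (st (Suc k) \<omega>) (obs (Suc k) \<omega>)) / real n" for T n \<omega>
  have [measurable]: "(\<lambda>\<omega>. \<psi> T (st (Suc k) \<omega>) (obs (Suc k) \<omega>)) \<in> borel_measurable M" for T k
    by (rule obs_measurable) auto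
  have [measurable]: "Z T n \<in> borel_measurable M" for T n unfolding Z_def[abs_def] by measurable
  have Z_int: "(\<integral>\<^sup>+\<omega>. ennreal (Z T n \<omega>) \<partial>M) \<le> ennreal (\<tau> T)" for T n
  proof -
    have \<tau>: "(\<integral>\<^sup>+u. ennreal (\<psi> T i u) \<partial>P i) \<le> ennreal (\<tau> T)" for i
    proof -
      have "(LINT u|P i. \<psi> T i u) \<le> \<tau> T"
        unfolding \<tau>_def using \<psi>0
        by (intro member_le_sum[of i UNIV "\<lambda>i. LINT u|P i. \<psi> T i u"]) (auto intro: Bochner_Integration.integral_nonneg)
      then show ?thesis
        using \<psi>0 int_\<psi> by (subst nn_integral_eq_integral) (auto intro: ennreal_leI)
    qed
    have "(\<integral>\<^sup>+\<omega>. ennreal (Z T n \<omega>) \<partial>M) =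
        (\<integral>\<^sup>+\<omega>. (\<Sum>k<n. ennreal (1 / real n) * ennreal (\<psi> T (st (Suc k) \<omega>) (obs (Suc k) \<omega>))) \<partial>M)"
      using \<psi>0 by (intro nn_integral_cong) (simp add: Z_def ennreal_mult[symmetric] sum_divide_distrib sum_ennreal)
    also have "\<dots> = (\<Sum>k<n. \<integral>\<^sup>+\<omega>. ennreal (1 / real n) * ennreal (\<psi> T (st (Suc k) \<omega>) (obs (Suc k) \<omega>)) \<partial>M)"
      by (rule nn_integral_sum) measurable
    also have "\<dots> = (\<Sum>k<n. ennreal (1 / real n) * (\<integral>\<^sup>+\<omega>. ennreal (\<psi> T (st (Suc k) \<omega>) (obs (Suc k) \<omega>)) \<partial>M))"
      by (intro sum.cong refl nn_integral_cmult) measurable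
    also have "\<dots> \<le> (\<Sum>k<n. ennreal (1 / real n) * ennreal (\<tau> T))"
      by (intro sum_mono mult_left_mono nn_integral_obs_le \<tau>) auto
    also have "\<dots> \<le> ennreal (\<tau> T)"
    proof (cases "n = 0")
      case False
      have "(\<Sum>k<n. ennreal (1 / real n) * ennreal (\<tau> T)) = ennreal (real n) * ennreal (1 / real n) * ennreal (\<tau> T)"
        by (simp add: mult.assoc ennreal_of_nat_eq_real_of_nat)
      also have "\<dots> = ennreal (\<tau> T)" using False by (simp add: ennreal_mult[symmetric])
      finally show ?thesis by simp
    qed simp
    finally show ?thesis .
  qed
  \<comment> \<open>For a fixed T, Fatou bounds only the expectation of the liminf, by
    \<open>\<tau> T\<close>. As \<open>\<tau>\<close> tends to 0, the infimum over T >= T0 has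
    expectation 0, so almost every path admits some T >= T0, depending on the path, whose liminf is
    small.\<close>
  have "AE \<omega> in M. (INF T\<in>{T0..}. liminf (\<lambda>n. ennreal (Z T n \<omega>))) = 0" for T0
  proof -
    have [measurable]: "(\<lambda>\<omega>. INF T\<in>{T0..}. liminf (\<lambda>n. ennreal (Z T n \<omega>))) \<in> borel_measurable M"
      by measurable
    have "(\<integral>\<^sup>+\<omega>. (INF T\<in>{T0..}. liminf (\<lambda>n. ennreal (Z T n \<omega>))) \<partial>M) \<le> ennreal (\<tau> T)" if "T0 \<le> T" for T
    proof -
      have "(\<integral>\<^sup>+\<omega>. (INF T\<in>{T0..}. liminf (\<lambda>n. ennreal (Z T n \<omega>))) \<partial>M) \<le> (\<integral>\<^sup>+\<omega>. liminf (\<lambda>n. ennreal (Z T n \<omega>)) \<partial>M)"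
        using that by (intro nn_integral_mono INF_lower) auto
      also have "\<dots> \<le> liminf (\<lambda>n. \<integral>\<^sup>+\<omega>. ennreal (Z T n \<omega>) \<partial>M)"
        by (rule nn_integral_liminf) measurable
      also have "\<dots> \<le> ennreal (\<tau> T)"
        by (intro Liminf_le always_eventually allI Z_int) simp
      finally show ?thesis .
    qed
    moreover have "(\<lambda>T. ennreal (\<tau> T)) \<longlonglongrightarrow> ennreal 0" using \<tau>_lim by (rule tendsto_ennrealI)
    ultimately have "(\<integral>\<^sup>+\<omega>. (INF T\<in>{T0..}. liminf (\<lambda>n. ennreal (Z T n \<omega>))) \<partial>M) \<le> ennreal 0"
      by (intro LIMSEQ_le_const) auto
    then show ?thesis by (simp add: nn_integral_0_iff_AE)
  qed
  then have "AE \<omega> in M. \<forall>T0. (INF T\<in>{T0..}. liminf (\<lambda>n. ennreal (Z T n \<omega>))) = 0"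
    by (subst AE_all_countable) blast
  moreover have "AE \<omega> in M. \<forall>T. (\<lambda>n. (\<Sum>k<n. c T (st (Suc k) \<omega>) (obs (Suc k) \<omega>) - m T (st (Suc k) \<omega>)) / real n) \<longlonglongrightarrow> 0"
    unfolding m_def by (subst AE_all_countable) (intro allI AE_mean_noise_tendsto_0[OF _ cK], measurable)
  moreover have "AE \<omega> in M. \<forall>T. (\<lambda>n. (\<Sum>k<n. m T (st (Suc k) \<omega>)) / real n) \<longlonglongrightarrow> (\<Sum>i\<in>UNIV. \<mu> $ i * m T i)"
    by (subst AE_all_countable) (intro allI AE_mean_chain_tendsto[OF slow erg])
  ultimately show ?thesis
  proof eventually_elim
    case (elim \<omega>)
    show ?case
    proof (intro allI impI)
      fix \<delta> :: real assume \<delta>: "\<delta> > 0"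
      let ?D = "\<Sum>i\<in>UNIV. \<mu> $ i * (LINT u|P i. \<zeta> i u)"
      \<comment> \<open>The tolerance is spent in four quarters: on the mean of the truncated part,
        the excess, the noise average and the chain average.\<close>
      have "\<forall>\<^sub>F T in sequentially. (\<Sum>i\<in>UNIV. \<mu> $ i * m T i) < ?D + \<delta> / 4"
        using \<delta> by (intro order_tendstoD(2)[OF sum_lim]) simp
      then obtain T0 where T0: "\<And>T. T \<ge> T0 \<Longrightarrow> (\<Sum>i\<in>UNIV. \<mu> $ i * m T i) < ?D + \<delta> / 4"
        by (auto simp: eventually_sequentially)
      have "(INF T\<in>{T0..}. liminf (\<lambda>n. ennreal (Z T n \<omega>))) < ennreal (\<delta> / 4)"
        using elim(1) \<delta> by simp
      then obtain T where T: "T \<ge> T0" "liminf (\<lambda>n. ennreal (Z T n \<omega>)) < ennreal (\<delta> / 4)"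
        by (auto simp: INF_less_iff)
      have "\<exists>\<^sub>F n in sequentially. Z T n \<omega> < \<delta> / 4"
      proof (rule ccontr)
        assume "\<not> (\<exists>\<^sub>F n in sequentially. Z T n \<omega> < \<delta> / 4)"
        then have "\<forall>\<^sub>F n in sequentially. ennreal (\<delta> / 4) \<le> ennreal (Z T n \<omega>)"
          unfolding not_frequently by eventually_elim (auto intro: ennreal_leI)
        then have "ennreal (\<delta> / 4) \<le> liminf (\<lambda>n. ennreal (Z T n \<omega>))" by (rule Liminf_bounded)
        with T show False by simp
      qed
      moreover have "\<forall>\<^sub>F n in sequentially. (\<Sum>k<n. c T (st (Suc k) \<omega>) (obs (Suc k) \<omega>) - m T (st (Suc k) \<omega>)) / real n < \<delta> / 4"
        using elim(2) \<delta> by (intro order_tendstoD(2)) auto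
      moreover have "\<forall>\<^sub>F n in sequentially. (\<Sum>k<n. m T (st (Suc k) \<omega>)) / real n < (\<Sum>i\<in>UNIV. \<mu> $ i * m T i) + \<delta> / 4"
        using elim(3) \<delta> by (intro order_tendstoD(2)) auto
      ultimately show "\<exists>\<^sub>F n in sequentially.
        (\<Sum>k<n. \<zeta> (st (Suc k) \<omega>) (obs (Suc k) \<omega>)) \<le> (?D + \<delta>) * real n"
      proof (rule frequently_elim1[OF frequently_eventually_frequently[OF _ eventually_conj[OF _ eventually_conj[OF _ eventually_gt_at_top[of 0]]]]])
        fix n
        let ?n = "real n"
        assume A: "Z T n \<omega> < \<delta> / 4 \<and> (\<Sum>k<n. c T (st (Suc k) \<omega>) (obs (Suc k) \<omega>) - m T (st (Suc k) \<omega>)) / ?n < \<delta> / 4 \<and>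
          (\<Sum>k<n. m T (st (Suc k) \<omega>)) / ?n < (\<Sum>i\<in>UNIV. \<mu> $ i * m T i) + \<delta> / 4 \<and> 0 < n"
        have "(\<Sum>k<n. \<zeta> (st (Suc k) \<omega>) (obs (Suc k) \<omega>)) \<le>
            (\<Sum>k<n. c T (st (Suc k) \<omega>) (obs (Suc k) \<omega>) + \<psi> T (st (Suc k) \<omega>) (obs (Suc k) \<omega>))"
          by (intro sum_mono \<zeta>_le)
        also have "\<dots> = ((\<Sum>k<n. c T (st (Suc k) \<omega>) (obs (Suc k) \<omega>) - m T (st (Suc k) \<omega>)) / ?n +
             (\<Sum>k<n. m T (st (Suc k) \<omega>)) / ?n + Z T n \<omega>) * ?n"
          using A by (simp add: Z_def sum.distrib sum_subtractf add_divide_distrib[symmetric])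
        also have "\<dots> \<le> (?D + \<delta>) * ?n"
          using A T0[OF T(1)] \<delta> by (intro mult_right_mono) linarith+
        finally show "(\<Sum>k<n. \<zeta> (st (Suc k) \<omega>) (obs (Suc k) \<omega>)) \<le> (?D + \<delta>) * ?n" .
      qed
    qed
  qed
qed

end

section \<open>Moments of likelihood ratios\<close>

text \<open>A domination of the difference quotients uniform in \<theta>. For w < 0 the tangent at 0
  gives |w|. For w >= 0 the quotient is at most w exp(\<theta> w), and w <= 4 exp(w/4) together with
  \<theta> <= 1/4 brings the exponent to w/2; for a sum w of two log-ratios this is the square root
  of the product of the ratios, which is integrable.\<close>

lemma exp_scaled_bound:
  fixes w \<theta> :: real
  assumes "0 < \<theta>" "\<theta> \<le> 1 / 4"
  shows "\<bar>(exp (\<theta> * w) - 1) / \<theta>\<bar> \<le> \<bar>w\<bar> + 4 * exp (w / 2)"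
proof (cases "w \<ge> 0")
  case True
  have "exp (\<theta> * w) - 1 \<le> \<theta> * w * exp (\<theta> * w)"
  proof -
    have "1 - \<theta> * w \<le> exp (- (\<theta> * w))" using exp_ge_add_one_self[of "- (\<theta> * w)"] by simp
    then have "exp (\<theta> * w) * (1 - \<theta> * w) \<le> exp (\<theta> * w) * exp (- (\<theta> * w))" by (rule mult_left_mono) simp
    then show ?thesis by (simp add: exp_minus algebra_simps)
  qed
  then have "(exp (\<theta> * w) - 1) / \<theta> \<le> w * exp (\<theta> * w)"
    using assms by (simp add: field_simps)
  also have "\<dots> \<le> (4 * exp (w / 4)) * exp (w / 4)"
  proof (rule mult_mono)
    show "w \<le> 4 * exp (w / 4)" using exp_ge_add_one_self[of "w / 4"] by linarith
    show "exp (\<theta> * w) \<le> exp (w / 4)" using mult_right_mono[OF assms(2) True] by simp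
  qed auto
  also have "\<dots> = 4 * exp (w / 2)" by (simp add: exp_add[symmetric])
  finally have "(exp (\<theta> * w) - 1) / \<theta> \<le> 4 * exp (w / 2)" .
  moreover have "0 \<le> (exp (\<theta> * w) - 1) / \<theta>" using True assms by simp
  ultimately show ?thesis using True by simp
next
  case False
  have "exp (\<theta> * w) - 1 \<le> 0" using False assms by (simp add: mult_nonneg_nonpos)
  moreover have "\<theta> * w \<le> exp (\<theta> * w) - 1" using exp_ge_add_one_self[of "\<theta> * w"] by linarith
  ultimately have "\<bar>(exp (\<theta> * w) - 1) / \<theta>\<bar> \<le> - w"
    using assms by (simp add: field_simps abs_le_iff)
  then show ?thesis using False exp_ge_zero[of "w / 2"] by linarith
qed

text \<open>The derivative of exp(w h) at h = 0, along a sequence whose shift by 4 keeps it inside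
  the range of the preceding bound.\<close>

lemma exp_scaled_tendsto:
  fixes w :: real
  shows "(\<lambda>n. (exp (1 / (real n + 4) * w) - 1) / (1 / (real n + 4))) \<longlonglongrightarrow> w"
proof -
  have "((\<lambda>h. (exp (w * h) - 1) / h) \<longlongrightarrow> w) (at 0)"
  proof -
    have "((\<lambda>h. exp (w * h)) has_real_derivative w) (at 0)"
      by (auto intro!: derivative_eq_intros)
    then show ?thesis by (simp add: DERIV_def)
  qed
  moreover have "filterlim (\<lambda>n. 1 / (real n + 4)) (at 0) sequentially"
    by real_asymp
  ultimately show ?thesis
    by (rule filterlim_compose[where g="\<lambda>h. (exp (w * h) - 1) / h", THEN filterlim_mono_eventually])
      (auto simp: mult.commute intro!: always_eventually)
qed

locale comparable_hidden_chain = hidden_chain M a \<nu> L X \<phi> g \<xi>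
  for M :: "'w measure" and a :: "'d::finite \<Rightarrow> real" and \<nu> :: "real ^ 'd" and L :: "real ^ 'd ^ 'd"
    and X :: "nat \<Rightarrow> 'w \<Rightarrow> real" and \<phi> :: "real measure" and g :: "'d \<Rightarrow> real \<Rightarrow> real"
    and \<xi> :: "nat \<Rightarrow> 'd \<Rightarrow> 'w \<Rightarrow> real" +
  assumes same_support: "\<And>i j. AE u in \<phi>. g i u > 0 \<longleftrightarrow> g j u > 0"
    and bounded_g: "\<And>i. bounded (range (g i))"
    and log_integral: "\<And>i j. log_integral_finite \<phi> (g i) (g j)"
begin

lemma space_\<phi>: "space \<phi> = UNIV"
  using sets_eq_imp_space_eq[OF sets_\<phi>] by simp

lemma AE_P_pos: "AE u in P i. \<forall>k. g k u > 0"
proof -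
  have "AE u in \<phi>. \<forall>k. g i u > 0 \<longleftrightarrow> g k u > 0"
    unfolding AE_all_countable by (intro allI same_support)
  then show ?thesis
    by (subst AE_density) (auto elim!: eventually_mono)
qed

lemma nn_integral_P: "f \<in> borel_measurable borel \<Longrightarrow> (\<integral>\<^sup>+u. f u \<partial>P i) = (\<integral>\<^sup>+u. ennreal (g i u) * f u \<partial>\<phi>)"
  by (subst nn_integral_density) auto

text \<open>The density of the true state cancels against the sampling density. The pointwise
  estimate is an inequality because division by 0 gives 0.\<close>

lemma nn_integral_ratio_le: "(\<integral>\<^sup>+u. ennreal (ratio g i k u) \<partial>P i) \<le> 1"
proof -
  have "(\<integral>\<^sup>+u. ennreal (ratio g i k u) \<partial>P i) = (\<integral>\<^sup>+u. ennreal (g i u) * ennreal (ratio g i k u) \<partial>\<phi>)"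
    by (rule nn_integral_P) measurable
  also have "\<dots> \<le> (\<integral>\<^sup>+u. ennreal (g k u) * indicator (space \<phi>) u \<partial>\<phi>)"
    using g_nonneg by (intro nn_integral_mono) (simp add: ennreal_mult[symmetric])
  also have "\<dots> = emeasure (P k) (space (P k))"
    by (subst emeasure_density) (auto simp: space_\<phi>)
  also have "\<dots> = 1" by (rule prob_space.emeasure_space_1[OF prob_space_P])
  finally show ?thesis .
qed

lemma integrable_ratio: "integrable (P i) (ratio g i k)"
proof (rule integrableI_bounded)
  have "(\<integral>\<^sup>+u. ennreal (norm (ratio g i k u)) \<partial>P i) = (\<integral>\<^sup>+u. ennreal (ratio g i k u) \<partial>P i)"
    using g_nonneg by (intro nn_integral_cong) simp
  also have "\<dots> < \<infinity>" using nn_integral_ratio_le by (rule le_less_trans) simp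
  finally show "(\<integral>\<^sup>+u. ennreal (norm (ratio g i k u)) \<partial>P i) < \<infinity>" .
qed simp

lemma integral_ratio_le: "(LINT u|P i. ratio g i k u) \<le> 1"
proof -
  have "ennreal (LINT u|P i. ratio g i k u) = (\<integral>\<^sup>+u. ennreal (ratio g i k u) \<partial>P i)"
    using g_nonneg by (intro nn_integral_eq_integral[symmetric] integrable_ratio) auto
  also have "\<dots> \<le> ennreal 1" using nn_integral_ratio_le by simp
  finally show ?thesis by (simp add: ennreal_le_iff)
qed

text \<open>Boundedness of \<open>g k\<close> controls the positive part of the logarithm,
  \<open>log_integral\<close> the negative part.\<close>

lemma integrable_ln_g: "integrable (P i) (\<lambda>u. ln (g k u))"
proof -
  obtain B where B: "\<And>u. \<bar>g k u\<bar> \<le> B" using bounded_g[of k] by (auto simp: bounded_iff)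
  define C where "C = ln (max 1 B)"
  have C: "0 \<le> C" "ln (g k u) \<le> C" for u
  proof -
    show "0 \<le> C" by (simp add: C_def)
    show "ln (g k u) \<le> C"
    proof (cases "g k u = 0")
      case False
      then have "g k u > 0" using g_nonneg[of k u] by simp
      then show ?thesis using B[of u] unfolding C_def by (subst ln_le_cancel_iff) auto
    qed (simp add: \<open>0 \<le> C\<close>)
  qed
  have "(\<integral>\<^sup>+u. ennreal (norm (g i u * ln (g k u))) \<partial>\<phi>) \<le>
      (\<integral>\<^sup>+u. ennreal C * ennreal (g i u) + ennreal (- (g i u * ln (g k u))) \<partial>\<phi>)"
  proof (rule nn_integral_mono)
    fix u
    have "ennreal C * ennreal (g i u) = ennreal (g i u * C)" using C g_nonneg by (simp add: ennreal_mult mult.commute)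
    moreover have "g i u * ln (g k u) \<le> g i u * C" using C g_nonneg by (intro mult_left_mono) auto
    then have "ennreal (norm (g i u * ln (g k u))) \<le> ennreal (g i u * C) + ennreal (- (g i u * ln (g k u)))"
      using C(1) g_nonneg[of i u]
      by (cases "g i u * ln (g k u) \<ge> 0") (auto simp: ennreal_neg intro!: ennreal_leI add_increasing)
    ultimately show "ennreal (norm (g i u * ln (g k u))) \<le> ennreal C * ennreal (g i u) + ennreal (- (g i u * ln (g k u)))"
      by simp
  qed
  also have "\<dots> = ennreal C * (\<integral>\<^sup>+u. ennreal (g i u) \<partial>\<phi>) + (\<integral>\<^sup>+u. ennreal (- (g i u * ln (g k u))) \<partial>\<phi>)"
    by (simp add: nn_integral_add nn_integral_cmult)
  also have "(\<integral>\<^sup>+u. ennreal (g i u) \<partial>\<phi>) = 1"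
    using prob_space.emeasure_space_1[OF prob_space_P[of i]]
    by (subst (asm) emeasure_density) (auto simp: space_\<phi>)
  also have "ennreal C * 1 + (\<integral>\<^sup>+u. ennreal (- (g i u * ln (g k u))) \<partial>\<phi>) < \<infinity>"
    using log_integral[of i k] by (simp add: log_integral_finite_def ennreal_add_less_top)
  finally have "integrable \<phi> (\<lambda>u. g i u * ln (g k u))"
    by (intro integrableI_bounded) auto
  then show ?thesis
    using g_nonneg by (subst integrable_density) auto
qed

definition log_ratio :: "'d \<Rightarrow> 'd \<Rightarrow> real \<Rightarrow> real" where
  "log_ratio i k u = ln (ratio g i k u)"

lemma log_ratio_measurable[measurable]: "log_ratio i k \<in> borel_measurable borel"
  unfolding log_ratio_def[abs_def] by measurable

lemma integrable_log_ratio: "integrable (P i) (log_ratio i k)"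
proof -
  have "integrable (P i) (\<lambda>u. ln (g k u) - ln (g i u))"
    by (intro Bochner_Integration.integrable_diff integrable_ln_g)
  then show ?thesis
  proof (rule integrable_cong_AE_imp)
    show "AE u in P i. ln (g k u) - ln (g i u) = log_ratio i k u"
      using AE_P_pos[of i]
    proof eventually_elim
      case (elim u)
      then have "0 < g k u" "0 < g i u" by auto
      then show ?case by (simp add: log_ratio_def ln_div)
    qed
  qed simp
qed

lemma integral_log_ratio: "(LINT u|P i. log_ratio i k u) = - kl_div \<phi> (g i) (g k)"
proof -
  have "(LINT u|P i. log_ratio i k u) = (LINT u|P i. - ln (g i u / g k u))"
  proof (rule integral_cong_AE)
    show "AE u in P i. log_ratio i k u = - ln (g i u / g k u)"
      using AE_P_pos[of i]
    proof eventually_elim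
      case (elim u)
      then have "0 < g k u" "0 < g i u" by auto
      then show ?case by (simp add: log_ratio_def ln_div)
    qed
  qed auto
  also have "\<dots> = - kl_div \<phi> (g i) (g k)"
    using g_nonneg by (simp add: kl_div_def integral_density)
  finally show ?thesis .
qed

text \<open>Integrate ln x <= x - 1 at the ratio of the densities, whose mean is at most 1.\<close>

lemma kl_div_nonneg: "0 \<le> kl_div \<phi> (g i) (g k)"
proof -
  interpret P: prob_space "P i" by (rule prob_space_P)
  have "(LINT u|P i. log_ratio i k u) \<le> (LINT u|P i. ratio g i k u - 1)"
  proof (rule integral_mono_AE)
    show "AE u in P i. log_ratio i k u \<le> ratio g i k u - 1"
      using AE_P_pos[of i] by eventually_elim (simp add: log_ratio_def ln_le_minus_one)
  qed (auto intro!: integrable_log_ratio Bochner_Integration.integrable_diff integrable_ratio)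
  also have "\<dots> = (LINT u|P i. ratio g i k u) - 1"
    using P.prob_space by (subst Bochner_Integration.integral_diff) (auto intro: integrable_ratio)
  also have "\<dots> \<le> 0" using integral_ratio_le by simp
  finally show ?thesis by (simp add: integral_log_ratio)
qed

section \<open>Moments of products of two ratios and their slope at exponent 0\<close>

definition pair_moment :: "real \<Rightarrow> 'd \<Rightarrow> 'd \<Rightarrow> 'd \<Rightarrow> real" where
  "pair_moment \<theta> i k l = (LINT u|P i. (ratio g i k u * ratio g i l u) powr \<theta>)"

text \<open>Up to exponent 1/2 a power is at most 1 plus the square root, and the geometric mean is
  below the arithmetic mean, which is integrable. This is the origin of the restriction \<theta> <=
  1/2.\<close>

lemma ratio_pair_powr_le:
  assumes "0 < \<theta>" "\<theta> \<le> 1 / 2"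
  shows "(ratio g i k u * ratio g i l u) powr \<theta> \<le> 1 + (ratio g i k u + ratio g i l u) / 2"
proof -
  define x y where "x = ratio g i k u" and "y = ratio g i l u"
  have xy: "0 \<le> x" "0 \<le> y" using g_nonneg by (auto simp: x_def y_def)
  have "sqrt (x * y) \<le> (x + y) / 2" using xy by (rule arith_geo_mean_sqrt)
  moreover have "(x * y) powr \<theta> \<le> 1 + sqrt (x * y)"
  proof (cases "x * y \<le> 1")
    case True
    then have "(x * y) powr \<theta> \<le> 1 powr \<theta>" using xy assms by (intro powr_mono2) auto
    then show ?thesis using xy by (simp add: add_increasing2)
  next
    case False
    then have "(x * y) powr \<theta> \<le> (x * y) powr (1 / 2)" using assms by (intro powr_mono) auto
    then show ?thesis using xy by (simp add: powr_half_sqrt)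
  qed
  ultimately show ?thesis unfolding x_def y_def by linarith
qed

lemma integrable_ratio_pair_powr:
  assumes "0 < \<theta>" "\<theta> \<le> 1 / 2"
  shows "integrable (P i) (\<lambda>u. (ratio g i k u * ratio g i l u) powr \<theta>)"
proof (rule Bochner_Integration.integrable_bound)
  interpret P: prob_space "P i" by (rule prob_space_P)
  show "integrable (P i) (\<lambda>u. 1 + (ratio g i k u + ratio g i l u) / 2)"
    by (intro Bochner_Integration.integrable_add integrable_divide integrable_ratio) simp
  show "AE u in P i. norm ((ratio g i k u * ratio g i l u) powr \<theta>) \<le> norm (1 + (ratio g i k u + ratio g i l u) / 2)"
    by (intro AE_I2) (use ratio_pair_powr_le[OF assms] in \<open>auto intro: order_trans[OF _ abs_ge_self]\<close>)
qed simp

lemma pair_moment_le: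
  assumes "0 < \<theta>" "\<theta> \<le> 1 / 2"
  shows "pair_moment \<theta> i k l \<le> 2"
proof -
  interpret P: prob_space "P i" by (rule prob_space_P)
  note int = integrable_ratio[of i k] integrable_ratio[of i l]
  have "pair_moment \<theta> i k l \<le> (LINT u|P i. 1 + (ratio g i k u + ratio g i l u) / 2)"
    unfolding pair_moment_def
    by (intro integral_mono integrable_ratio_pair_powr assms ratio_pair_powr_le
        Bochner_Integration.integrable_add integrable_divide int) simp
  also have "\<dots> = 1 + ((LINT u|P i. ratio g i k u) + (LINT u|P i. ratio g i l u)) / 2"
    using int P.prob_space by simp
  also have "\<dots> \<le> 2" using integral_ratio_le[of i k] integral_ratio_le[of i l] by simp
  finally show ?thesis .
qed

lemma nn_integral_ratio_pair_powr:
  assumes "0 < \<theta>" "\<theta> \<le> 1 / 2"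
  shows "(\<integral>\<^sup>+u. ennreal ((ratio g i k u * ratio g i l u) powr \<theta>) \<partial>P i) = ennreal (pair_moment \<theta> i k l)"
  unfolding pair_moment_def by (intro nn_integral_eq_integral integrable_ratio_pair_powr assms) simp

text \<open>The moment is the mean of exp(\<theta> w) with w the sum of two log-ratios, so its
  derivative at \<theta> = 0 is the mean of w.\<close>

lemma pair_moment_tendsto:
  "(\<lambda>n. (pair_moment (1 / (real n + 4)) i k l - 1) / (1 / (real n + 4))) \<longlonglongrightarrow>
     - kl_div \<phi> (g i) (g k) - kl_div \<phi> (g i) (g l)"
proof -
  interpret P: prob_space "P i" by (rule prob_space_P)
  define w where "w u = log_ratio i k u + log_ratio i l u" for u
  have [measurable]: "w \<in> borel_measurable borel" unfolding w_def[abs_def] by measurable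
  have exp_w: "AE u in P i. exp (t * w u) = (ratio g i k u * ratio g i l u) powr t" for t
    using AE_P_pos[of i]
  proof eventually_elim
    case (elim u)
    then have pos: "ratio g i k u > 0" "ratio g i l u > 0" by simp_all
    then have "w u = ln (ratio g i k u * ratio g i l u)"
      unfolding w_def log_ratio_def by (rule ln_mult_pos[symmetric])
    with mult_pos_pos[OF pos] show ?case unfolding powr_def by (simp del: times_divide_times_eq) (use elim in \<open>metis less_irrefl\<close>)
  qed
  have int_w: "integrable (P i) w"
    unfolding w_def[abs_def] by (intro Bochner_Integration.integrable_add integrable_log_ratio)
  have int_exp: "integrable (P i) (\<lambda>u. exp (t * w u))" if "0 < t" "t \<le> 1 / 2" for t
    using integrable_ratio_pair_powr[OF that, of i k l]
    by (rule integrable_cong_AE_imp) (use exp_w[of t] in auto)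
  have eq: "(LINT u|P i. (exp (t * w u) - 1) / t) = (pair_moment t i k l - 1) / t" if "0 < t" "t \<le> 1 / 2" for t
  proof -
    have "(LINT u|P i. exp (t * w u)) = pair_moment t i k l"
      unfolding pair_moment_def by (rule integral_cong_AE) (use exp_w[of t] in auto)
    then show ?thesis using int_exp[OF that] P.prob_space by simp
  qed
  have "(\<lambda>n. LINT u|P i. (exp (1 / (real n + 4) * w u) - 1) / (1 / (real n + 4))) \<longlonglongrightarrow> (LINT u|P i. w u)"
  proof (rule integral_dominated_convergence[where w="\<lambda>u. \<bar>w u\<bar> + 4 * exp (1 / 2 * w u)"])
    show "integrable (P i) (\<lambda>u. \<bar>w u\<bar> + 4 * exp (1 / 2 * w u))"
      by (intro Bochner_Integration.integrable_add integrable_abs int_w integrable_mult_right int_exp) auto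
    show "AE u in P i. (\<lambda>n. (exp (1 / (real n + 4) * w u) - 1) / (1 / (real n + 4))) \<longlonglongrightarrow> w u"
      by (intro AE_I2 exp_scaled_tendsto)
    show "AE u in P i. norm ((exp (1 / (real n + 4) * w u) - 1) / (1 / (real n + 4))) \<le> \<bar>w u\<bar> + 4 * exp (1 / 2 * w u)" for n
      using exp_scaled_bound[of "1 / (real n + 4)"] by (intro AE_I2) auto
  qed measurable
  moreover have "(LINT u|P i. w u) = - kl_div \<phi> (g i) (g k) - kl_div \<phi> (g i) (g l)"
    unfolding w_def by (simp add: integrable_log_ratio integral_log_ratio)
  moreover have "(LINT u|P i. (exp (1 / (real n + 4) * w u) - 1) / (1 / (real n + 4))) =
      (pair_moment (1 / (real n + 4)) i k l - 1) / (1 / (real n + 4))" for n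
    by (rule eq) auto
  ultimately show ?thesis by simp
qed

text \<open>An observation is drawn from the density of the current state, and all densities share
  its support; hence almost surely no likelihood ratio is zero or has denominator zero.\<close>

lemma AE_obs_pos: "AE \<omega> in M. \<forall>n k. g k (obs (Suc n) \<omega>) > 0"
proof -
  have "AE \<omega> in M. \<forall>k. g k (obs (Suc n) \<omega>) > 0" for n
  proof -
    define f where "f i u = (if \<forall>k. g k u > 0 then 0 else 1 :: real)" for i :: 'd and u
    have f[measurable]: "f i \<in> borel_measurable borel" for i
      unfolding f_def[abs_def] by measurable
    have "(\<integral>\<^sup>+u. ennreal (f i u) \<partial>P i) = 0" for i
      using AE_P_pos[of i] by (subst nn_integral_0_iff_AE) (auto simp: f_def)
    then have "(\<integral>\<^sup>+\<omega>. ennreal (f (st (Suc n) \<omega>) (obs (Suc n) \<omega>)) \<partial>M) \<le> 0"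
      by (intro nn_integral_obs_le) auto
    moreover have [measurable]: "(\<lambda>\<omega>. f (st (Suc n) \<omega>) (obs (Suc n) \<omega>)) \<in> borel_measurable M"
      by (rule obs_measurable) auto
    ultimately have "AE \<omega> in M. ennreal (f (st (Suc n) \<omega>) (obs (Suc n) \<omega>)) = 0"
      by (simp add: nn_integral_0_iff_AE)
    then show ?thesis by eventually_elim (auto simp: f_def split: if_splits)
  qed
  then show ?thesis by (subst AE_all_countable) blast
qed

end


section \<open>Bounds on the stability index at a fixed switching rate\<close>

lemma eventually_le_exp:
  assumes "\<delta> > 0"
  shows "\<forall>\<^sub>F n in sequentially. C \<le> exp (\<delta> * real n)"
proof -
  have "filterlim (\<lambda>n. exp (\<delta> * real n)) at_top sequentially"
    using assms by real_asymp
  then show ?thesis by (simp add: filterlim_at_top)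
qed

lemma has_stability_index_le:
  assumes ind: "has_stability_index p q \<gamma>"
    and le: "\<And>\<delta>. \<delta> > 0 \<Longrightarrow> \<forall>\<^sub>F n in sequentially. l1_norm (p n - q n) \<le> exp ((B + \<delta>) * real n)"
  shows "\<gamma> \<le> ereal B"
proof (rule ereal_le_epsilon2)
  fix \<delta> :: real assume "\<delta> > 0"
  have lim: "(\<lambda>n. ereal (1 / real n) * ext_log (l1_norm (p n - q n))) \<longlonglongrightarrow> \<gamma>"
    using ind by (simp add: has_stability_index_def)
  have "\<forall>\<^sub>F n in sequentially. ereal (1 / real n) * ext_log (l1_norm (p n - q n)) \<le> ereal (B + \<delta>)"
    using le[OF \<open>\<delta> > 0\<close>] eventually_gt_at_top[of 0]
  proof eventually_elim
    case (elim n)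
    have nn: "0 \<le> l1_norm (p n - q n)" by (simp add: l1_norm_def sum_nonneg)
    show ?case
    proof (cases "l1_norm (p n - q n) = 0")
      case True
      then show ?thesis using elim by (simp add: ext_log_def)
    next
      case False
      then have "ln (l1_norm (p n - q n)) \<le> (B + \<delta>) * real n"
        using elim nn ln_le_cancel_iff[of "l1_norm (p n - q n)" "exp ((B + \<delta>) * real n)"] by simp
      then show ?thesis using False elim by (simp add: ext_log_def divide_le_eq)
    qed
  qed
  then have "\<gamma> \<le> ereal (B + \<delta>)" by (rule tendsto_upperbound[OF lim]) simp
  then show "\<gamma> \<le> ereal B + ereal \<delta>" by simp
qed

text \<open>A limit cannot lie below a level that is reached at infinitely many times; hence
  \<open>frequently\<close>, which is what merely integrable log-ratios provide.\<close>

lemma has_stability_index_ge: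
  assumes ind: "has_stability_index p q \<gamma>"
    and ge: "\<And>\<delta>. \<delta> > 0 \<Longrightarrow> \<exists>\<^sub>F n in sequentially. exp ((B - \<delta>) * real n) \<le> l1_norm (p n - q n)"
  shows "ereal B \<le> \<gamma>"
proof (rule ereal_le_epsilon2)
  fix \<delta> :: real assume "\<delta> > 0"
  have lim: "(\<lambda>n. ereal (1 / real n) * ext_log (l1_norm (p n - q n))) \<longlonglongrightarrow> \<gamma>"
    using ind by (simp add: has_stability_index_def)
  have "ereal (B - \<delta>) \<le> \<gamma>"
  proof (rule ccontr)
    assume "\<not> ereal (B - \<delta>) \<le> \<gamma>"
    then have "\<forall>\<^sub>F n in sequentially. ereal (1 / real n) * ext_log (l1_norm (p n - q n)) < ereal (B - \<delta>)"
      by (intro order_tendstoD[OF lim]) simp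
    with ge[OF \<open>\<delta> > 0\<close>] have "\<exists>\<^sub>F n in sequentially. exp ((B - \<delta>) * real n) \<le> l1_norm (p n - q n) \<and>
        (ereal (1 / real n) * ext_log (l1_norm (p n - q n)) < ereal (B - \<delta>) \<and> 0 < n)"
      by (intro frequently_eventually_frequently eventually_conj eventually_gt_at_top)
    then obtain n where n: "exp ((B - \<delta>) * real n) \<le> l1_norm (p n - q n)"
      "ereal (1 / real n) * ext_log (l1_norm (p n - q n)) < ereal (B - \<delta>)" "0 < n"
      by (auto dest: frequently_ex)
    have pos: "l1_norm (p n - q n) > 0" using n(1) exp_gt_zero by (rule less_le_trans[rotated])
    then have "ln (exp ((B - \<delta>) * real n)) \<le> ln (l1_norm (p n - q n))"
      using n(1) by (subst ln_le_cancel_iff) auto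
    then have "B - \<delta> \<le> ln (l1_norm (p n - q n)) / real n" using n by (simp add: le_divide_eq)
    then show False using n pos by (simp add: ext_log_def)
  qed
  then show "ereal B \<le> \<gamma> + ereal \<delta>" by (cases \<gamma>) auto
qed

section \<open>Growth of the masses and of the minors\<close>

context comparable_hidden_chain
begin

abbreviation rfilter :: "real ^ 'd \<Rightarrow> 'w \<Rightarrow> nat \<Rightarrow> 'd \<Rightarrow> real" where
  "rfilter p \<omega> \<equiv> ratio_filter g L (\<lambda>k. st k \<omega>) (\<lambda>k. obs k \<omega>) p"

definition mass :: "real ^ 'd \<Rightarrow> 'w \<Rightarrow> nat \<Rightarrow> real" where
  "mass p \<omega> n = (\<Sum>l\<in>UNIV. rfilter p \<omega> n l)"

abbreviation rminor :: "real ^ 'd \<Rightarrow> real ^ 'd \<Rightarrow> 'w \<Rightarrow> nat \<Rightarrow> 'd \<Rightarrow> 'd \<Rightarrow> real" where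
  "rminor p q \<omega> \<equiv> minor g L (\<lambda>k. st k \<omega>) (\<lambda>k. obs k \<omega>) p q"

text \<open>An averaged step does not increase the mass: the ratios have mean at most 1 and the rows
  of \<open>L\<close> sum to 1.\<close>

lemma AE_mass_le:
  assumes p: "prob_vec p"
  shows "AE \<omega> in M. \<forall>\<delta>>0. \<forall>\<^sub>F n in sequentially. mass p \<omega> n \<le> exp (\<delta> * real n)"
proof -
  have "AE \<omega> in M. \<forall>\<delta>>0. \<forall>\<^sub>F n in sequentially.
    (\<Sum>x\<in>UNIV. lin_rec (ratio g) (\<lambda>i j. L $ i $ j) (\<lambda>k. st k \<omega>) (\<lambda>k. obs k \<omega>) (\<lambda>i. p $ i) n x) \<le>
      exp (\<delta> * real n) * (\<Prod>k<n. (\<lambda>_. 1) (st (Suc k) \<omega>))"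
  proof (rule AE_sum_lin_rec_le)
    fix i z
    have "(\<Sum>x\<in>UNIV. ennreal (L $ z $ x) * (\<integral>\<^sup>+u. ennreal (ratio g i x u) \<partial>P i)) \<le> (\<Sum>x\<in>UNIV. ennreal (L $ z $ x) * 1)"
      by (intro sum_mono mult_left_mono nn_integral_ratio_le) auto
    also have "\<dots> = ennreal 1" using L_nonneg by (simp add: sum_ennreal L_sum)
    finally show "(\<Sum>x\<in>UNIV. ennreal (L $ z $ x) * (\<integral>\<^sup>+u. ennreal (ratio g i x u) \<partial>P i)) \<le> ennreal 1" .
  qed (use p g_nonneg L_nonneg in \<open>auto simp: prob_vec_def\<close>)
  then show ?thesis by (simp add: mass_def ratio_filter_def)
qed

context
  fixes \<Lambda> :: "real ^ 'd ^ 'd" and \<mu> :: "real ^ 'd" and \<epsilon> :: real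
  assumes slow: "L = slow \<Lambda> \<epsilon>" and \<epsilon>: "0 < \<epsilon>" "\<epsilon> < 1" and \<Lambda>: "stochastic \<Lambda>"
    and erg: "ergodic_with_limits \<Lambda> \<mu>"
begin

lemma \<Lambda>_nonneg: "0 \<le> \<Lambda> $ i $ j" and \<Lambda>_le_1: "\<Lambda> $ i $ j \<le> 1"
proof -
  have nn: "0 \<le> \<Lambda> $ i $ j" for i j using \<Lambda> by (auto simp: stochastic_def prob_vec_def)
  show "0 \<le> \<Lambda> $ i $ j" by (rule nn)
  have "\<Lambda> $ i $ j \<le> (\<Sum>j\<in>UNIV. \<Lambda> $ i $ j)" by (rule member_le_sum) (auto simp: nn)
  then show "\<Lambda> $ i $ j \<le> 1" using \<Lambda> by (simp add: stochastic_def prob_vec_def)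
qed

lemma L_eq: "L $ i $ j = (if i = j then 1 - \<epsilon> else 0) + \<epsilon> * \<Lambda> $ i $ j"
  unfolding slow by (rule slow_eq[OF \<Lambda>])

lemma L_diag: "L $ i $ i > 0"
  using \<epsilon> \<Lambda>_nonneg[of i i] by (simp add: L_eq add_pos_nonneg)

lemma L_pos: "\<Lambda> $ i $ j > 0 \<Longrightarrow> L $ i $ j > 0"
  using \<epsilon> by (simp add: L_eq add_nonneg_pos)

lemma L_le_1: "L $ i $ j \<le> 1"
proof -
  have "L $ i $ j \<le> (\<Sum>j\<in>UNIV. L $ i $ j)" by (rule member_le_sum) (auto simp: L_nonneg)
  then show ?thesis by (simp add: L_sum)
qed

lemma L_off_diag: "i \<noteq> j \<Longrightarrow> L $ i $ j \<le> \<epsilon>"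
  using \<epsilon> mult_left_mono[OF \<Lambda>_le_1[of i j], of \<epsilon>] by (simp add: L_eq)

text \<open>The vector \<open>p\<close> may miss the true initial state. At some time m the law of
  the fast chain started from \<open>p\<close> is positive everywhere, so the filter charges the
  true state at time m and follows the true path from there. The transition probabilities before m
  are at most 1.\<close>

lemma mass_ge_path:
  assumes p: "prob_vec p" and gpos: "\<And>n k. g k (obs (Suc n) \<omega>) > 0"
  shows "\<exists>c>0. \<forall>\<^sub>F n in sequentially. c * (\<Prod>k<n. L $ st k \<omega> $ st (Suc k) \<omega>) \<le> mass p \<omega> n"
proof -
  have "\<forall>\<^sub>F n in sequentially. \<forall>k. law_at \<Lambda> p n $ k > 0"
    using erg p by (intro eventually_all_finite order_tendstoD(1)) (auto simp: ergodic_with_limits_def)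
  then obtain m where m: "\<And>k. law_at \<Lambda> p m $ k > 0" by (auto simp: eventually_sequentially)
  define c where "c = rfilter p \<omega> m (st m \<omega>)"
  have c: "c > 0"
    unfolding c_def by (rule ratio_filter_pos[where g=g and y="\<lambda>k. obs k \<omega>" and L=L and \<Lambda>=\<Lambda>, OF gpos L_nonneg p L_pos \<Lambda>_nonneg m])
  have "c * (\<Prod>k<n. L $ st k \<omega> $ st (Suc k) \<omega>) \<le> mass p \<omega> n" if "m \<le> n" for n
  proof -
    have "(\<Prod>k<n. L $ st k \<omega> $ st (Suc k) \<omega>) =
       (\<Prod>k<m. L $ st k \<omega> $ st (Suc k) \<omega>) * (\<Prod>k=m..<n. L $ st k \<omega> $ st (Suc k) \<omega>)"
      using that by (simp add: lessThan_atLeast0 prod.atLeastLessThan_concat)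
    also have "\<dots> \<le> 1 * (\<Prod>k=m..<n. L $ st k \<omega> $ st (Suc k) \<omega>)"
      by (intro mult_right_mono prod_le_1 prod_nonneg) (auto simp: L_nonneg L_le_1)
    finally have "c * (\<Prod>k<n. L $ st k \<omega> $ st (Suc k) \<omega>) \<le> c * (\<Prod>k=m..<n. L $ st k \<omega> $ st (Suc k) \<omega>)"
      using c by simp
    also have "\<dots> \<le> rfilter p \<omega> n (st n \<omega>)"
      unfolding c_def using that ratio_filter_path_ge[where g=g and y="\<lambda>k. obs k \<omega>" and L=L, OF gpos L_nonneg p, of "\<lambda>k. st k \<omega>" m "n - m"] by simp
    also have "\<dots> \<le> mass p \<omega> n"
      unfolding mass_def by (rule member_le_sum) (auto intro: ratio_filter_nonneg[where g=g and y="\<lambda>k. obs k \<omega>" and L=L, OF gpos L_nonneg p])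
    finally show ?thesis .
  qed
  then show ?thesis using c by (auto simp: eventually_sequentially)
qed

text \<open>The expectation of \<open>\<lambda>\<^bsub>ij\<^esub>\<^bsup>-1/2\<^esup>\<close> over one step is \<open>\<Sum>\<^sub>j \<lambda>\<^bsub>ij\<^esub>\<^bsup>1/2\<^esup>\<close>, which
  tends to \<open>1\<close> with \<open>\<epsilon>\<close>.\<close>

lemma AE_path_prob_ge:
  "AE \<omega> in M. \<forall>\<delta>>0. \<forall>\<^sub>F n in sequentially.
    exp (- (\<delta> + 2 * real CARD('d) * sqrt \<epsilon>) * real n) \<le> (\<Prod>k<n. L $ st k \<omega> $ st (Suc k) \<omega>)"
proof -
  define c where "c = 1 + real CARD('d) * sqrt \<epsilon>"
  have c: "0 < c" using \<epsilon> by (simp add: c_def add_pos_nonneg)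
  have "AE \<omega> in M. \<forall>\<delta>>0. \<forall>\<^sub>F n in sequentially.
      (\<Prod>k<n. L $ st k \<omega> $ st (Suc k) \<omega> powr (- 1 / 2)) \<le> exp (\<delta> * real n) * c ^ n"
  proof (rule AE_chain_prod_le)
    fix i
    have "(\<Sum>j\<in>UNIV. L $ i $ j * L $ i $ j powr (- 1 / 2)) \<le> (\<Sum>j\<in>UNIV. (if i = j then 1 else 0) + sqrt \<epsilon>)"
    proof (rule sum_mono)
      fix j
      have "L $ i $ j * L $ i $ j powr (- 1 / 2) = sqrt (L $ i $ j)"
      proof (cases "L $ i $ j = 0")
        case False
        then have "L $ i $ j > 0" using L_nonneg[of i j] by simp
        then have "L $ i $ j * L $ i $ j powr (- 1 / 2) = L $ i $ j powr 1 * L $ i $ j powr (- 1 / 2)" by simp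
        also have "\<dots> = L $ i $ j powr (1 / 2)" by (simp only: powr_add[symmetric]) simp
        finally show ?thesis using L_nonneg by (simp add: powr_half_sqrt)
      qed simp
      also have "\<dots> \<le> (if i = j then 1 else 0) + sqrt \<epsilon>"
        using L_le_1[of i j] L_off_diag[of i j] \<epsilon>
        by (auto intro: order_trans[of _ 1])
      finally show "L $ i $ j * L $ i $ j powr (- 1 / 2) \<le> (if i = j then 1 else 0) + sqrt \<epsilon>" .
    qed
    also have "\<dots> = c" by (simp add: c_def sum.distrib)
    finally show "(\<Sum>j\<in>UNIV. L $ i $ j * L $ i $ j powr (- 1 / 2)) \<le> c" .
  qed (use c in simp_all)
  then show ?thesis
    using AE_transitions_pos
  proof eventually_elim
    case (elim \<omega>)
    define Q where "Q n = (\<Prod>k<n. L $ st k \<omega> $ st (Suc k) \<omega>)" for n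
    have Q: "Q n > 0" for n unfolding Q_def using elim(2) by (intro prod_pos) auto
    show ?case
    proof (intro allI impI)
      fix \<delta> :: real assume "\<delta> > 0"
      then have "\<forall>\<^sub>F n in sequentially. (\<Prod>k<n. L $ st k \<omega> $ st (Suc k) \<omega> powr (- 1 / 2)) \<le> exp (\<delta> / 2 * real n) * c ^ n"
        using elim(1) half_gt_zero by blast
      then show "\<forall>\<^sub>F n in sequentially. exp (- (\<delta> + 2 * real CARD('d) * sqrt \<epsilon>) * real n) \<le> (\<Prod>k<n. L $ st k \<omega> $ st (Suc k) \<omega>)"
      proof eventually_elim
        case (elim n)
        have "Q n powr (- 1 / 2) = (\<Prod>k<n. L $ st k \<omega> $ st (Suc k) \<omega> powr (- 1 / 2))"
          unfolding Q_def by (induction n) (simp_all add: powr_mult)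
        also have "\<dots> \<le> exp (\<delta> / 2 * real n) * c ^ n" by (rule elim)
        also have "\<dots> \<le> exp (\<delta> / 2 * real n) * exp (real CARD('d) * sqrt \<epsilon>) ^ n"
          using c by (intro mult_left_mono power_mono) (auto simp: c_def exp_ge_add_one_self)
        also have "\<dots> = exp ((\<delta> / 2 + real CARD('d) * sqrt \<epsilon>) * real n)"
          by (simp add: exp_of_nat_mult[symmetric] exp_add[symmetric] algebra_simps)
        \<comment> \<open>Undoing the power -1/2 doubles the rate, whence the 2 in front of the
          number of states.\<close>
        finally have "- 1 / 2 * ln (Q n) \<le> (\<delta> / 2 + real CARD('d) * sqrt \<epsilon>) * real n"
          using Q[of n] by (simp add: powr_def)
        then have "- (\<delta> + 2 * real CARD('d) * sqrt \<epsilon>) * real n \<le> ln (Q n)"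
          by (simp add: algebra_simps)
        then show ?case using Q[of n] by (simp add: ln_ge_iff Q_def)
      qed
    qed
  qed
qed

lemma AE_mass_ge:
  assumes p: "prob_vec p"
  shows "AE \<omega> in M. \<forall>\<delta>>0. \<forall>\<^sub>F n in sequentially.
    exp (- (\<delta> + 2 * real CARD('d) * sqrt \<epsilon>) * real n) \<le> mass p \<omega> n"
  using AE_path_prob_ge AE_obs_pos
proof eventually_elim
  case (elim \<omega>)
  then obtain c where c: "c > 0" "\<forall>\<^sub>F n in sequentially. c * (\<Prod>k<n. L $ st k \<omega> $ st (Suc k) \<omega>) \<le> mass p \<omega> n"
    using mass_ge_path[OF p] by blast
  show ?case
  proof (intro allI impI)
    fix \<delta> :: real assume \<delta>: "\<delta> > 0"
    then have "\<forall>\<^sub>F n in sequentially. exp (- (\<delta> / 2 + 2 * real CARD('d) * sqrt \<epsilon>) * real n) \<le> (\<Prod>k<n. L $ st k \<omega> $ st (Suc k) \<omega>)"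
      using elim(1) half_gt_zero by blast
    moreover have "\<forall>\<^sub>F n in sequentially. 1 / c \<le> exp (\<delta> / 2 * real n)"
      using \<delta> by (intro eventually_le_exp) simp
    ultimately show "\<forall>\<^sub>F n in sequentially. exp (- (\<delta> + 2 * real CARD('d) * sqrt \<epsilon>) * real n) \<le> mass p \<omega> n"
      using c(2)
    proof eventually_elim
      case (elim n)
      let ?e = "exp (- (\<delta> / 2 + 2 * real CARD('d) * sqrt \<epsilon>) * real n)"
      have "exp (- (\<delta> / 2 * real n)) \<le> c"
        using elim(2) c(1) by (simp add: exp_minus field_simps)
      have "exp (- (\<delta> + 2 * real CARD('d) * sqrt \<epsilon>) * real n) = exp (- (\<delta> / 2 * real n)) * ?e"
        by (simp add: exp_add[symmetric] algebra_simps)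
      also have "\<dots> \<le> c * ?e" using \<open>exp (- (\<delta> / 2 * real n)) \<le> c\<close> by (rule mult_right_mono) simp
      also have "\<dots> \<le> c * (\<Prod>k<n. L $ st k \<omega> $ st (Suc k) \<omega>)"
        using elim(1) c(1) by (intro mult_left_mono) auto
      also have "\<dots> \<le> mass p \<omega> n" by (rule elim(3))
      finally show ?case .
    qed
  qed
qed

text \<open>For \<open>\<theta> \<le> 1\<close> the \<open>\<theta>\<close>-th powers of the minors obey a linear recursion on pairs of distinct
  states whose off-diagonal coefficients are at most \<open>\<epsilon>\<^sup>\<theta>\<close>.\<close>

lemma AE_minor_le:
  assumes \<theta>: "0 < \<theta>" "\<theta> \<le> 1 / 2" and b: "\<And>i k l. k \<noteq> l \<longrightarrow> pair_moment \<theta> i k l \<le> b i" and b0: "\<And>i. 0 \<le> b i"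
  shows "AE \<omega> in M. \<forall>\<delta>>0. \<forall>\<^sub>F n in sequentially. (\<Sum>x\<in>UNIV. \<bar>rminor p q \<omega> n (fst x) (snd x)\<bar>) \<le>
    exp (((\<Sum>i\<in>UNIV. \<mu> $ i * (b i + 2 * real CARD('d) ^ 2 * \<epsilon> powr \<theta> - 1)) / \<theta> + \<delta>) * real n)"
proof -
  define r where "r i x u = (if fst x = snd x then 0 else (ratio g i (fst x) u * ratio g i (snd x) u) powr \<theta>)"
    for i and x :: "'d \<times> 'd" and u
  define A where "A z x = (L $ fst z $ fst x * L $ snd z $ snd x) powr \<theta>" for z x :: "'d \<times> 'd"
  define T where "T \<omega> x = \<bar>rminor p q \<omega> 0 (fst x) (snd x)\<bar> powr \<theta>" for \<omega> and x :: "'d \<times> 'd"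
  define T' where "T' x = \<bar>p $ fst x * q $ snd x - p $ snd x * q $ fst x\<bar> powr \<theta>" for x :: "'d \<times> 'd"
  have T: "T \<omega> = T'" for \<omega> by (simp add: T_def T'_def fun_eq_iff minor_def)
  define d where "d = real CARD('d)"
  \<comment> \<open>Staying at a pair contributes at most \<open>b i\<close>. Each of the d^2 target
    pairs is allotted another 2 \<epsilon>^\<theta>, where 2 is the general bound
    \<open>pair_moment_le\<close>.\<close>
  define \<rho> where "\<rho> i = b i + 2 * d ^ 2 * \<epsilon> powr \<theta>" for i
  have d: "d > 0" by (simp add: d_def)
  have \<rho>0: "0 < \<rho> i" for i using b0[of i] d \<epsilon> by (simp add: \<rho>_def add_nonneg_pos)
  have r_int: "(\<integral>\<^sup>+u. ennreal (r i x u) \<partial>P i) = ennreal (if fst x = snd x then 0 else pair_moment \<theta> i (fst x) (snd x))" for i x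
    unfolding r_def using nn_integral_ratio_pair_powr[OF \<theta>] by simp
  have pm0: "0 \<le> pair_moment \<theta> i k l" for i k l unfolding pair_moment_def by simp
  have "AE \<omega> in M. \<forall>\<delta>>0. \<forall>\<^sub>F n in sequentially.
      (\<Sum>x\<in>UNIV. lin_rec r A (\<lambda>k. st k \<omega>) (\<lambda>k. obs k \<omega>) T' n x) \<le> exp (\<delta> * real n) * (\<Prod>k<n. \<rho> (st (Suc k) \<omega>))"
  proof (rule AE_sum_lin_rec_le)
    show "r i x \<in> borel_measurable borel" for i x
      unfolding r_def[abs_def] by measurable
    fix i z
    have "(\<Sum>x\<in>UNIV. ennreal (A z x) * (\<integral>\<^sup>+u. ennreal (r i x u) \<partial>P i)) =
        ennreal (\<Sum>x\<in>UNIV. A z x * (if fst x = snd x then 0 else pair_moment \<theta> i (fst x) (snd x)))"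
      unfolding r_int using pm0 by (simp add: A_def ennreal_mult[symmetric] sum_ennreal del: ennreal_0 cong: if_cong)
    also have "\<dots> \<le> ennreal (\<Sum>x\<in>UNIV. (if z = x then b i else 0) + 2 * \<epsilon> powr \<theta>)"
    proof (intro ennreal_leI sum_mono)
      fix x :: "'d \<times> 'd"
      let ?m = "if fst x = snd x then 0 else pair_moment \<theta> i (fst x) (snd x)"
      have m: "0 \<le> ?m" "?m \<le> 2" "?m \<le> b i" using pm0 pair_moment_le[OF \<theta>] b b0 by auto
      show "A z x * ?m \<le> (if z = x then b i else 0) + 2 * \<epsilon> powr \<theta>"
      proof (cases "z = x")
        case True
        have "A z x \<le> 1 powr \<theta>" unfolding A_def using \<theta> L_nonneg L_le_1
          by (intro powr_mono2) (auto intro: mult_le_one)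
        then have "A z x * ?m \<le> 1 * b i" using m by (intro mult_mono) (auto simp: A_def)
        then show ?thesis using True by (simp add: add_increasing2)
      next
        case False
        have "L $ fst z $ fst x * L $ snd z $ snd x \<le> \<epsilon>"
        proof (cases "fst z = fst x")
          case True
          with False have "snd z \<noteq> snd x" by (auto simp: prod_eq_iff)
          then have "L $ fst z $ fst x * L $ snd z $ snd x \<le> 1 * \<epsilon>"
            using L_nonneg L_le_1 L_off_diag by (intro mult_mono) auto
          then show ?thesis by simp
        next
          case False
          then have "L $ fst z $ fst x * L $ snd z $ snd x \<le> \<epsilon> * 1"
            using L_nonneg L_le_1 L_off_diag \<epsilon> by (intro mult_mono) auto
          then show ?thesis by simp
        qed
        then have "A z x \<le> \<epsilon> powr \<theta>" unfolding A_def using \<theta> L_nonneg by (intro powr_mono2) auto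
        then have "A z x * ?m \<le> \<epsilon> powr \<theta> * 2" using m by (intro mult_mono) (auto simp: A_def)
        then show ?thesis using False by simp
      qed
    qed
    also have "\<dots> = ennreal (\<rho> i)"
      by (simp add: sum.distrib \<rho>_def d_def power2_eq_square mult_ac)
    finally show "(\<Sum>x\<in>UNIV. ennreal (A z x) * (\<integral>\<^sup>+u. ennreal (r i x u) \<partial>P i)) \<le> ennreal (\<rho> i)" .
  qed (auto simp: r_def A_def T'_def \<rho>0)
  then show ?thesis
    using AE_mean_chain_tendsto[OF slow \<epsilon>(1) \<Lambda> erg, of "\<lambda>i. \<rho> i - 1"] AE_obs_pos
  proof eventually_elim
    case (elim \<omega>)
    let ?m = "\<Sum>i\<in>UNIV. \<mu> $ i * (\<rho> i - 1)"
    show ?case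
    proof (intro allI impI)
      fix \<delta> :: real assume \<delta>: "\<delta> > 0"
      \<comment> \<open>After division by \<theta>, two errors of this size make \<delta>/2; the
        other half pays for the sum over d^2 pairs.\<close>
      define \<delta>' where "\<delta>' = \<delta> * \<theta> / 4"
      have \<delta>': "\<delta>' > 0" using \<delta> \<theta> by (simp add: \<delta>'_def)
      have "\<forall>\<^sub>F n in sequentially. (\<Sum>x\<in>UNIV. lin_rec r A (\<lambda>k. st k \<omega>) (\<lambda>k. obs k \<omega>) T' n x) \<le>
          exp (\<delta>' * real n) * (\<Prod>k<n. \<rho> (st (Suc k) \<omega>))"
        using elim(1) \<delta>' by blast
      moreover have "\<forall>\<^sub>F n in sequentially. (\<Sum>k<n. \<rho> (st (Suc k) \<omega>) - 1) / real n < ?m + \<delta>'"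
        using elim(2) \<delta>' by (intro order_tendstoD(2)) auto
      moreover have "\<forall>\<^sub>F n in sequentially. d ^ 2 \<le> exp (\<delta> / 2 * real n)"
        using \<delta> by (intro eventually_le_exp) simp
      ultimately show "\<forall>\<^sub>F n in sequentially. (\<Sum>x\<in>UNIV. \<bar>rminor p q \<omega> n (fst x) (snd x)\<bar>) \<le>
          exp (((\<Sum>i\<in>UNIV. \<mu> $ i * (b i + 2 * real CARD('d) ^ 2 * \<epsilon> powr \<theta> - 1)) / \<theta> + \<delta>) * real n)"
        using eventually_gt_at_top[of 0]
      proof eventually_elim
        case E: (elim n)
        \<comment> \<open>The inequality x <= exp(x - 1) turns the product into a time average, to
          which the ergodic theorem applies.\<close>
        have "(\<Prod>k<n. \<rho> (st (Suc k) \<omega>)) \<le> (\<Prod>k<n. exp (\<rho> (st (Suc k) \<omega>) - 1))"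
          using \<rho>0 by (intro prod_mono) (auto simp: less_imp_le intro: order_trans[OF _ exp_ge_add_one_self])
        also have "\<dots> = exp (\<Sum>k<n. \<rho> (st (Suc k) \<omega>) - 1)" by (simp add: exp_sum)
        also have "\<dots> \<le> exp ((?m + \<delta>') * real n)"
          using E(2,4) by (simp add: divide_less_eq)
        finally have prod: "(\<Prod>k<n. \<rho> (st (Suc k) \<omega>)) \<le> exp ((?m + \<delta>') * real n)" .
        have "\<bar>rminor p q \<omega> n (fst x) (snd x)\<bar> \<le> exp ((?m + 2 * \<delta>') / \<theta> * real n)" for x
        proof -
          have "\<bar>rminor p q \<omega> n (fst x) (snd x)\<bar> powr \<theta> \<le> lin_rec r A (\<lambda>k. st k \<omega>) (\<lambda>k. obs k \<omega>) T' n x"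
            using minor_powr_le[of g "\<lambda>k. obs k \<omega>" L \<theta> "\<lambda>k. st k \<omega>" p q n "fst x" "snd x"] elim(3) L_nonneg \<theta>
            unfolding T[symmetric, of \<omega>] r_def[abs_def] A_def[abs_def] T_def[abs_def] by simp
          also have "\<dots> \<le> (\<Sum>x\<in>UNIV. lin_rec r A (\<lambda>k. st k \<omega>) (\<lambda>k. obs k \<omega>) T' n x)"
            by (rule member_le_sum) (auto intro!: lin_rec_nonneg simp: r_def A_def T'_def)
          also have "\<dots> \<le> exp (\<delta>' * real n) * (\<Prod>k<n. \<rho> (st (Suc k) \<omega>))" by (rule E(1))
          also have "\<dots> \<le> exp (\<delta>' * real n) * exp ((?m + \<delta>') * real n)"
            using prod by (intro mult_left_mono) auto
          also have "\<dots> = exp ((?m + 2 * \<delta>') * real n)" by (simp add: exp_add[symmetric] algebra_simps)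
          finally have *: "\<bar>rminor p q \<omega> n (fst x) (snd x)\<bar> powr \<theta> \<le> exp ((?m + 2 * \<delta>') * real n)" .
          show ?thesis
          proof (cases "rminor p q \<omega> n (fst x) (snd x) = 0")
            case False
            then have "exp (\<theta> * ln \<bar>rminor p q \<omega> n (fst x) (snd x)\<bar>) \<le> exp ((?m + 2 * \<delta>') * real n)"
              using * by (simp add: powr_def)
            then have "ln \<bar>rminor p q \<omega> n (fst x) (snd x)\<bar> \<le> (?m + 2 * \<delta>') / \<theta> * real n"
              using \<theta> by (simp add: field_simps)
            then have "exp (ln \<bar>rminor p q \<omega> n (fst x) (snd x)\<bar>) \<le> exp ((?m + 2 * \<delta>') / \<theta> * real n)"
              by (simp only: exp_le_cancel_iff)
            then show ?thesis using False by simp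
          qed simp
        qed
        then have "(\<Sum>x\<in>UNIV. \<bar>rminor p q \<omega> n (fst x) (snd x)\<bar>) \<le> (\<Sum>x\<in>(UNIV :: ('d \<times> 'd) set). exp ((?m + 2 * \<delta>') / \<theta> * real n))"
          by (intro sum_mono)
        also have "\<dots> = d ^ 2 * exp ((?m + 2 * \<delta>') / \<theta> * real n)" by (simp add: d_def power2_eq_square)
        also have "\<dots> \<le> exp (\<delta> / 2 * real n) * exp ((?m + 2 * \<delta>') / \<theta> * real n)"
          by (intro mult_right_mono E(3)) simp
        also have "\<dots> = exp ((?m / \<theta> + \<delta>) * real n)"
          using \<theta> by (simp add: exp_add[symmetric] \<delta>'_def field_simps)
        finally show ?case by (simp add: \<rho>_def d_def)
      qed
    qed
  qed
qed

text \<open>The minors give the decay; each of the two masses in the denominator costs 2 d sqrt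
  \<epsilon>, with d the number of states.\<close>

lemma AE_stability_index_le:
  assumes p: "prob_vec p" and q: "prob_vec q"
    and \<theta>: "0 < \<theta>" "\<theta> \<le> 1 / 2" and b: "\<And>i k l. k \<noteq> l \<longrightarrow> pair_moment \<theta> i k l \<le> b i" and b0: "\<And>i. 0 \<le> b i"
    and ind: "AE \<omega> in M. has_stability_index (nl_filter g L (\<lambda>n. observation a X \<xi> n \<omega>) p)
      (nl_filter g L (\<lambda>n. observation a X \<xi> n \<omega>) q) (\<gamma> \<omega>)"
  shows "AE \<omega> in M. \<gamma> \<omega> \<le> ereal ((\<Sum>i\<in>UNIV. \<mu> $ i * (b i + 2 * real CARD('d) ^ 2 * \<epsilon> powr \<theta> - 1)) / \<theta> +
    4 * real CARD('d) * sqrt \<epsilon>)"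
  using ind AE_obs_pos AE_mass_ge[OF p] AE_mass_ge[OF q] AE_minor_le[OF \<theta> b b0, of p q] AE_space
proof eventually_elim
  case (elim \<omega>)
  let ?B = "(\<Sum>i\<in>UNIV. \<mu> $ i * (b i + 2 * real CARD('d) ^ 2 * \<epsilon> powr \<theta> - 1)) / \<theta>"
  let ?e = "2 * real CARD('d) * sqrt \<epsilon>"
  have obs: "(\<lambda>n. observation a X \<xi> n \<omega>) = (\<lambda>n. obs n \<omega>)" using elim(6) by (simp add: observation_eq)
  show ?case
  proof (rule has_stability_index_le)
    show "has_stability_index (nl_filter g L (\<lambda>n. obs n \<omega>) p) (nl_filter g L (\<lambda>n. obs n \<omega>) q) (\<gamma> \<omega>)"
      using elim(1) unfolding obs .
    fix \<delta> :: real assume "\<delta> > 0"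
    then have "\<delta> / 3 > 0" by simp
    with elim have "\<forall>\<^sub>F n in sequentially. exp (- (\<delta> / 3 + ?e) * real n) \<le> mass p \<omega> n"
      "\<forall>\<^sub>F n in sequentially. exp (- (\<delta> / 3 + ?e) * real n) \<le> mass q \<omega> n"
      "\<forall>\<^sub>F n in sequentially. (\<Sum>x\<in>UNIV. \<bar>rminor p q \<omega> n (fst x) (snd x)\<bar>) \<le> exp ((?B + \<delta> / 3) * real n)"
      by blast+
    then show "\<forall>\<^sub>F n in sequentially. l1_norm (nl_filter g L (\<lambda>n. obs n \<omega>) p n - nl_filter g L (\<lambda>n. obs n \<omega>) q n) \<le>
        exp ((?B + 4 * real CARD('d) * sqrt \<epsilon> + \<delta>) * real n)"
    proof eventually_elim
      case E: (elim n)
      have "l1_norm (nl_filter g L (\<lambda>n. obs n \<omega>) p n - nl_filter g L (\<lambda>n. obs n \<omega>) q n) \<le>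
          (\<Sum>x\<in>UNIV. \<bar>rminor p q \<omega> n (fst x) (snd x)\<bar>) / (mass p \<omega> n * mass q \<omega> n)"
        unfolding mass_def
        using elim(2) by (intro l1_norm_nl_filter_diff_le L_nonneg p q L_diag) auto
      also have "\<dots> \<le> exp ((?B + \<delta> / 3) * real n) /
          (exp (- (\<delta> / 3 + ?e) * real n) * exp (- (\<delta> / 3 + ?e) * real n))"
        using E by (intro frac_le mult_mono mult_pos_pos) (auto intro: order_trans[OF exp_ge_zero])
      also have "\<dots> = exp ((?B + 4 * real CARD('d) * sqrt \<epsilon> + \<delta>) * real n)"
        by (simp add: exp_add[symmetric] exp_diff[symmetric] algebra_simps)
      finally show ?case .
    qed
  qed
qed

lemma AE_stability_index_ge:
  assumes U: "(UNIV :: 'd set) = {i, j}" "i \<noteq> j" and p: "prob_vec p" and q: "prob_vec q" and pq: "p \<noteq> q"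
    and \<epsilon>2: "\<epsilon> < 1 / 2"
    and ind: "AE \<omega> in M. has_stability_index (nl_filter g L (\<lambda>n. observation a X \<xi> n \<omega>) p)
      (nl_filter g L (\<lambda>n. observation a X \<xi> n \<omega>) q) (\<gamma> \<omega>)"
  shows "AE \<omega> in M. ereal (- \<mu> $ i * kl_div \<phi> (g i) (g j) - \<mu> $ j * kl_div \<phi> (g j) (g i) + ln (1 - 2 * \<epsilon>)) \<le> \<gamma> \<omega>"
proof -
  \<comment> \<open>Minus the logarithm of the likelihood factor of the minor, so that upper bounds
    on its sums are lower bounds on the minor.\<close>
  define \<zeta> where "\<zeta> k u = - (log_ratio k i u + log_ratio k j u)" for k u
  have \<zeta>_measurable: "\<zeta> k \<in> borel_measurable borel" for k unfolding \<zeta>_def[abs_def] by measurable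
  have int: "integrable (P k) (\<zeta> k)" for k
    unfolding \<zeta>_def[abs_def] by (intro Bochner_Integration.integrable_minus Bochner_Integration.integrable_add integrable_log_ratio)
  have \<zeta>: "(LINT u|P k. \<zeta> k u) = kl_div \<phi> (g k) (g i) + kl_div \<phi> (g k) (g j)" for k
    unfolding \<zeta>_def by (simp add: integrable_log_ratio integral_log_ratio)
  have kl_self: "kl_div \<phi> (g k) (g k) = 0" for k
  proof -
    have "g k u * ln (g k u / g k u) = 0" for u by (cases "g k u = 0") auto
    then show ?thesis unfolding kl_div_def by (simp only:) simp
  qed
  have two: "(\<Sum>k\<in>UNIV. f k) = f i + f j" for f :: "'d \<Rightarrow> real" unfolding U(1) using U(2) by simp
  let ?D = "\<mu> $ i * kl_div \<phi> (g i) (g j) + \<mu> $ j * kl_div \<phi> (g j) (g i)"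
  have D: "(\<Sum>k\<in>UNIV. \<mu> $ k * (LINT u|P k. \<zeta> k u)) = ?D"
    unfolding \<zeta> two by (simp add: kl_self)
  define det where "det = L $ i $ i * L $ j $ j - L $ i $ j * L $ j $ i"
  \<comment> \<open>For a two-state stochastic matrix the determinant is 1 minus the two jump
    probabilities, each at most \<epsilon>.\<close>
  have det: "det \<ge> 1 - 2 * \<epsilon>"
  proof -
    have "L $ i $ i = 1 - L $ i $ j" "L $ j $ j = 1 - L $ j $ i"
      using L_sum[of i] L_sum[of j] by (auto simp: two)
    then have "det = 1 - L $ i $ j - L $ j $ i"
      unfolding det_def by (simp only:) (simp add: algebra_simps)
    then show ?thesis using L_off_diag[OF U(2)] L_off_diag[OF U(2)[symmetric]] by linarith
  qed
  define D0 where "D0 = \<bar>p $ i * q $ j - p $ j * q $ i\<bar>"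
  \<comment> \<open>For probability vectors on two points the initial minor equals
    \<open>p $ i - q $ i\<close>, which is nonzero when the vectors differ.\<close>
  have D0: "D0 > 0"
  proof -
    have pj: "p $ j = 1 - p $ i" "q $ j = 1 - q $ i" using p q by (auto simp: prob_vec_def two)
    have "p $ i \<noteq> q $ i"
    proof
      assume "p $ i = q $ i"
      then have "\<forall>k\<in>UNIV. p $ k = q $ k" unfolding U(1) using pj by simp
      with pq show False by (simp add: vec_eq_iff)
    qed
    then show ?thesis unfolding D0_def pj by (simp add: algebra_simps)
  qed
  show ?thesis
    using ind AE_obs_pos AE_mass_le[OF p] AE_mass_le[OF q]
      AE_frequently_sum_le[OF slow \<epsilon>(1) \<Lambda> erg \<zeta>_measurable int, unfolded D] AE_space
  proof eventually_elim
    case (elim \<omega>)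
    have obs: "(\<lambda>n. observation a X \<xi> n \<omega>) = (\<lambda>n. obs n \<omega>)" using elim(6) by (simp add: observation_eq)
    have minor: "\<bar>rminor p q \<omega> n i j\<bar> = exp (- (\<Sum>k<n. \<zeta> (st (Suc k) \<omega>) (obs (Suc k) \<omega>))) * det ^ n * D0" for n
    proof -
      have ex: "ratio g (st (Suc k) \<omega>) i (obs (Suc k) \<omega>) * ratio g (st (Suc k) \<omega>) j (obs (Suc k) \<omega>) =
          exp (- \<zeta> (st (Suc k) \<omega>) (obs (Suc k) \<omega>))" for k
        using elim(2) by (simp add: \<zeta>_def log_ratio_def exp_add)
      have minor_prod: "rminor p q \<omega> n i j =
          (\<Prod>k=1..n. ratio g (st k \<omega>) i (obs k \<omega>) * ratio g (st k \<omega>) j (obs k \<omega>)) *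
            det ^ n * rminor p q \<omega> 0 i j"
        unfolding det_def by (rule minor_two_states) (use elim(2) L_nonneg U in \<open>auto\<close>)
      have "\<bar>rminor p q \<omega> n i j\<bar> = \<bar>(\<Prod>k<n. exp (- \<zeta> (st (Suc k) \<omega>) (obs (Suc k) \<omega>))) * det ^ n * rminor p q \<omega> 0 i j\<bar>"
        by (simp only: minor_prod One_nat_def prod.atLeast1_atMost_eq ex)
      also have "\<dots> = exp (- (\<Sum>k<n. \<zeta> (st (Suc k) \<omega>) (obs (Suc k) \<omega>))) * det ^ n * D0"
        using det \<epsilon>2 by (simp add: abs_mult exp_sum[symmetric] sum_negf D0_def minor_def prod_nonneg)
      finally show ?thesis .
    qed
    show ?case
    proof (rule has_stability_index_ge)
      show "has_stability_index (nl_filter g L (\<lambda>n. obs n \<omega>) p) (nl_filter g L (\<lambda>n. obs n \<omega>) q) (\<gamma> \<omega>)"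
        using elim(1) unfolding obs .
      fix \<delta> :: real assume "\<delta> > 0"
      \<comment> \<open>One quarter each for the sum of log-ratios, the initial minor and the two
        masses.\<close>
      then have \<delta>: "\<delta> / 4 > 0" by simp
      have "\<exists>\<^sub>F n in sequentially. (\<Sum>k<n. \<zeta> (st (Suc k) \<omega>) (obs (Suc k) \<omega>)) \<le> (?D + \<delta> / 4) * real n"
        using elim(5) \<delta> by blast
      moreover have "\<forall>\<^sub>F n in sequentially. mass p \<omega> n \<le> exp (\<delta> / 4 * real n)"
        "\<forall>\<^sub>F n in sequentially. mass q \<omega> n \<le> exp (\<delta> / 4 * real n)"
        using elim(3,4) \<delta> by blast+
      moreover have "\<forall>\<^sub>F n in sequentially. 1 / D0 \<le> exp (\<delta> / 4 * real n)"
        by (rule eventually_le_exp[OF \<delta>])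
      ultimately have "\<exists>\<^sub>F n in sequentially. (\<Sum>k<n. \<zeta> (st (Suc k) \<omega>) (obs (Suc k) \<omega>)) \<le> (?D + \<delta> / 4) * real n \<and>
          mass p \<omega> n \<le> exp (\<delta> / 4 * real n) \<and> mass q \<omega> n \<le> exp (\<delta> / 4 * real n) \<and> 1 / D0 \<le> exp (\<delta> / 4 * real n)"
        by (intro frequently_eventually_frequently eventually_conj)
      then show "\<exists>\<^sub>F n in sequentially.
        exp ((- \<mu> $ i * kl_div \<phi> (g i) (g j) - \<mu> $ j * kl_div \<phi> (g j) (g i) + ln (1 - 2 * \<epsilon>) - \<delta>) * real n) \<le>
          l1_norm (nl_filter g L (\<lambda>n. obs n \<omega>) p n - nl_filter g L (\<lambda>n. obs n \<omega>) q n)"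
      proof (rule frequently_elim1)
        fix n
        assume A: "(\<Sum>k<n. \<zeta> (st (Suc k) \<omega>) (obs (Suc k) \<omega>)) \<le> (?D + \<delta> / 4) * real n \<and>
          mass p \<omega> n \<le> exp (\<delta> / 4 * real n) \<and> mass q \<omega> n \<le> exp (\<delta> / 4 * real n) \<and> 1 / D0 \<le> exp (\<delta> / 4 * real n)"
        have mass_pos: "mass p \<omega> n > 0" "mass q \<omega> n > 0"
          unfolding mass_def using elim(2) by (auto intro!: ratio_filter_sum_pos L_nonneg p q L_diag)
        have D0e: "exp (- (\<delta> / 4 * real n)) \<le> D0"
          using A D0 by (simp add: exp_minus field_simps)
        have dete: "exp (ln (1 - 2 * \<epsilon>) * real n) \<le> det ^ n"
        proof -
          have "exp (ln (1 - 2 * \<epsilon>) * real n) = (1 - 2 * \<epsilon>) ^ n"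
            using \<epsilon>2 by (simp add: exp_of_nat2_mult)
          also have "\<dots> \<le> det ^ n" using det \<epsilon>2 by (intro power_mono) auto
          finally show ?thesis .
        qed
        have "exp ((- \<mu> $ i * kl_div \<phi> (g i) (g j) - \<mu> $ j * kl_div \<phi> (g j) (g i) + ln (1 - 2 * \<epsilon>) - \<delta>) * real n) =
          exp (- ((?D + \<delta> / 4) * real n)) * exp (ln (1 - 2 * \<epsilon>) * real n) * exp (- (\<delta> / 4 * real n)) /
            (exp (\<delta> / 4 * real n) * exp (\<delta> / 4 * real n))"
          by (simp add: exp_add[symmetric] exp_diff[symmetric] algebra_simps)
        also have "\<dots> \<le> \<bar>rminor p q \<omega> n i j\<bar> / (mass p \<omega> n * mass q \<omega> n)"
          unfolding minor using A mass_pos D0e dete det \<epsilon>2 D0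
          by (intro frac_le mult_mono mult_pos_pos mult_nonneg_nonneg) (auto simp: less_imp_le)
        also have "\<dots> \<le> l1_norm (nl_filter g L (\<lambda>n. obs n \<omega>) p n - nl_filter g L (\<lambda>n. obs n \<omega>) q n)"
          unfolding mass_def using elim(2) U
          by (intro l1_norm_nl_filter_diff_ge L_nonneg p q L_diag) auto
        finally show "exp ((- \<mu> $ i * kl_div \<phi> (g i) (g j) - \<mu> $ j * kl_div \<phi> (g j) (g i) + ln (1 - 2 * \<epsilon>) - \<delta>) * real n) \<le>
          l1_norm (nl_filter g L (\<lambda>n. obs n \<omega>) p n - nl_filter g L (\<lambda>n. obs n \<omega>) q n)" .
      qed
    qed
  qed
qed

end

end


section \<open>From a bound at every tolerance to a single remainder, and the theorem\<close>

lemma small_o_remainder: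
  fixes Q :: "real \<Rightarrow> real \<Rightarrow> bool"
  assumes ev: "\<And>\<eta>. \<eta> > 0 \<Longrightarrow> \<forall>\<^sub>F \<epsilon> in at_right 0. Q \<epsilon> \<eta>"
    and mono: "\<And>\<epsilon> \<eta> \<eta>'. Q \<epsilon> \<eta> \<Longrightarrow> \<eta> \<le> \<eta>' \<Longrightarrow> Q \<epsilon> \<eta>'"
  shows "\<exists>r \<in> o[at_right 0](\<lambda>_. 1). \<forall>\<^sub>F \<epsilon> in at_right 0. Q \<epsilon> (r \<epsilon>)"
proof -
  define S where "S \<epsilon> = {\<eta>. 0 < \<eta> \<and> Q \<epsilon> \<eta>}" for \<epsilon>
  \<comment> \<open>The least admissible error, raised by \<epsilon> because the infimum need not be
    attained; the shift itself tends to 0.\<close>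
  define r where "r \<epsilon> = Inf (S \<epsilon>) + \<epsilon>" for \<epsilon>
  have bdd: "bdd_below (S \<epsilon>)" for \<epsilon> by (rule bdd_belowI[of _ 0]) (auto simp: S_def)
  have "(r \<longlongrightarrow> 0) (at_right 0)"
  proof (rule tendstoI)
    fix e :: real assume e: "e > 0"
    have "\<forall>\<^sub>F \<epsilon> in at_right 0. Q \<epsilon> (e / 2)" using e by (intro ev) simp
    moreover have "\<forall>\<^sub>F \<epsilon> in at_right 0. \<epsilon> \<in> {0<..<e / 2}"
      using e by (intro eventually_at_right_real) simp
    ultimately show "\<forall>\<^sub>F \<epsilon> in at_right 0. dist (r \<epsilon>) 0 < e"
    proof eventually_elim
      case (elim \<epsilon>)
      then have mem: "e / 2 \<in> S \<epsilon>" using e by (simp add: S_def)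
      then have "Inf (S \<epsilon>) \<le> e / 2" by (rule cInf_lower) (rule bdd)
      moreover have "0 \<le> Inf (S \<epsilon>)" using mem by (intro cInf_greatest) (blast, simp add: S_def)
      ultimately show ?case using elim by (simp add: r_def dist_real_def)
    qed
  qed
  then have "r \<in> o[at_right 0](\<lambda>_. 1)" by (intro smalloI_tendsto) auto
  moreover have "\<forall>\<^sub>F \<epsilon> in at_right 0. Q \<epsilon> (r \<epsilon>)"
    using ev[OF zero_less_one] eventually_at_right_real[OF zero_less_one]
  proof eventually_elim
    case (elim \<epsilon>)
    then have "S \<epsilon> \<noteq> {}" by (auto simp: S_def intro!: exI[of _ 1])
    then obtain \<eta> where "\<eta> \<in> S \<epsilon>" "\<eta> < r \<epsilon>"
      using cInf_lessD[of "S \<epsilon>" "r \<epsilon>"] elim by (auto simp: r_def)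
    then show ?case using mono by (auto simp: S_def intro: less_imp_le)
  qed
  ultimately show ?thesis by blast
qed

lemma abs_ereal_diff_le:
  fixes x :: ereal
  assumes "x \<le> ereal (c + \<eta>)" "ereal (c - \<eta>) \<le> x"
  shows "\<bar>x - ereal c\<bar> \<le> ereal \<eta>"
  using assms by (cases x) auto

theorem theorem1p1:
  fixes a :: "'d::finite \<Rightarrow> real"
    and \<Lambda> :: "real ^ 'd ^ 'd"
    and \<mu> \<nu> \<nu>' :: "real ^ 'd"
    and \<phi> :: "real measure"
    and g :: "'d \<Rightarrow> real \<Rightarrow> real"
    and M :: "'w measure"
    and X :: "real \<Rightarrow> nat \<Rightarrow> 'w \<Rightarrow> real"
    and \<xi> :: "nat \<Rightarrow> 'd \<Rightarrow> 'w \<Rightarrow> real"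
    and \<gamma> :: "real \<Rightarrow> 'w \<Rightarrow> ereal"
  assumes "CARD('d) \<ge> 2" and "inj a"
    and "stochastic \<Lambda>" and "ergodic_with_limits \<Lambda> \<mu>"
    and "prob_vec \<nu>" and "prob_vec \<nu>'"
    and "sigma_finite_measure \<phi>" and "sets \<phi> = sets borel"
    and "\<And>i u. 0 \<le> g i u"
    and "prob_space M"
    and "\<And>\<epsilon>. \<epsilon> \<in> {0<..<1} \<Longrightarrow> markov_chain M a \<nu> (slow \<Lambda> \<epsilon>) (X \<epsilon>)"
    and "noise M \<phi> g \<xi>"
    and "\<And>\<epsilon>. \<epsilon> \<in> {0<..<1} \<Longrightarrow> indep_chain_noise M (X \<epsilon>) \<xi>"
    and bounded: "\<And>i. bounded (range (g i))"
    and same_support: "\<And>i j. AE u in \<phi>. g i u > 0 \<longleftrightarrow> g j u > 0"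
    and log_integral: "\<And>i j. log_integral_finite \<phi> (g i) (g j)"
    and stability_index: "\<And>\<epsilon>. \<epsilon> \<in> {0<..<1} \<Longrightarrow>
      AE \<omega> in M. has_stability_index
        (nl_filter g (slow \<Lambda> \<epsilon>) (\<lambda>n. observation a (X \<epsilon>) \<xi> n \<omega>) \<nu>)
        (nl_filter g (slow \<Lambda> \<epsilon>) (\<lambda>n. observation a (X \<epsilon>) \<xi> n \<omega>) \<nu>')
        (\<gamma> \<epsilon> \<omega>)"
  shows "(\<exists>r \<in> o[at_right 0](\<lambda>_. 1). \<forall>\<^sub>F \<epsilon> in at_right 0. AE \<omega> in M.
            \<gamma> \<epsilon> \<omega> \<le> ereal (- (\<Sum>i\<in>UNIV. \<mu> $ i * (MIN j\<in>UNIV - {i}. kl_div \<phi> (g i) (g j))) + r \<epsilon>))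
       \<and> (\<forall>i\<^sub>1 i\<^sub>2. CARD('d) = 2 \<and> \<nu> \<noteq> \<nu>' \<and> i\<^sub>1 \<noteq> i\<^sub>2 \<longrightarrow>
            (\<exists>r \<in> o[at_right 0](\<lambda>_. 1). \<forall>\<^sub>F \<epsilon> in at_right 0. AE \<omega> in M.
               \<bar>\<gamma> \<epsilon> \<omega> - ereal (- \<mu> $ i\<^sub>1 * kl_div \<phi> (g i\<^sub>1) (g i\<^sub>2)
                                 - \<mu> $ i\<^sub>2 * kl_div \<phi> (g i\<^sub>2) (g i\<^sub>1))\<bar> \<le> ereal (r \<epsilon>)))"
proof -
  define kl where "kl i j = kl_div \<phi> (g i) (g j)" for i j
  define m where "m i = (MIN j\<in>UNIV - {i}. kl i j)" for i
  define d where "d = real CARD('d)"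
  let ?K = "\<Sum>i\<in>UNIV. \<mu> $ i * m i"
  have chain: "comparable_hidden_chain M a \<nu> (slow \<Lambda> \<epsilon>) (X \<epsilon>) \<phi> g \<xi>" if "\<epsilon> \<in> {0<..<1}" for \<epsilon>
    using assms that
    by (intro comparable_hidden_chain.intro hidden_chain.intro hidden_chain_axioms.intro
        comparable_hidden_chain_axioms.intro stochastic_slow) auto
  \<comment> \<open>The moments and entropies depend on \<open>\<phi>\<close> and \<open>g\<close>
    alone, while \<theta> must be chosen before \<epsilon>. The instance at \<epsilon> = 1/2 makes
    them available.\<close>
  interpret half: comparable_hidden_chain M a \<nu> "slow \<Lambda> (1 / 2)" "X (1 / 2)" \<phi> g \<xi>
    by (rule chain) simp
  have other: "\<exists>k. k \<noteq> i" for i :: 'd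
  proof (rule ccontr)
    assume "\<nexists>k. k \<noteq> i"
    then have "(UNIV :: 'd set) = {i}" by auto
    then have "CARD('d) = 1" by (metis card_1_singleton_iff One_nat_def)
    with \<open>CARD('d) \<ge> 2\<close> show False by simp
  qed
  \<comment> \<open>Of two distinct indices at least one differs from i, and the other entropy is
    nonnegative; this produces the minimum over j \<noteq> i.\<close>
  have m_le: "m i \<le> kl i k + kl i l" if "k \<noteq> l" for i k l
  proof -
    have nn: "0 \<le> kl i k" for k unfolding kl_def by (rule half.kl_div_nonneg)
    have "m i \<le> kl i k" if "k \<noteq> i" for k unfolding m_def using that by (intro Min_le) auto
    then show ?thesis using that nn[of k] nn[of l] by (cases "k = i") (auto intro: add_increasing add_increasing2)
  qed
  have upper: "\<forall>\<^sub>F \<epsilon> in at_right 0. AE \<omega> in M. \<gamma> \<epsilon> \<omega> \<le> ereal (- ?K + \<eta>)" if "\<eta> > 0" for \<eta>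
  proof -
    define S where "S = (\<Sum>i\<in>UNIV. \<mu> $ i)"
    have \<mu>: "\<mu> $ i > 0" for i using assms(4) by (simp add: ergodic_with_limits_def)
    have S: "S \<ge> 0" unfolding S_def by (intro sum_nonneg) (simp add: \<mu> less_imp_le)
    \<comment> \<open>A third of \<eta> is reserved for the slopes and a third for the terms that
      vanish with \<epsilon>; the 1 keeps the denominator positive.\<close>
    define \<eta>' where "\<eta>' = \<eta> / (3 * (S + 1))"
    have \<eta>': "\<eta>' > 0" "S * \<eta>' \<le> \<eta> / 3" using that S by (simp_all add: \<eta>'_def field_simps)
    have "\<forall>\<^sub>F n in sequentially. \<forall>i. \<forall>k. \<forall>l. k \<noteq> l \<longrightarrow>
       (half.pair_moment (1 / (real n + 4)) i k l - 1) / (1 / (real n + 4)) < \<eta>' - m i"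
    proof (intro eventually_all_finite)
      fix i k l
      show "\<forall>\<^sub>F n in sequentially. k \<noteq> l \<longrightarrow>
         (half.pair_moment (1 / (real n + 4)) i k l - 1) / (1 / (real n + 4)) < \<eta>' - m i"
      proof (cases "k = l")
        case False
        have "\<forall>\<^sub>F n in sequentially.
          (half.pair_moment (1 / (real n + 4)) i k l - 1) / (1 / (real n + 4)) < \<eta>' - m i"
          using m_le[OF False, of i] \<eta>'(1)
          by (intro order_tendstoD(2)[OF half.pair_moment_tendsto]) (simp add: kl_def)
        then show ?thesis by eventually_elim simp
      qed simp
    qed
    from eventually_happens'[OF sequentially_bot this] obtain n :: nat where n: "\<And>i k l. k \<noteq> l \<Longrightarrow>
       (half.pair_moment (1 / (real n + 4)) i k l - 1) / (1 / (real n + 4)) < \<eta>' - m i"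
      by blast
    \<comment> \<open>The exponent depends on \<eta> and not on \<epsilon>: with \<theta> fixed,
      \<epsilon>^\<theta> / \<theta> tends to 0.\<close>
    define \<theta> where "\<theta> = 1 / (real n + 4)"
    have \<theta>: "0 < \<theta>" "\<theta> \<le> 1 / 2" by (auto simp: \<theta>_def)
    \<comment> \<open>The first-order expansion of the moments, with slope -\<open>m i\<close>
      relaxed by \<open>\<eta>'\<close>.\<close>
    define b where "b i = 1 + \<theta> * (\<eta>' - m i)" for i
    have b: "k \<noteq> l \<longrightarrow> half.pair_moment \<theta> i k l \<le> b i" for i k l
    proof
      assume "k \<noteq> l"
      from n[OF this, of i, folded \<theta>_def] show "half.pair_moment \<theta> i k l \<le> b i"
        using \<theta>(1) by (simp add: b_def divide_less_eq mult.commute)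
    qed
    have b0: "0 \<le> b i" for i
    proof -
      obtain k where "k \<noteq> i" using other by blast
      then have "half.pair_moment \<theta> i k i \<le> b i" using b by blast
      moreover have "0 \<le> half.pair_moment \<theta> i k i" unfolding half.pair_moment_def by simp
      ultimately show ?thesis by linarith
    qed
    have "((\<lambda>\<epsilon>. S * (2 * d ^ 2) / \<theta> * \<epsilon> powr \<theta> + 4 * d * sqrt \<epsilon>) \<longlongrightarrow> S * (2 * d ^ 2) / \<theta> * 0 + 4 * d * 0) (at_right 0)"
    proof (intro tendsto_add tendsto_mult tendsto_const)
      show "((\<lambda>\<epsilon>. \<epsilon> powr \<theta>) \<longlongrightarrow> 0) (at_right 0)" using \<theta>(1) by real_asymp
      show "(sqrt \<longlongrightarrow> 0) (at_right 0)" by real_asymp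
    qed
    then have "\<forall>\<^sub>F \<epsilon> in at_right 0. S * (2 * d ^ 2) / \<theta> * \<epsilon> powr \<theta> + 4 * d * sqrt \<epsilon> < \<eta> / 3"
      using that by (intro order_tendstoD(2)) auto
    then show ?thesis
      using eventually_at_right_real[OF zero_less_one]
    proof eventually_elim
      case (elim \<epsilon>)
      interpret comparable_hidden_chain M a \<nu> "slow \<Lambda> \<epsilon>" "X \<epsilon>" \<phi> g \<xi> by (rule chain[OF elim(2)])
      have "AE \<omega> in M. \<gamma> \<epsilon> \<omega> \<le> ereal ((\<Sum>i\<in>UNIV. \<mu> $ i * (b i + 2 * real CARD('d) ^ 2 * \<epsilon> powr \<theta> - 1)) / \<theta> +
          4 * real CARD('d) * sqrt \<epsilon>)"
        using elim(2) assms by (intro AE_stability_index_le[OF refl _ _ _ _ _ _ \<theta> b b0 stability_index]) auto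
      moreover have "(\<Sum>i\<in>UNIV. \<mu> $ i * (b i + 2 * real CARD('d) ^ 2 * \<epsilon> powr \<theta> - 1)) / \<theta> + 4 * real CARD('d) * sqrt \<epsilon>
          \<le> - ?K + \<eta>"
      proof -
        have "(\<Sum>i\<in>UNIV. \<mu> $ i * (b i + 2 * real CARD('d) ^ 2 * \<epsilon> powr \<theta> - 1)) =
          (\<Sum>i\<in>UNIV. \<theta> * (\<mu> $ i * \<eta>') - \<theta> * (\<mu> $ i * m i) + \<mu> $ i * (2 * d ^ 2 * \<epsilon> powr \<theta>))"
          by (intro sum.cong) (simp_all add: b_def d_def algebra_simps)
        also have "\<dots> = \<theta> * (S * \<eta>' - ?K) + S * (2 * d ^ 2 * \<epsilon> powr \<theta>)"
          by (simp add: sum.distrib sum_subtractf S_def sum_distrib_left[symmetric] sum_distrib_right[symmetric] right_diff_distrib)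
        finally have "(\<Sum>i\<in>UNIV. \<mu> $ i * (b i + 2 * real CARD('d) ^ 2 * \<epsilon> powr \<theta> - 1)) / \<theta> =
            S * \<eta>' - ?K + S * (2 * d ^ 2) / \<theta> * \<epsilon> powr \<theta>"
          using \<theta>(1) by (simp add: add_divide_distrib)
        then show ?thesis using elim(1) \<eta>' that unfolding d_def by linarith
      qed
      ultimately show ?case
        by (auto elim!: eventually_mono intro: order_trans)
    qed
  qed
  show ?thesis
  proof (intro conjI allI impI)
    show "\<exists>r \<in> o[at_right 0](\<lambda>_. 1). \<forall>\<^sub>F \<epsilon> in at_right 0. AE \<omega> in M.
       \<gamma> \<epsilon> \<omega> \<le> ereal (- (\<Sum>i\<in>UNIV. \<mu> $ i * (MIN j\<in>UNIV - {i}. kl_div \<phi> (g i) (g j))) + r \<epsilon>)"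
      using upper unfolding m_def kl_def
      by (intro small_o_remainder) (auto elim!: eventually_mono intro: order_trans)
  next
    fix i\<^sub>1 i\<^sub>2 :: 'd assume A: "CARD('d) = 2 \<and> \<nu> \<noteq> \<nu>' \<and> i\<^sub>1 \<noteq> i\<^sub>2"
    have U: "(UNIV :: 'd set) = {i\<^sub>1, i\<^sub>2}"
      using A by (intro card_subset_eq[symmetric]) auto
    have U1: "UNIV - {i\<^sub>1} = {i\<^sub>2}" "UNIV - {i\<^sub>2} = {i\<^sub>1}" unfolding U using A by auto
    \<comment> \<open>Each minimum runs over a single state, so the general upper bound is already
      the sharp value.\<close>
    have K: "?K = \<mu> $ i\<^sub>1 * kl i\<^sub>1 i\<^sub>2 + \<mu> $ i\<^sub>2 * kl i\<^sub>2 i\<^sub>1"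
      unfolding m_def using A by (subst U) (simp add: U1)
    let ?c = "- \<mu> $ i\<^sub>1 * kl_div \<phi> (g i\<^sub>1) (g i\<^sub>2) - \<mu> $ i\<^sub>2 * kl_div \<phi> (g i\<^sub>2) (g i\<^sub>1)"
    show "\<exists>r \<in> o[at_right 0](\<lambda>_. 1). \<forall>\<^sub>F \<epsilon> in at_right 0. AE \<omega> in M. \<bar>\<gamma> \<epsilon> \<omega> - ereal ?c\<bar> \<le> ereal (r \<epsilon>)"
    proof (rule small_o_remainder)
      fix \<eta> :: real assume \<eta>: "\<eta> > 0"
      have "((\<lambda>\<epsilon> :: real. ln (1 - 2 * \<epsilon>)) \<longlongrightarrow> 0) (at_right 0)" by real_asymp
      then have "\<forall>\<^sub>F \<epsilon> in at_right 0. - \<eta> < ln (1 - 2 * \<epsilon> :: real)"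
        using \<eta> by (intro order_tendstoD(1)) auto
      moreover have "\<forall>\<^sub>F \<epsilon> in at_right 0. \<epsilon> \<in> {0<..<1 / 2 :: real}"
        by (rule eventually_at_right_real) simp
      ultimately show "\<forall>\<^sub>F \<epsilon> in at_right 0. AE \<omega> in M. \<bar>\<gamma> \<epsilon> \<omega> - ereal ?c\<bar> \<le> ereal \<eta>"
        using upper[OF \<eta>]
      proof eventually_elim
        case (elim \<epsilon>)
        then have \<epsilon>: "\<epsilon> \<in> {0<..<1}" by auto
        interpret comparable_hidden_chain M a \<nu> "slow \<Lambda> \<epsilon>" "X \<epsilon>" \<phi> g \<xi> by (rule chain[OF \<epsilon>])
        have "AE \<omega> in M. ereal (?c + ln (1 - 2 * \<epsilon>)) \<le> \<gamma> \<epsilon> \<omega>"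
          using elim(2) assms A \<epsilon> by (intro AE_stability_index_ge[OF refl _ _ _ _ U _ _ _ _ _ stability_index]) auto
        then show ?case
          using elim(3)
        proof eventually_elim
          case E: (elim \<omega>)
          have "ereal (?c - \<eta>) \<le> ereal (?c + ln (1 - 2 * \<epsilon>))" using elim(1) by simp
          also have "\<dots> \<le> \<gamma> \<epsilon> \<omega>" by (rule E(1))
          finally have "ereal (?c - \<eta>) \<le> \<gamma> \<epsilon> \<omega>" .
          moreover have "\<gamma> \<epsilon> \<omega> \<le> ereal (?c + \<eta>)" using E(2) unfolding K kl_def by simp
          ultimately show ?case by (intro abs_ereal_diff_le)
        qed
      qed
    qed (auto elim!: eventually_mono intro: order_trans)
  qed
qed

end
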